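(* Let $k$ be an algebraically closed field of characteristic $p>0$ and let $\mathcal L$ be a finite-dimensional restricted Lie algebra over $k$ with $p$th power map $x\mapsto x^{[p]}$. Let $n=\dim\mathcal L$, $e=e(\mathcal L)$, $s=MT(\mathcal L)$. Let $\psi_0,\ldots,\psi_{s-1}$ be homogeneous polynomial functions on $\mathcal L$, with $\deg\psi_i=p^{s+e}-p^{i+e}$, such that $$x^{[p]^{s+e}}=\sum_{i=0}^{s-1}\psi_i(x)\,x^{[p]^{i+e}}\qquad\text{for all }x\in\mathcal L.$$ Then the following are true: 1. $\psi_i(x^{[p]})=\psi_i(x)^p$ for all $x\in\mathcal L$ and all $0\le i\le s-1$. 2. The nilpotent variety $\mathcal N(\mathcal L)$ coincides with the set of all common zeros of $\psi_0,\ldots,\psi_{s-1}$ in $\mathcal L$. 3. All irreducible components of $\mathcal N(\mathcal L)$ have dimension $n-s$.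
   Context: $\mathcal N(\mathcal L)$ is the set of all $x\in\mathcal L$ with $x^{[p]^N}=0$ for $N\gg0$. Let $\pi:\mathcal L\to\mathcal L$, $\pi(x)=x^{[p]}$. An element $x\in\mathcal L$ is semisimple if it lies in the restricted subalgebra of $\mathcal L$ generated by $x^{[p]}$; $\mathcal L_{ss}$ denotes the set of semisimple elements. Define $$e(\mathcal L)=\min\{r\in\mathbb Z_{\ge0}\mid \pi^r(W)\subseteq\mathcal L_{ss}\text{ for some Zariski open dense }W\subseteq\mathcal L\}.$$ A restricted subalgebra $\mathfrak t\subseteq\mathcal L$ is toral (a torus) if the $p$th power map of $\mathcal L$ is injective on $\mathfrak t$. Define $MT(\mathcal L)=\max\{\dim\mathfrak t\mid\mathfrak t\text{ is toral in }\mathcal L\}$. It is a known result (Premet, 1989) that homogeneous polynomial functions $\psi_0,\dots,\psi_{s-1}$ with the stated degrees and identity exist for every such $\mathcal L$. *)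

theory Defs
  imports "HOL-Analysis.Abstract_Topology" "HOL-Computational_Algebra.Computational_Algebra"
    "HOL-Library.Extended_Nat"
begin

section \<open>Irreducibility and Krull dimension of topological spaces\<close>

definition irreducible_in :: "'a topology \<Rightarrow> 'a set \<Rightarrow> bool" where
  "irreducible_in X S \<longleftrightarrow> S \<subseteq> topspace X \<and> S \<noteq> {} \<and>
     (\<forall>A B. closedin X A \<and> closedin X B \<and> S \<subseteq> A \<union> B \<longrightarrow> S \<subseteq> A \<or> S \<subseteq> B)"

definition irreducible_components :: "'a topology \<Rightarrow> 'a set set" where
  "irreducible_components X =
     {Z. irreducible_in X Z \<and> (\<forall>Y. irreducible_in X Y \<and> Z \<subseteq> Y \<longrightarrow> Y = Z)}"

definition krull_dimension :: "'a topology \<Rightarrow> enat" where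
  "krull_dimension X = Sup {enat m | m. \<exists>C :: nat \<Rightarrow> 'a set.
     (\<forall>i\<le>m. closedin X (C i) \<and> irreducible_in X (C i)) \<and> (\<forall>i<m. C i \<subset> C (Suc i))}"


section \<open>Polynomial functions and the Zariski topology of a vector space\<close>

locale zariski_vector_space = vector_space scale
  for scale :: "'a::field \<Rightarrow> 'b::ab_group_add \<Rightarrow> 'b" (infixr \<open>*s\<close> 75)
begin

text \<open>The algebra of functions generated by the linear functionals.\<close>

inductive_set polynomial_functions :: "('b \<Rightarrow> 'a) set" where
  const: "(\<lambda>_. c) \<in> polynomial_functions"
| functional: "Vector_Spaces.linear scale (*) \<phi> \<Longrightarrow> \<phi> \<in> polynomial_functions"
| add: "f \<in> polynomial_functions \<Longrightarrow> g \<in> polynomial_functions \<Longrightarrow>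
    (\<lambda>x. f x + g x) \<in> polynomial_functions"
| mult: "f \<in> polynomial_functions \<Longrightarrow> g \<in> polynomial_functions \<Longrightarrow>
    (\<lambda>x. f x * g x) \<in> polynomial_functions"

text \<open>
  Linear combinations of products of \<open>d\<close> linear functionals, i.e. the image of the \<open>d\<close>-th
  symmetric power of the dual space. The zero function is homogeneous of every degree.
\<close>

inductive_set homogeneous_polynomial_functions :: "nat \<Rightarrow> ('b \<Rightarrow> 'a) set" for d :: nat where
  zero: "(\<lambda>_. 0) \<in> homogeneous_polynomial_functions d"
| add_term: "f \<in> homogeneous_polynomial_functions d \<Longrightarrow>
    (\<And>i. i < d \<Longrightarrow> Vector_Spaces.linear scale (*) (\<phi> i)) \<Longrightarrow>
    (\<lambda>x. f x + c * (\<Prod>i<d. \<phi> i x)) \<in> homogeneous_polynomial_functions d"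

definition zero_locus :: "('b \<Rightarrow> 'a) set \<Rightarrow> 'b set" where
  "zero_locus F = {x. \<forall>f\<in>F. f x = 0}"

definition zariski :: "'b topology" where
  "zariski = topology (\<lambda>U. \<exists>F\<subseteq>polynomial_functions. U = - zero_locus F)"

lemma istopology_zariski: "istopology (\<lambda>U. \<exists>F\<subseteq>polynomial_functions. U = - zero_locus F)"
  unfolding istopology_def
proof (intro conjI allI impI)
  fix S T
  assume "\<exists>F\<subseteq>polynomial_functions. S = - zero_locus F"
    and "\<exists>F\<subseteq>polynomial_functions. T = - zero_locus F"
  then obtain F G where FG: "F \<subseteq> polynomial_functions" "G \<subseteq> polynomial_functions"
    and ST: "S = - zero_locus F" "T = - zero_locus G" by blast
  define H where "H = (\<lambda>(f, g) x. f x * g x) ` (F \<times> G)"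
  have "H \<subseteq> polynomial_functions"
    using FG by (auto simp: H_def intro!: polynomial_functions.mult)
  moreover have "S \<inter> T = - zero_locus H"
    by (auto simp: ST H_def zero_locus_def)
  ultimately show "\<exists>F\<subseteq>polynomial_functions. S \<inter> T = - zero_locus F" by blast
next
  fix K
  assume "\<forall>U\<in>K. \<exists>F\<subseteq>polynomial_functions. U = - zero_locus F"
  then obtain F where F: "\<And>U. U \<in> K \<Longrightarrow> F U \<subseteq> polynomial_functions"
    "\<And>U. U \<in> K \<Longrightarrow> U = - zero_locus (F U)" by metis
  have "\<Union>K = - zero_locus (\<Union>U\<in>K. F U)"
    using F(2) by (fastforce simp: zero_locus_def)
  with F(1) show "\<exists>F\<subseteq>polynomial_functions. \<Union>K = - zero_locus F" by blast
qed

lemma openin_zariski: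
  "openin zariski U \<longleftrightarrow> (\<exists>F\<subseteq>polynomial_functions. U = - zero_locus F)"
  unfolding zariski_def using istopology_zariski by (simp add: topology_inverse')

lemma topspace_zariski [simp]: "topspace zariski = UNIV"
proof -
  have "openin zariski (- zero_locus {\<lambda>_. 1})"
    unfolding openin_zariski by (intro exI[of _ "{\<lambda>_. 1}"]) (auto intro: polynomial_functions.const)
  then show ?thesis
    using openin_subset by (fastforce simp: zero_locus_def)
qed

lemma closedin_zariski:
  "closedin zariski S \<longleftrightarrow> (\<exists>F\<subseteq>polynomial_functions. S = zero_locus F)"
  by (auto simp: closedin_def openin_zariski Compl_eq_Diff_UNIV[symmetric])

end


section \<open>Restricted Lie algebras\<close>

locale lie_algebra = zariski_vector_space scale
  for scale :: "'a::field \<Rightarrow> 'b::ab_group_add \<Rightarrow> 'b" (infixr \<open>*s\<close> 75) +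
  fixes lie :: "'b \<Rightarrow> 'b \<Rightarrow> 'b"
  assumes lie_add_left: "lie (x + y) z = lie x z + lie y z"
    and lie_add_right: "lie z (x + y) = lie z x + lie z y"
    and lie_scale_left: "lie (a *s x) y = a *s lie x y"
    and lie_scale_right: "lie x (a *s y) = a *s lie x y"
    and lie_self: "lie x x = 0"
    and jacobi: "lie x (lie y z) + lie y (lie z x) + lie z (lie x y) = 0"
begin

text \<open>
  \<open>ad_coeff x y z m j\<close> is the coefficient of \<open>t ^ j\<close> in \<open>ad (t x + y) ^ m\<close> applied to \<open>z\<close>,
  for an indeterminate \<open>t\<close>.
\<close>

fun ad_coeff :: "'b \<Rightarrow> 'b \<Rightarrow> 'b \<Rightarrow> nat \<Rightarrow> nat \<Rightarrow> 'b" where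
  "ad_coeff x y z 0 j = (if j = 0 then z else 0)"
| "ad_coeff x y z (Suc m) 0 = lie y (ad_coeff x y z m 0)"
| "ad_coeff x y z (Suc m) (Suc j) = lie x (ad_coeff x y z m j) + lie y (ad_coeff x y z m (Suc j))"

lemma lie_zero_right [simp]: "lie x 0 = 0"
  using lie_add_right[of x 0 0] by simp

lemma ad_coeff_eq_0: "m < j \<Longrightarrow> ad_coeff x y z m j = 0"
proof (induction m arbitrary: j)
  case (Suc m)
  then show ?case by (cases j) auto
qed simp

lemma lie_sum_right: "lie x (sum f A) = (\<Sum>i\<in>A. lie x (f i))"
  by (induction A rule: infinite_finite_induct) (auto simp: lie_add_right)

lemma ad_power_eq_sum_ad_coeff:
  "(lie (t *s x + y) ^^ m) z = (\<Sum>j\<le>m. t ^ j *s ad_coeff x y z m j)"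
proof (induction m)
  case (Suc m)
  let ?c = "ad_coeff x y z m"
  have "(lie (t *s x + y) ^^ Suc m) z = lie (t *s x + y) (\<Sum>j\<le>m. t ^ j *s ?c j)"
    by (simp add: Suc.IH)
  also have "\<dots> = (\<Sum>j\<le>m. t ^ Suc j *s lie x (?c j)) + (\<Sum>j\<le>m. t ^ j *s lie y (?c j))"
    by (simp add: lie_add_left lie_scale_left lie_sum_right lie_scale_right sum.distrib
        scale_sum_right scale_right_distrib mult_ac)
  also have "(\<Sum>j\<le>m. t ^ j *s lie y (?c j)) = (\<Sum>j\<le>Suc m. t ^ j *s lie y (?c j))"
    by (simp add: ad_coeff_eq_0)
  also have "\<dots> = lie y (?c 0) + (\<Sum>j\<le>m. t ^ Suc j *s lie y (?c (Suc j)))"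
    by (subst sum.atMost_Suc_shift) simp
  also have "(\<Sum>j\<le>m. t ^ Suc j *s lie x (?c j)) +
      (lie y (?c 0) + (\<Sum>j\<le>m. t ^ Suc j *s lie y (?c (Suc j)))) =
      (\<Sum>j\<le>Suc m. t ^ j *s ad_coeff x y z (Suc m) j)"
    by (subst sum.atMost_Suc_shift) (simp add: scale_right_distrib sum.distrib algebra_simps)
  finally show ?case .
qed simp

text \<open>
  The terms \<open>s\<^sub>i(x, y)\<close>, \<open>0 < i < p\<close>, in Jacobson's formula for \<open>(x + y)\<^sup>[\<^sup>p\<^sup>]\<close>, where \<open>p\<close> is the
  characteristic: \<open>i s\<^sub>i(x, y)\<close> is the coefficient of \<open>t ^ (i - 1)\<close> in \<open>ad (t x + y) ^ (p - 1)\<close>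
  applied to \<open>x\<close>.
\<close>

definition jacobson_term :: "nat \<Rightarrow> 'b \<Rightarrow> 'b \<Rightarrow> 'b" where
  "jacobson_term i x y = inverse (of_nat i) *s ad_coeff x y x (CHAR('a) - 1) (i - 1)"

end

locale restricted_lie_algebra = lie_algebra scale lie
  for scale :: "'a::field \<Rightarrow> 'b::ab_group_add \<Rightarrow> 'b" (infixr \<open>*s\<close> 75)
    and lie :: "'b \<Rightarrow> 'b \<Rightarrow> 'b" +
  fixes pmap :: "'b \<Rightarrow> 'b"
  assumes CHAR_positive: "CHAR('a) > 0"
    and pmap_scale: "pmap (a *s x) = a ^ CHAR('a) *s pmap x"
    and lie_pmap: "lie (pmap x) y = (lie x ^^ CHAR('a)) y"
    and pmap_add: "pmap (x + y) = pmap x + pmap y + (\<Sum>i = 1..<CHAR('a). jacobson_term i x y)"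
begin

definition restricted_subalgebra :: "'b set \<Rightarrow> bool" where
  "restricted_subalgebra H \<longleftrightarrow>
     subspace H \<and> (\<forall>x\<in>H. \<forall>y\<in>H. lie x y \<in> H) \<and> (\<forall>x\<in>H. pmap x \<in> H)"

definition nilpotent_variety :: "'b set" where
  "nilpotent_variety = {x. \<exists>N\<^sub>0. \<forall>N\<ge>N\<^sub>0. (pmap ^^ N) x = 0}"

definition semisimple_elements :: "'b set" where
  "semisimple_elements = {x. x \<in> restricted_subalgebra hull {pmap x}}"

definition toral :: "'b set \<Rightarrow> bool" where
  "toral T \<longleftrightarrow> restricted_subalgebra T \<and> inj_on pmap T"

text \<open>The invariants \<open>e(L)\<close> and \<open>MT(L)\<close>.\<close>

definition e_invariant :: nat where
  "e_invariant = (LEAST r. \<exists>W. openin zariski W \<and> zariski closure_of W = UNIV \<and>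
     (pmap ^^ r) ` W \<subseteq> semisimple_elements)"

definition max_toral_dim :: nat where
  "max_toral_dim = Max (dim ` {T. toral T})"

end

end

theory Submission
  imports Defs "HOL-Library.Function_Algebras"
begin

text \<open>
  A maximal torus has a basis of commuting elements fixed by the power map. In coordinates \<open>X i\<close>
  that extend this basis, the identity defining the \<open>\<psi> i\<close> reads
  \<open>X i ^ p ^ (s + e) = (\<Sum>l<s. \<psi> l * X i ^ p ^ (l + e))\<close> on the torus, so the \<open>\<psi> i\<close> restrict to powers
  of Dickson invariants there. Part 1 compares the identity for \<open>x\<^sup>[\<^sup>p\<^sup>]\<close> with the \<open>p\<close>-th power of the
  identity for \<open>x\<close>, at points where the iterates of \<open>x\<close> are independent; part 2 follows from it by
  iteration and homogeneity.

  For part 3, the relations of the Dickson invariants give a spanning family of the polynomial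
  functions as a module over the polynomials in the \<open>\<psi> i\<close> and the \<open>n - s\<close> coordinates \<open>y\<close> vanishing on
  the torus. Its generating degrees are so small that comparison with the number of monomials shows
  that the module is free. Hence nonzero polynomials in \<open>y\<close> are not zero divisors on the nilpotent
  variety, and every component is finite over the affine space with coordinates \<open>y\<close> and dominates it.
  Lying over then yields a chain of length \<open>n - s\<close>, and counting products of powers of separating
  functions shows that there is no longer one.
\<close>

section \<open>Linear algebra of function spaces\<close>

text \<open>Part 3 concerns every component, so a bound for the whole variety is not enough; some
  form of unmixedness is needed. It rests on a numerical coincidence. Dividing the additive
  polynomial of the torus by the factors of the \<open>p ^ j\<close> roots spanned by the first
  \<open>j\<close> coordinates, and evaluating at the next one, gives a relation with leading term
  \<open>X j ^ (p ^ (s + e) - p ^ (j + e))\<close>, and this exponent is exactly the degree of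
  \<open>\<psi> j\<close>. Trading that power for a factor \<open>\<psi> j\<close> matches monomials
  with generators one to one up to any degree, and no theory of heights or regular sequences enters.
  Freeness gives the functions on all fibres over \<open>y\<close> the same basis. The ideals of
  these fibres may fail to be radical, hence a Nullstellensatz whose exponent does not depend on the
  fibre. Polynomials are functions and ideals are sets of functions throughout; linear systems over
  a ring of functions are solved by elimination near a point instead of by determinants. This serves
  both the comparison of coefficients in part 1 and lying over in part 3.\<close>

definition fscale :: "'k::field \<Rightarrow> ('x \<Rightarrow> 'k) \<Rightarrow> 'x \<Rightarrow> 'k" where
  "fscale c f = (\<lambda>x. c * f x)"

lemma fscale_apply: "fscale c f x = c * f x"
  by (simp add: fscale_def)

interpretation fs: vector_space "fscale :: 'k::field \<Rightarrow> ('x \<Rightarrow> 'k) \<Rightarrow> 'x \<Rightarrow> 'k"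
  by unfold_locales (auto simp: fun_eq_iff fscale_apply algebra_simps)

lemma sum_fun_apply: "(\<Sum>i\<in>A. f i) x = (\<Sum>i\<in>A. f i x)"
  by (induction A rule: infinite_finite_induct) auto

text \<open>Coefficients are indexed by \<open>E\<close> rather than by the image, because the
  family \<open>\<Phi>\<close> is not known to be injective.\<close>

lemma span_imageE:
  assumes "f \<in> fs.span (\<Phi> ` E)" "finite E"
  obtains c where "f = (\<lambda>x. \<Sum>a\<in>E. c a * \<Phi> a x)"
proof -
  have "\<exists>c. f = (\<lambda>x. \<Sum>a\<in>E. c a * \<Phi> a x)"
    using assms(1)
  proof (induction rule: fs.span_induct_alt)
    case base
    then show ?case by (intro exI[of _ "\<lambda>_. 0"]) (auto simp: fun_eq_iff)
  next
    case (step c' g y)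
    then obtain a c where a: "a \<in> E" "g = \<Phi> a" and c: "y = (\<lambda>x. \<Sum>a\<in>E. c a * \<Phi> a x)" by blast
    have "fscale c' g + y = (\<lambda>x. \<Sum>b\<in>E. (c b + (if b = a then c' else 0)) * \<Phi> b x)"
      using a assms(2) by (auto simp: fun_eq_iff fscale_apply c distrib_right sum.distrib if_distrib[of "\<lambda>t. t * _"]
          cong: if_cong)
    then show ?case by (intro exI)
  qed
  then show ?thesis using that by blast
qed

lemma span_imageI:
  assumes "\<And>a. a \<in> E \<Longrightarrow> \<Phi> a \<in> fs.span S"
  shows "(\<lambda>x. \<Sum>a\<in>E. c a * \<Phi> a x) \<in> fs.span S"
proof -
  have "(\<lambda>x. \<Sum>a\<in>E. c a * \<Phi> a x) = (\<Sum>a\<in>E. fscale (c a) (\<Phi> a))"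
    by (simp add: fun_eq_iff sum_fun_apply fscale_apply)
  then show ?thesis using assms by (auto intro!: fs.span_sum fs.span_scale)
qed

lemma fspan_add: "f \<in> fs.span S \<Longrightarrow> g \<in> fs.span S \<Longrightarrow> (\<lambda>x. f x + g x) \<in> fs.span S"
  using fs.span_add[of f S g] by (simp add: plus_fun_def)

lemma fspan_scale: "f \<in> fs.span S \<Longrightarrow> (\<lambda>x. c * f x) \<in> fs.span S"
  using fs.span_scale[of f S c] by (simp add: fscale_def)

lemma fspan_zero: "(\<lambda>_. 0) \<in> fs.span S"
  using fs.span_zero[of S] by (simp add: zero_fun_def)

lemma fspan_sum:
  assumes "\<And>i. i \<in> A \<Longrightarrow> f i \<in> fs.span S"
  shows "(\<lambda>x. \<Sum>i\<in>A. f i x) \<in> fs.span S"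
  using assms
proof (induction A rule: infinite_finite_induct)
  case (insert i A)
  then show ?case using fspan_add[of "f i" S "\<lambda>x. \<Sum>i\<in>A. f i x"] by simp
qed (simp_all add: fspan_zero)

lemma fspan_mult:
  assumes "f \<in> fs.span S" "\<And>b. b \<in> S \<Longrightarrow> (\<lambda>x. t x * b x) \<in> fs.span T"
  shows "(\<lambda>x. t x * f x) \<in> fs.span T"
  using assms(1)
proof (induction rule: fs.span_induct_alt)
  case base
  then show ?case by (simp add: fspan_zero)
next
  case (step c b y)
  have "(\<lambda>x. c * (t x * b x) + t x * y x) \<in> fs.span T"
    using step assms(2) by (intro fspan_add fspan_scale)
  moreover have "(\<lambda>x. t x * (fscale c b + y) x) = (\<lambda>x. c * (t x * b x) + t x * y x)"
    by (simp add: fun_eq_iff fscale_apply algebra_simps)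
  ultimately show ?case by simp
qed

lemma family_dependent:
  fixes v :: "'i \<Rightarrow> 'x \<Rightarrow> 'k::field"
  assumes "finite A" "\<And>i. i \<in> A \<Longrightarrow> v i \<in> fs.span B" "finite B" "card B < card A"
  obtains \<alpha> where "\<exists>i\<in>A. \<alpha> i \<noteq> 0" "\<And>x. (\<Sum>i\<in>A. \<alpha> i * v i x) = 0"
proof (cases "inj_on v A")
  case True
  have "fs.dependent (v ` A)"
  proof (rule ccontr)
    assume "\<not> fs.dependent (v ` A)"
    then have "card (v ` A) \<le> card B"
      using fs.independent_span_bound[OF assms(3), of "v ` A"] assms(2) by blast
    then show False using assms(4) True by (simp add: card_image)
  qed
  then obtain u where u: "\<exists>f\<in>v ` A. u f \<noteq> 0" "(\<Sum>f\<in>v ` A. fscale (u f) f) = 0"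
    using fs.dependent_finite[of "v ` A"] assms(1) by auto
  show ?thesis
  proof
    show "\<exists>i\<in>A. (u \<circ> v) i \<noteq> 0" using u by auto
    fix x
    have "(\<Sum>f\<in>v ` A. fscale (u f) f) x = 0" using u by simp
    then show "(\<Sum>i\<in>A. (u \<circ> v) i * v i x) = 0"
      by (simp add: sum_fun_apply fscale_apply sum.reindex[OF True])
  qed
next
  case False
  then obtain i j where ij: "i \<in> A" "j \<in> A" "i \<noteq> j" "v i = v j" by (auto simp: inj_on_def)
  show ?thesis
  proof
    let ?\<alpha> = "\<lambda>l. (if l = i then 1 else 0) - (if l = j then 1 else 0 :: 'k)"
    show "\<exists>i\<in>A. ?\<alpha> i \<noteq> 0" using ij by (intro bexI[of _ i]) auto
    show "(\<Sum>i\<in>A. ?\<alpha> i * v i x) = 0" for x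
      using ij assms(1) by (simp add: left_diff_distrib sum_subtractf if_distrib[of "\<lambda>t. t * _"] cong: if_cong)
  qed
qed

text \<open>A repetition in the family counts as a dependence, which independence of the image set
  would hide; counting arguments need the former.\<close>

definition family_independent :: "'i set \<Rightarrow> ('i \<Rightarrow> 'x \<Rightarrow> 'k::field) \<Rightarrow> bool" where
  "family_independent A v \<longleftrightarrow> (\<forall>\<alpha>. (\<forall>x. (\<Sum>i\<in>A. \<alpha> i * v i x) = 0) \<longrightarrow> (\<forall>i\<in>A. \<alpha> i = 0))"

lemma family_independent_card_le:
  assumes "family_independent A v" "finite A" "\<And>i. i \<in> A \<Longrightarrow> v i \<in> fs.span B" "finite B"
  shows "card A \<le> card B"
  using family_dependent[of A v B] assms unfolding family_independent_def by (metis not_le)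

text \<open>A dependent family keeps its span after the loss of one member, so fewer than
  \<open>card E\<close> functions would span the \<open>card E\<close> independent functions
  \<open>m a\<close>.\<close>

lemma family_independent_if_spans:
  assumes E: "finite E" and m: "family_independent E m"
    and span: "\<And>a. a \<in> E \<Longrightarrow> m a \<in> fs.span (\<Phi> ` E)"
  shows "family_independent E \<Phi>"
  unfolding family_independent_def
proof (intro allI impI ballI)
  fix c a assume c: "\<forall>x. (\<Sum>b\<in>E. c b * \<Phi> b x) = 0" and a: "a \<in> E"
  show "c a = 0"
  proof (rule ccontr)
    assume nz: "c a \<noteq> 0"
    have eq: "\<Phi> a = (\<lambda>x. \<Sum>b\<in>E - {a}. (- c b / c a) * \<Phi> b x)"
    proof
      fix x
      have "c a * \<Phi> a x + (\<Sum>b\<in>E - {a}. c b * \<Phi> b x) = 0"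
        using c sum.remove[OF E a, of "\<lambda>b. c b * \<Phi> b x"] by simp
      then have "\<Phi> a x = - (\<Sum>b\<in>E - {a}. c b * \<Phi> b x) / c a"
        using nz by (simp add: field_simps add_eq_0_iff)
      then show "\<Phi> a x = (\<Sum>b\<in>E - {a}. (- c b / c a) * \<Phi> b x)"
        by (simp add: sum_negf sum_divide_distrib)
    qed
    have "\<Phi> a \<in> fs.span (\<Phi> ` (E - {a}))"
      by (subst eq, rule span_imageI) (auto intro: fs.span_base)
    then have "\<Phi> ` E \<subseteq> fs.span (\<Phi> ` (E - {a}))"
      by (auto intro: fs.span_base)
    then have "fs.span (\<Phi> ` E) \<subseteq> fs.span (\<Phi> ` (E - {a}))"
      by (simp add: fs.span_minimal)
    then have "card E \<le> card (\<Phi> ` (E - {a}))"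
      using family_independent_card_le[OF m E, of "\<Phi> ` (E - {a})"] span E by blast
    also have "\<dots> \<le> card (E - {a})" using E by (simp add: card_image_le)
    also have "\<dots> < card E" using E a by (rule card_Diff1_less)
    finally show False by simp
  qed
qed

section \<open>Polynomial functions\<close>

context zariski_vector_space
begin

lemma linear_functionalD:
  assumes "Vector_Spaces.linear scale (*) \<phi>"
  shows "\<phi> (x + y) = \<phi> x + \<phi> y" "\<phi> (c *s x) = c * \<phi> x" "\<phi> 0 = 0" "\<phi> (sum f A) = (\<Sum>i\<in>A. \<phi> (f i))"
    "\<phi> (x - y) = \<phi> x - \<phi> y"
proof -
  interpret Vector_Spaces.linear scale "(*)" \<phi> by (fact assms)
  show "\<phi> (x + y) = \<phi> x + \<phi> y" "\<phi> (c *s x) = c * \<phi> x" "\<phi> 0 = 0" "\<phi> (sum f A) = (\<Sum>i\<in>A. \<phi> (f i))"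
    "\<phi> (x - y) = \<phi> x - \<phi> y"
    by (simp_all add: add scale zero sum diff)
qed

lemma polynomial_functions_scale:
  "f \<in> polynomial_functions \<Longrightarrow> (\<lambda>x. c * f x) \<in> polynomial_functions"
  by (intro polynomial_functions.mult polynomial_functions.const)

lemma polynomial_functions_uminus:
  "f \<in> polynomial_functions \<Longrightarrow> (\<lambda>x. - f x) \<in> polynomial_functions"
  using polynomial_functions_scale[of f "-1"] by simp

lemma polynomial_functions_diff:
  "f \<in> polynomial_functions \<Longrightarrow> g \<in> polynomial_functions \<Longrightarrow> (\<lambda>x. f x - g x) \<in> polynomial_functions"
  using polynomial_functions.add[of f "\<lambda>x. - g x"] polynomial_functions_uminus[of g] by simp

lemma polynomial_functions_sum:
  "(\<And>i. i \<in> A \<Longrightarrow> f i \<in> polynomial_functions) \<Longrightarrow> (\<lambda>x. \<Sum>i\<in>A. f i x) \<in> polynomial_functions"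
  by (induction A rule: infinite_finite_induct)
    (auto intro: polynomial_functions.const polynomial_functions.add)

lemma polynomial_functions_prod:
  "(\<And>i. i \<in> A \<Longrightarrow> f i \<in> polynomial_functions) \<Longrightarrow> (\<lambda>x. \<Prod>i\<in>A. f i x) \<in> polynomial_functions"
  by (induction A rule: infinite_finite_induct)
    (auto intro: polynomial_functions.const polynomial_functions.mult)

lemma polynomial_functions_power:
  "f \<in> polynomial_functions \<Longrightarrow> (\<lambda>x. f x ^ m) \<in> polynomial_functions"
  by (induction m) (auto intro: polynomial_functions.const polynomial_functions.mult)

lemma polynomial_functions_poly:
  "f \<in> polynomial_functions \<Longrightarrow> (\<lambda>x. poly q (f x)) \<in> polynomial_functions"
  by (induction q) (auto intro!: polynomial_functions.const polynomial_functions.mult polynomial_functions.add)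

lemmas polynomial_functions_intros = polynomial_functions.const polynomial_functions.add polynomial_functions.mult polynomial_functions_uminus
  polynomial_functions_diff polynomial_functions_sum polynomial_functions_prod
  polynomial_functions_power

lemma homogeneous_polynomial_function:
  assumes "f \<in> homogeneous_polynomial_functions d"
  shows "f \<in> polynomial_functions"
  using assms by induction (auto intro!: polynomial_functions_intros intro: polynomial_functions.functional)

lemma homogeneous_at_0:
  assumes "f \<in> homogeneous_polynomial_functions d" "d > 0"
  shows "f 0 = 0"
  using assms(1)
proof induction
  case (add_term f \<phi> c)
  have "(\<Prod>i<d. \<phi> i 0) = 0"
    using assms(2) add_term(2)[of 0] linear_functionalD(3)[of "\<phi> 0"]
    by (intro prod_zero) (auto intro!: bexI[of _ 0])
  then show ?case using add_term by simp
qed simp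

lemma polynomial_functions_compose_polynomial_map:
  assumes "f \<in> polynomial_functions"
    and "\<And>\<phi>. Vector_Spaces.linear scale (*) \<phi> \<Longrightarrow> (\<lambda>x. \<phi> (F x)) \<in> polynomial_functions"
  shows "(\<lambda>x. f (F x)) \<in> polynomial_functions"
  using assms(1) by induction (auto intro: assms(2) polynomial_functions_intros)

lemma polynomial_function_on_line:
  assumes "f \<in> polynomial_functions"
  shows "\<exists>q. \<forall>t. f (u + t *s v) = poly q t"
  using assms
proof induction
  case (const c)
  then show ?case by (intro exI[of _ "[:c:]"]) simp
next
  case (functional \<phi>)
  then show ?case
    by (intro exI[of _ "[:\<phi> u, \<phi> v:]"]) (simp add: linear_functionalD[of \<phi>])
next
  case (add f g)
  then show ?case by (metis poly_add)
next
  case (mult f g)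
  then show ?case by (metis poly_mult)
qed

section \<open>Irreducible sets and prime vanishing ideals\<close>

text \<open>The vanishing ideal of \<open>C\<close> is prime. The set itself need not be
  closed.\<close>

definition prime_set :: "'b set \<Rightarrow> bool" where
  "prime_set C \<longleftrightarrow> C \<noteq> {} \<and> (\<forall>f\<in>polynomial_functions. \<forall>g\<in>polynomial_functions.
     (\<forall>x\<in>C. f x * g x = 0) \<longrightarrow> (\<forall>x\<in>C. f x = 0) \<or> (\<forall>x\<in>C. g x = 0))"

lemma prime_setD:
  "prime_set C \<Longrightarrow> f \<in> polynomial_functions \<Longrightarrow> g \<in> polynomial_functions \<Longrightarrow>
    (\<And>x. x \<in> C \<Longrightarrow> f x * g x = 0) \<Longrightarrow> \<exists>x\<in>C. f x \<noteq> 0 \<Longrightarrow> x \<in> C \<Longrightarrow> g x = 0"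
  unfolding prime_set_def by blast

lemma prime_set_prod:
  assumes "prime_set C" "finite A" "\<And>i. i \<in> A \<Longrightarrow> f i \<in> polynomial_functions"
    "\<And>i. i \<in> A \<Longrightarrow> \<exists>x\<in>C. f i x \<noteq> 0"
  shows "\<exists>x\<in>C. (\<Prod>i\<in>A. f i x) \<noteq> 0"
  using assms(2-)
proof (induction A rule: finite_induct)
  case empty
  then show ?case using assms(1) by (auto simp: prime_set_def)
next
  case (insert i A)
  then have "\<exists>x\<in>C. (\<Prod>i\<in>A. f i x) \<noteq> 0" by auto
  moreover have "f i \<in> polynomial_functions" "(\<lambda>x. \<Prod>i\<in>A. f i x) \<in> polynomial_functions"
    using insert by (auto intro!: polynomial_functions_prod)
  moreover have "\<exists>x\<in>C. f i x \<noteq> 0" using insert.prems by simp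
  ultimately have "\<not> (\<forall>x\<in>C. f i x * (\<Prod>i\<in>A. f i x) = 0)"
    using assms(1)[unfolded prime_set_def, THEN conjunct2, THEN bspec, of "f i",
      THEN bspec, of "\<lambda>x. \<Prod>i\<in>A. f i x"] by blast
  then show ?case using insert(1,2) by simp
qed

text \<open>A closed set that does not contain \<open>C\<close> lies in a hypersurface that does not
  contain \<open>C\<close> either, so products of two functions detect reducibility.\<close>

lemma irreducible_in_zariski_iff: "irreducible_in zariski C \<longleftrightarrow> prime_set C"
proof
  assume irr: "irreducible_in zariski C"
  show "prime_set C"
    unfolding prime_set_def
  proof (intro conjI ballI impI)
    show "C \<noteq> {}" using irr by (simp add: irreducible_in_def)
    fix f g assume fg: "f \<in> polynomial_functions" "g \<in> polynomial_functions" "\<forall>x\<in>C. f x * g x = 0"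
    have "closedin zariski (zero_locus {f})" "closedin zariski (zero_locus {g})"
      using fg by (auto simp: closedin_zariski)
    moreover have "C \<subseteq> zero_locus {f} \<union> zero_locus {g}" using fg by (auto simp: zero_locus_def)
    ultimately have "C \<subseteq> zero_locus {f} \<or> C \<subseteq> zero_locus {g}"
      using irr by (simp add: irreducible_in_def)
    then show "(\<forall>x\<in>C. f x = 0) \<or> (\<forall>x\<in>C. g x = 0)" by (auto simp: zero_locus_def)
  qed
next
  assume pr: "prime_set C"
  show "irreducible_in zariski C"
    unfolding irreducible_in_def
  proof (intro conjI allI impI)
    show "C \<noteq> {}" using pr by (simp add: prime_set_def)
    fix A B assume AB: "closedin zariski A \<and> closedin zariski B \<and> C \<subseteq> A \<union> B"
    then obtain F G where FG: "F \<subseteq> polynomial_functions" "A = zero_locus F"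
      "G \<subseteq> polynomial_functions" "B = zero_locus G" by (auto simp: closedin_zariski)
    show "C \<subseteq> A \<or> C \<subseteq> B"
    proof (rule ccontr)
      assume "\<not> (C \<subseteq> A \<or> C \<subseteq> B)"
      then obtain f g where fg: "f \<in> F" "\<exists>x\<in>C. f x \<noteq> 0" "g \<in> G" "\<exists>x\<in>C. g x \<noteq> 0"
        by (auto simp: FG zero_locus_def)
      have "f x * g x = 0" if "x \<in> C" for x
        using AB that fg by (auto simp: FG zero_locus_def)
      then show False using prime_setD[OF pr, of f g] fg FG by blast
    qed
  qed simp
qed

text \<open>On the line through a point with \<open>f \<noteq> 0\<close> and a point with
  \<open>g \<noteq> 0\<close>, both functions are nonzero univariate polynomials, and their product
  has only finitely many roots.\<close>

lemma prime_set_line_closed: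
  assumes inf: "infinite (UNIV :: 'a set)" and "C \<noteq> {}"
    and line: "\<And>u v t. u \<in> C \<Longrightarrow> v \<in> C \<Longrightarrow> u + t *s (v - u) \<in> C"
  shows "prime_set C"
  unfolding prime_set_def
proof (intro conjI ballI impI)
  fix f g assume fg: "f \<in> polynomial_functions" "g \<in> polynomial_functions" "\<forall>x\<in>C. f x * g x = 0"
  show "(\<forall>x\<in>C. f x = 0) \<or> (\<forall>x\<in>C. g x = 0)"
  proof (rule ccontr)
    assume "\<not> ?thesis"
    then obtain u v where uv: "u \<in> C" "v \<in> C" "f u \<noteq> 0" "g v \<noteq> 0" by blast
    obtain q r where q: "\<And>t. f (u + t *s (v - u)) = poly q t" and r: "\<And>t. g (u + t *s (v - u)) = poly r t"
      using polynomial_function_on_line fg by metis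
    have "q \<noteq> 0" using q[of 0] uv by auto
    have "r \<noteq> 0" using r[of 1] uv by auto
    have "poly (q * r) t = 0" for t
      using fg(3) line[OF uv(1,2), of t] by (simp add: q[symmetric] r[symmetric])
    then have "{t. poly (q * r) t = 0} = UNIV" by auto
    then have "q * r = 0" using poly_roots_finite[of "q * r"] inf by auto
    then show False using \<open>q \<noteq> 0\<close> \<open>r \<noteq> 0\<close> by simp
  qed
qed fact

text \<open>
  Divide a relation by the lowest power of the last function, which is not a zero divisor on the
  last set, and restrict the quotient to the preceding set of the chain.
\<close>

lemma chain_independent:
  assumes "\<And>i. i \<le> m \<Longrightarrow> prime_set (C i)" "\<And>i. i < m \<Longrightarrow> C i \<subseteq> C (Suc i)"
    "\<And>i. i < m \<Longrightarrow> f i \<in> polynomial_functions"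
    "\<And>i x. i < m \<Longrightarrow> x \<in> C i \<Longrightarrow> f i x = 0" "\<And>i. i < m \<Longrightarrow> \<exists>x\<in>C (Suc i). f i x \<noteq> 0"
    "finite A" "\<And>a i. a \<in> A \<Longrightarrow> i \<ge> m \<Longrightarrow> a i = (0::nat)"
    "\<And>x. x \<in> C m \<Longrightarrow> (\<Sum>a\<in>A. c a * (\<Prod>i<m. f i x ^ a i)) = 0" "a \<in> A"
  shows "c a = 0"
  using assms
proof (induction m arbitrary: A c a)
  case 0
  then have "a = (\<lambda>_. 0)" "A \<subseteq> {\<lambda>_. 0}" by auto
  then have "A = {a}" using 0 by auto
  moreover obtain x where "x \<in> C 0" using 0(1)[of 0] by (auto simp: prime_set_def)
  ultimately show ?case using "0.prems"(8)[of x] by simp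
next
  case (Suc m)
  show ?case
  proof (rule ccontr)
    assume nz: "c a \<noteq> 0"
    \<comment> \<open>Zero coefficients must go first, or the lowest power of \<open>f m\<close>
      might occur only with coefficient 0.\<close>
    define A' where "A' = {b \<in> A. c b \<noteq> 0}"
    have A': "finite A'" "a \<in> A'" using Suc.prems nz by (auto simp: A'_def)
    define j where "j = Min ((\<lambda>b. b m) ` A')"
    have j: "j \<le> b m" if "b \<in> A'" for b using that A' by (auto simp: j_def)
    have "j \<in> (\<lambda>b. b m) ` A'" unfolding j_def using A' by (intro Min_in) auto
    then obtain a0 where a0: "a0 \<in> A'" "a0 m = j" by auto
    define g where "g = (\<lambda>x. \<Sum>b\<in>A'. c b * ((\<Prod>i<m. f i x ^ b i) * f m x ^ (b m - j)))"
    have gR: "g \<in> polynomial_functions"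
      using Suc.prems(3) by (auto simp: g_def intro!: polynomial_functions_intros)
    have fR: "(\<lambda>x. f m x ^ j) \<in> polynomial_functions"
      using Suc.prems(3) by (auto intro!: polynomial_functions_intros)
    have "f m x ^ j * g x = 0" if "x \<in> C (Suc m)" for x
    proof -
      have "f m x ^ j * g x = (\<Sum>b\<in>A'. c b * (\<Prod>i<Suc m. f i x ^ b i))"
        unfolding g_def sum_distrib_left
      proof (rule sum.cong[OF refl])
        fix b assume "b \<in> A'"
        then have "f m x ^ b m = f m x ^ j * f m x ^ (b m - j)"
          using j by (simp add: power_add[symmetric])
        then show "f m x ^ j * (c b * ((\<Prod>i<m. f i x ^ b i) * f m x ^ (b m - j))) =
            c b * (\<Prod>i<Suc m. f i x ^ b i)" by (simp add: mult_ac)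
      qed
      also have "\<dots> = (\<Sum>b\<in>A. c b * (\<Prod>i<Suc m. f i x ^ b i))"
        using Suc.prems(6) by (intro sum.mono_neutral_left) (auto simp: A'_def)
      finally show ?thesis using Suc.prems(8)[OF that] by simp
    qed
    moreover have "\<exists>x\<in>C (Suc m). f m x ^ j \<noteq> 0" using Suc.prems(5)[of m] by auto
    ultimately have g0: "g x = 0" if "x \<in> C (Suc m)" for x
      using prime_setD[OF Suc.prems(1)[of "Suc m"] fR gR] that by auto
    \<comment> \<open>On \<open>C m\<close> the function \<open>f m\<close> vanishes, so only the
      terms of the quotient \<open>g\<close> with \<open>b m = j\<close> survive. Erasing this
      common exponent is injective on them and leaves exponents supported below \<open>m\<close>, as
      the induction hypothesis requires.\<close>
    define A0 where "A0 = {b \<in> A'. b m = j}"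
    define z where "z = (\<lambda>b::nat\<Rightarrow>nat. b(m := 0))"
    have inj: "inj_on z A0"
    proof (rule inj_onI)
      fix b b' assume "b \<in> A0" "b' \<in> A0" "z b = z b'"
      then show "b = b'" unfolding z_def A0_def
        by (metis (mono_tags, lifting) fun_upd_triv fun_upd_upd mem_Collect_eq)
    qed
    have fin: "finite A0" using A' by (simp add: A0_def)
    have "(c \<circ> the_inv_into A0 z) (z a0) = 0"
    proof (rule Suc.IH[where A = "z ` A0" and c = "c \<circ> the_inv_into A0 z" and a = "z a0"])
      fix x assume x: "x \<in> C m"
      have fm: "f m x = 0" using Suc.prems(4)[of m] x by simp
      have "0 = g x" using g0 x Suc.prems(2)[of m] by auto
      also have "\<dots> = (\<Sum>b\<in>A0. c b * (\<Prod>i<m. f i x ^ b i))"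
      proof -
        have "g x = (\<Sum>b\<in>A0. c b * ((\<Prod>i<m. f i x ^ b i) * f m x ^ (b m - j)))"
          unfolding g_def
        proof (rule sum.mono_neutral_right)
          show "\<forall>b\<in>A' - A0. c b * ((\<Prod>i<m. f i x ^ b i) * f m x ^ (b m - j)) = 0"
          proof
            fix b assume "b \<in> A' - A0"
            then have "b m - j > 0" using j[of b] by (auto simp: A0_def)
            then show "c b * ((\<Prod>i<m. f i x ^ b i) * f m x ^ (b m - j)) = 0" by (simp add: fm)
          qed
        qed (use A' in \<open>auto simp: A0_def\<close>)
        also have "\<dots> = (\<Sum>b\<in>A0. c b * (\<Prod>i<m. f i x ^ b i))"
          by (intro sum.cong) (auto simp: A0_def)
        finally show ?thesis .
      qed
      also have "\<dots> = (\<Sum>b\<in>z ` A0. (c \<circ> the_inv_into A0 z) b * (\<Prod>i<m. f i x ^ b i))"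
      proof -
        have "c b * (\<Prod>i<m. f i x ^ b i) = c (the_inv_into A0 z (z b)) * (\<Prod>i<m. f i x ^ z b i)"
          if "b \<in> A0" for b
          using that by (simp add: the_inv_into_f_f[OF inj]) (simp add: z_def)
        then show ?thesis unfolding sum.reindex[OF inj] by (simp cong: sum.cong)
      qed
      finally show "(\<Sum>b\<in>z ` A0. (c \<circ> the_inv_into A0 z) b * (\<Prod>i<m. f i x ^ b i)) = 0" by simp
    next
      show "z a0 \<in> z ` A0" using a0 by (auto simp: A0_def)
      fix b i assume "b \<in> z ` A0" "m \<le> i"
      then show "b i = 0"
        using Suc.prems(7)[of _ i] by (cases "i = m") (auto simp: z_def A0_def A'_def)
    qed (use Suc.prems fin in auto)
    moreover have "a0 \<in> A0" using a0 by (simp add: A0_def)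
    ultimately show False using a0 by (simp add: the_inv_into_f_f[OF inj] A'_def)
  qed
qed

end

section \<open>Coordinates and monomials\<close>

locale coordinates = zariski_vector_space scale
  for scale :: "'a::field \<Rightarrow> 'b::ab_group_add \<Rightarrow> 'b" (infixr \<open>*s\<close> 75) +
  fixes n :: nat and bs :: "nat \<Rightarrow> 'b" and X :: "nat \<Rightarrow> 'b \<Rightarrow> 'a"
  assumes infinite_field: "infinite (UNIV :: 'a set)"
    and linear_X: "i < n \<Longrightarrow> Vector_Spaces.linear scale (*) (X i)"
    and X_bs: "i < n \<Longrightarrow> j < n \<Longrightarrow> X i (bs j) = (if i = j then 1 else 0)"
    and X_expansion: "(\<Sum>i<n. X i x *s bs i) = x"
begin

lemma X_poly: "i < n \<Longrightarrow> X i \<in> polynomial_functions"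
  by (simp add: polynomial_functions.functional linear_X)

lemma X_comb: "i < n \<Longrightarrow> J \<subseteq> {..<n} \<Longrightarrow> X i (\<Sum>j\<in>J. c j *s bs j) = (if i \<in> J then c i else 0)"
  using finite_subset[of J "{..<n}"]
  by (auto simp: linear_functionalD[OF linear_X] X_bs subset_iff if_distrib[of "\<lambda>t. _ * t"] cong: if_cong
      intro!: sum.neutral)

lemma functional_expansion:
  "Vector_Spaces.linear scale (*) \<phi> \<Longrightarrow> \<phi> x = (\<Sum>i<n. \<phi> (bs i) * X i x)"
  by (subst X_expansion[of x, symmetric]) (simp add: linear_functionalD mult.commute)

lemma polynomial_functions_coordinate_induct [consumes 1, case_names const X add mult]:
  assumes "f \<in> polynomial_functions" "\<And>c. Q (\<lambda>_. c)" "\<And>i. i < n \<Longrightarrow> Q (X i)"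
    "\<And>f g. f \<in> polynomial_functions \<Longrightarrow> Q f \<Longrightarrow> g \<in> polynomial_functions \<Longrightarrow> Q g \<Longrightarrow> Q (\<lambda>x. f x + g x)"
    "\<And>f g. f \<in> polynomial_functions \<Longrightarrow> Q f \<Longrightarrow> g \<in> polynomial_functions \<Longrightarrow> Q g \<Longrightarrow> Q (\<lambda>x. f x * g x)"
  shows "Q f"
  using assms(1)
proof induction
  case (functional \<phi>)
  have "Q (\<lambda>x. \<Sum>i<m. \<phi> (bs i) * X i x)" if "m \<le> n" for m
    using that
  proof (induction m)
    case (Suc m)
    have "Q (\<lambda>x. \<phi> (bs m) * X m x)"
      using Suc.prems by (intro assms(5)[of "\<lambda>_. \<phi> (bs m)" "X m"] assms(2) assms(3) polynomial_functions.const X_poly) auto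
    then have "Q (\<lambda>x. (\<Sum>i<m. \<phi> (bs i) * X i x) + \<phi> (bs m) * X m x)"
      using Suc by (intro assms(4)[of "\<lambda>x. \<Sum>i<m. \<phi> (bs i) * X i x" "\<lambda>x. \<phi> (bs m) * X m x"]
          polynomial_functions_sum polynomial_functions_scale X_poly) auto
    then show ?case by simp
  qed (use assms(2) in simp)
  then have "Q (\<lambda>x. \<Sum>i<n. \<phi> (bs i) * X i x)" by simp
  moreover have "\<phi> = (\<lambda>x. \<Sum>i<n. \<phi> (bs i) * X i x)"
    by (rule ext) (rule functional_expansion[OF functional])
  ultimately show ?case by simp
next
  case (const c)
  show ?case by (rule assms(2))
next
  case (add f g)
  show ?case by (rule assms(4)[OF add.hyps(1) add.IH(1) add.hyps(2) add.IH(2)])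
next
  case (mult f g)
  show ?case by (rule assms(5)[OF mult.hyps(1) mult.IH(1) mult.hyps(2) mult.IH(2)])
qed

section \<open>Monomials and the degree filtration\<close>

definition mon :: "(nat \<Rightarrow> nat) \<Rightarrow> 'b \<Rightarrow> 'a" where
  "mon a x = (\<Prod>i<n. X i x ^ a i)"

definition wdeg :: "(nat \<Rightarrow> nat) \<Rightarrow> nat" where
  "wdeg a = (\<Sum>i<n. a i)"

text \<open>Exponents vanish from \<open>n\<close> on, so that the set is finite and an exponent
  vector is determined by its monomial.\<close>

definition exps :: "nat \<Rightarrow> nat \<Rightarrow> (nat \<Rightarrow> nat) set" where
  "exps j d = {a. (\<forall>i. a i \<noteq> 0 \<longrightarrow> i < j \<and> i < n) \<and> wdeg a \<le> d}"

text \<open>A filtration by degree in place of a grading: the counting arguments only use upper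
  bounds for degrees.\<close>

definition polys :: "nat \<Rightarrow> nat \<Rightarrow> ('b \<Rightarrow> 'a) set" where
  "polys j d = fs.span (mon ` exps j d)"

lemma mon_poly: "mon a \<in> polynomial_functions"
  unfolding mon_def[abs_def] by (auto intro!: polynomial_functions_intros X_poly)

lemma mon_add: "mon (\<lambda>i. a i + b i) x = mon a x * mon b x"
  by (simp add: mon_def power_add prod.distrib)

lemma wdeg_add: "wdeg (\<lambda>i. a i + b i) = wdeg a + wdeg b"
  by (simp add: wdeg_def sum.distrib)

lemma mon_0: "mon (\<lambda>_. 0) x = 1"
  by (simp add: mon_def)

lemma mon_single: "j < n \<Longrightarrow> mon (\<lambda>i. if i = j then m else 0) x = X j x ^ m"
  by (simp add: mon_def if_distrib[of "\<lambda>k. _ ^ k"] cong: if_cong)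

lemma wdeg_single: "j < n \<Longrightarrow> wdeg (\<lambda>i. if i = j then m else 0) = m"
  by (simp add: wdeg_def)

lemma wdeg_ge: "i < n \<Longrightarrow> a i \<le> wdeg a"
  unfolding wdeg_def by (rule member_le_sum) auto

lemma exps_add: "a \<in> exps j d \<Longrightarrow> b \<in> exps j d' \<Longrightarrow> (\<lambda>i. a i + b i) \<in> exps j (d + d')"
  by (auto simp: exps_def wdeg_add)

lemma exps_mono: "j \<le> j' \<Longrightarrow> d \<le> d' \<Longrightarrow> exps j d \<subseteq> exps j' d'"
  by (auto simp: exps_def intro: less_le_trans)

lemma finite_bounded_funs: "finite {a :: nat \<Rightarrow> nat. (\<forall>i. a i \<noteq> 0 \<longrightarrow> i < n) \<and> (\<forall>i<n. a i \<le> B)}"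
proof -
  have "{a :: nat \<Rightarrow> nat. (\<forall>i. a i \<noteq> 0 \<longrightarrow> i < n) \<and> (\<forall>i<n. a i \<le> B)} \<subseteq>
      {f. \<forall>i. (i \<in> {..<n} \<longrightarrow> f i \<in> {..B}) \<and> (i \<notin> {..<n} \<longrightarrow> f i = 0)}" by auto
  then show ?thesis
    using finite_set_of_finite_funs[of "{..<n}" "{..B}" "0::nat"] finite_subset by blast
qed

lemma finite_exps: "finite (exps j d)"
  by (rule finite_subset[OF _ finite_bounded_funs[of d]]) (auto simp: exps_def intro: order_trans[OF wdeg_ge])

lemma polys_mono: "j \<le> j' \<Longrightarrow> d \<le> d' \<Longrightarrow> polys j d \<subseteq> polys j' d'"
  unfolding polys_def by (intro fs.span_mono image_mono exps_mono)

lemma mon_polys: "a \<in> exps j d \<Longrightarrow> mon a \<in> polys j d"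
  by (auto simp: polys_def intro: fs.span_base)

lemma polys_subset: "polys j d \<subseteq> polynomial_functions"
proof
  fix f assume "f \<in> polys j d"
  then obtain c where "f = (\<lambda>x. \<Sum>a\<in>exps j d. c a * mon a x)"
    unfolding polys_def using finite_exps by (rule span_imageE)
  then show "f \<in> polynomial_functions" by (auto intro!: polynomial_functions_intros mon_poly)
qed

lemma polys_add: "f \<in> polys j d \<Longrightarrow> g \<in> polys j d \<Longrightarrow> (\<lambda>x. f x + g x) \<in> polys j d"
  unfolding polys_def by (rule fspan_add)

lemma polys_scale: "f \<in> polys j d \<Longrightarrow> (\<lambda>x. c * f x) \<in> polys j d"
  unfolding polys_def by (rule fspan_scale)

lemma polys_diff: "f \<in> polys j d \<Longrightarrow> g \<in> polys j d \<Longrightarrow> (\<lambda>x. f x - g x) \<in> polys j d"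
  using polys_add[of f j d "\<lambda>x. -1 * g x"] polys_scale[of g j d "-1"] by simp

lemma polys_0: "(\<lambda>_. 0) \<in> polys j d"
  unfolding polys_def by (rule fspan_zero)

lemma polys_sum: "(\<And>i. i \<in> A \<Longrightarrow> f i \<in> polys j d) \<Longrightarrow> (\<lambda>x. \<Sum>i\<in>A. f i x) \<in> polys j d"
  unfolding polys_def by (rule fspan_sum)

lemma polys_const: "(\<lambda>_. c) \<in> polys j d"
proof -
  have "(\<lambda>x. c * mon (\<lambda>_. 0) x) \<in> polys j d"
    by (intro polys_scale mon_polys) (auto simp: exps_def wdeg_def)
  then show ?thesis by (simp add: mon_0)
qed

lemma polys_X_power: "i < j \<Longrightarrow> i < n \<Longrightarrow> (\<lambda>x. X i x ^ m) \<in> polys j m"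
proof -
  assume i: "i < j" "i < n"
  have "(\<lambda>x. X i x ^ m) = mon (\<lambda>l. if l = i then m else 0)"
    using i by (simp add: fun_eq_iff mon_single)
  then show ?thesis using i by (auto intro!: mon_polys simp: exps_def wdeg_single split: if_splits)
qed

lemma polys_X: "i < j \<Longrightarrow> i < n \<Longrightarrow> X i \<in> polys j 1"
  using polys_X_power[of i j 1] by simp

lemma polys_mult:
  assumes f: "f \<in> polys j d" and g: "g \<in> polys j d'"
  shows "(\<lambda>x. f x * g x) \<in> polys j (d + d')"
proof -
  have "(\<lambda>x. g x * f x) \<in> polys j (d + d')"
    using f unfolding polys_def[of j d] polys_def[of j "d + d'"]
  proof (rule fspan_mult)
    fix h assume "h \<in> mon ` exps j d"
    then obtain a where a: "a \<in> exps j d" "h = mon a" by auto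
    have "(\<lambda>x. mon a x * g x) \<in> fs.span (mon ` exps j (d + d'))"
      using g unfolding polys_def[of j d']
    proof (rule fspan_mult)
      fix h' assume "h' \<in> mon ` exps j d'"
      then obtain b where b: "b \<in> exps j d'" "h' = mon b" by auto
      have "mon (\<lambda>i. a i + b i) \<in> fs.span (mon ` exps j (d + d'))"
        using a b by (intro fs.span_base imageI exps_add)
      then show "(\<lambda>x. mon a x * h' x) \<in> fs.span (mon ` exps j (d + d'))"
        by (simp only: b(2) mon_add[abs_def])
    qed
    then show "(\<lambda>x. g x * h x) \<in> fs.span (mon ` exps j (d + d'))" by (simp add: a(2) mult.commute)
  qed
  then show ?thesis by (simp add: mult.commute)
qed

lemma polys_power: "f \<in> polys j d \<Longrightarrow> (\<lambda>x. f x ^ m) \<in> polys j (m * d)"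
proof (induction m)
  case (Suc m)
  then show ?case using polys_mult[of f j d "\<lambda>x. f x ^ m" "m * d"] by simp
qed (simp add: polys_const)

lemma polys_prod: "finite A \<Longrightarrow> (\<And>i. i \<in> A \<Longrightarrow> f i \<in> polys j (d i)) \<Longrightarrow>
    (\<lambda>x. \<Prod>i\<in>A. f i x) \<in> polys j (\<Sum>i\<in>A. d i)"
proof (induction A rule: finite_induct)
  case (insert i A)
  then show ?case using polys_mult[of "f i" j "d i" "\<lambda>x. \<Prod>i\<in>A. f i x" "\<Sum>i\<in>A. d i"] by simp
qed (simp add: polys_const)

lemma functional_polys: "Vector_Spaces.linear scale (*) \<phi> \<Longrightarrow> \<phi> \<in> polys n 1"
proof -
  assume \<phi>: "Vector_Spaces.linear scale (*) \<phi>"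
  have "(\<lambda>x. \<Sum>i<n. \<phi> (bs i) * X i x) \<in> polys n 1"
    by (intro polys_sum polys_scale polys_X) auto
  moreover have "\<phi> = (\<lambda>x. \<Sum>i<n. \<phi> (bs i) * X i x)"
    by (rule ext) (rule functional_expansion[OF \<phi>])
  ultimately show ?thesis by simp
qed

lemma homogeneous_polys:
  assumes "f \<in> homogeneous_polynomial_functions d"
  shows "f \<in> polys n d"
  using assms
proof induction
  case (add_term f \<phi> c)
  have "(\<lambda>x. \<Prod>i<d. \<phi> i x) \<in> polys n (\<Sum>i<d. 1)"
    using add_term(2) by (intro polys_prod functional_polys) auto
  then show ?case using add_term by (intro polys_add polys_scale) auto
qed (rule polys_0)

lemma polynomial_function_in_polys:
  assumes "f \<in> polynomial_functions"
  shows "\<exists>d. f \<in> polys n d"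
  using assms
proof (induction rule: polynomial_functions_coordinate_induct)
  case (add f g)
  then obtain d d' where "f \<in> polys n d" "g \<in> polys n d'" by blast
  then have "f \<in> polys n (max d d')" "g \<in> polys n (max d d')"
    using polys_mono[of n n d "max d d'"] polys_mono[of n n d' "max d d'"] by auto
  then show ?case using polys_add by blast
next
  case (mult f g)
  then show ?case using polys_mult by blast
qed (use polys_const polys_X in blast)+

lemma prime_set_coordinate_subspace: "prime_set {x. \<forall>i\<in>J. i < n \<longrightarrow> X i x = 0}"
  using infinite_field
proof (rule prime_set_line_closed)
  have "0 \<in> {x. \<forall>i\<in>J. i < n \<longrightarrow> X i x = 0}" by (auto simp: linear_functionalD[OF linear_X])
  then show "{x. \<forall>i\<in>J. i < n \<longrightarrow> X i x = 0} \<noteq> {}" by blast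
qed (auto simp: linear_functionalD[OF linear_X])

lemma prime_set_UNIV: "prime_set UNIV"
  using prime_set_coordinate_subspace[of "{}"] by simp

text \<open>The flag of coordinate subspaces \<open>?C j\<close> is a chain of irreducible sets, and
  \<open>X j\<close> vanishes on \<open>?C j\<close> but not on \<open>?C (Suc j)\<close>.\<close>

lemma mon_independent: "family_independent (exps n d) mon"
  unfolding family_independent_def
proof (intro allI impI ballI)
  fix c a
  assume c: "\<forall>x. (\<Sum>a\<in>exps n d. c a * mon a x) = 0" and a: "a \<in> exps n d"
  let ?C = "\<lambda>j. {x. \<forall>i\<in>{j..}. i < n \<longrightarrow> X i x = 0}"
  show "c a = 0"
  proof (rule chain_independent[where m = n and C = ?C and f = X and A = "exps n d" and c = c and a = a])
    show "prime_set (?C i)" for i by (rule prime_set_coordinate_subspace)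
    show "\<exists>x\<in>?C (Suc i). X i x \<noteq> 0" if "i < n" for i
      using that by (intro bexI[of _ "bs i"]) (auto simp: X_bs)
    show "(\<Sum>a\<in>exps n d. c a * (\<Prod>i<n. X i x ^ a i)) = 0" for x
      using c by (simp add: mon_def)
    show "finite (exps n d)" "a \<in> exps n d" by (fact finite_exps a)+
  qed (auto simp: X_poly exps_def Suc_le_eq)
qed

text \<open>The ideal of the point \<open>x0\<close> is generated by the
  \<open>X l - X l x0\<close>. Products are handled as in the Leibniz rule.\<close>

lemma polynomial_function_taylor:
  assumes "f \<in> polynomial_functions"
  shows "\<exists>g. (\<forall>l. g l \<in> polynomial_functions) \<and> (\<forall>x. f x - f x0 = (\<Sum>l<n. (X l x - X l x0) * g l x))"
  using assms
proof (induction rule: polynomial_functions_coordinate_induct)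
  case (const c)
  show ?case by (intro exI[of _ "\<lambda>_ _. 0"]) (auto intro: polynomial_functions_intros)
next
  case (X i)
  then show ?case
    by (intro exI[of _ "\<lambda>l x. if l = i then 1 else 0"])
      (auto intro: polynomial_functions_intros simp: if_distrib[of "\<lambda>t. _ * t"] cong: if_cong)
next
  case (add f g)
  then obtain f' g' where fg: "\<forall>l. f' l \<in> polynomial_functions" "\<forall>l. g' l \<in> polynomial_functions"
    and eq: "\<And>x. f x - f x0 = (\<Sum>l<n. (X l x - X l x0) * f' l x)"
      "\<And>x. g x - g x0 = (\<Sum>l<n. (X l x - X l x0) * g' l x)" by blast
  have "f x + g x - (f x0 + g x0) = (\<Sum>l<n. (X l x - X l x0) * (f' l x + g' l x))" for x
    unfolding add_diff_add eq by (simp add: distrib_left sum.distrib)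
  then show ?case using fg
    by (intro exI[of _ "\<lambda>l x. f' l x + g' l x"])
      (auto intro!: polynomial_functions_intros)
next
  case (mult f g)
  then obtain f' g' where fg: "\<forall>l. f' l \<in> polynomial_functions" "\<forall>l. g' l \<in> polynomial_functions"
    and eq: "\<And>x. f x - f x0 = (\<Sum>l<n. (X l x - X l x0) * f' l x)"
      "\<And>x. g x - g x0 = (\<Sum>l<n. (X l x - X l x0) * g' l x)" by blast
  have "f x * g x - f x0 * g x0 = (\<Sum>l<n. (X l x - X l x0) * (g x * f' l x + f x0 * g' l x))" for x
  proof -
    have "f x * g x - f x0 * g x0 = g x * (f x - f x0) + f x0 * (g x - g x0)"
      by (simp add: algebra_simps)
    also have "\<dots> = (\<Sum>l<n. (X l x - X l x0) * (g x * f' l x + f x0 * g' l x))"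
      unfolding eq by (simp add: sum_distrib_left sum.distrib[symmetric] algebra_simps)
    finally show ?thesis .
  qed
  then show ?case
    using fg mult by (intro exI[of _ "\<lambda>l x. g x * f' l x + f x0 * g' l x"])
      (auto intro!: polynomial_functions_intros)
qed

end

section \<open>Noetherian rings of functions\<close>

definition function_ring :: "('x \<Rightarrow> 'k::field) set \<Rightarrow> bool" where
  "function_ring A \<longleftrightarrow> (\<forall>c. (\<lambda>_. c) \<in> A) \<and> (\<forall>f\<in>A. \<forall>g\<in>A. (\<lambda>x. f x + g x) \<in> A \<and> (\<lambda>x. f x * g x) \<in> A)"

lemma function_ringD:
  assumes "function_ring A"
  shows "(\<lambda>_. c) \<in> A" "f \<in> A \<Longrightarrow> g \<in> A \<Longrightarrow> (\<lambda>x. f x + g x) \<in> A" "f \<in> A \<Longrightarrow> g \<in> A \<Longrightarrow> (\<lambda>x. f x * g x) \<in> A"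
  using assms by (auto simp: function_ring_def)

lemma function_ring_uminus: "function_ring A \<Longrightarrow> f \<in> A \<Longrightarrow> (\<lambda>x. - f x) \<in> A"
  using function_ringD(3)[of A "\<lambda>_. -1" f] function_ringD(1)[of A "-1"] by simp

definition generated :: "('x \<Rightarrow> 'k::field) set \<Rightarrow> (nat \<Rightarrow> 'x \<Rightarrow> 'k) \<Rightarrow> nat \<Rightarrow> ('x \<Rightarrow> 'k) set" where
  "generated A h m = {u. \<exists>g. (\<forall>i<m. g i \<in> A) \<and> u = (\<lambda>x. \<Sum>i<m. g i x * h i x)}"

text \<open>The ascending chain condition for the ideals generated by the initial segments of a
  sequence. Both the basis theorem and the descending chain condition for closed sets consume it in
  this form.\<close>

definition noetherian :: "('x \<Rightarrow> 'k::field) set \<Rightarrow> bool" where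
  "noetherian A \<longleftrightarrow> (\<forall>f::nat \<Rightarrow> _. (\<forall>i. f i \<in> A) \<longrightarrow> (\<exists>m. f m \<in> generated A f m))"

lemma generated_add:
  assumes "function_ring A" "u \<in> generated A h m" "v \<in> generated A h m"
  shows "(\<lambda>x. u x + v x) \<in> generated A h m"
proof -
  obtain g g' where g: "\<forall>i<m. g i \<in> A" "u = (\<lambda>x. \<Sum>i<m. g i x * h i x)"
    "\<forall>i<m. g' i \<in> A" "v = (\<lambda>x. \<Sum>i<m. g' i x * h i x)"
    using assms(2,3) by (auto simp: generated_def)
  have "\<forall>i<m. (\<lambda>x. g i x + g' i x) \<in> A" using g function_ringD(2)[OF assms(1)] by blast
  moreover have "(\<lambda>x. u x + v x) = (\<lambda>x. \<Sum>i<m. (g i x + g' i x) * h i x)"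
    by (simp add: g distrib_right sum.distrib)
  ultimately show ?thesis unfolding generated_def by (intro CollectI exI[of _ "\<lambda>i x. g i x + g' i x"]) blast
qed

lemma generated_mult:
  assumes "function_ring A" "u \<in> A" "v \<in> generated A h m"
  shows "(\<lambda>x. u x * v x) \<in> generated A h m"
proof -
  obtain g where g: "\<forall>i<m. g i \<in> A" "v = (\<lambda>x. \<Sum>i<m. g i x * h i x)"
    using assms(3) by (auto simp: generated_def)
  have "\<forall>i<m. (\<lambda>x. u x * g i x) \<in> A" using g function_ringD(3)[OF assms(1,2)] by blast
  moreover have "(\<lambda>x. u x * v x) = (\<lambda>x. \<Sum>i<m. (u x * g i x) * h i x)"
    by (simp add: g sum_distrib_left mult.assoc)
  ultimately show ?thesis unfolding generated_def by (intro CollectI exI[of _ "\<lambda>i x. u x * g i x"]) blast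
qed

lemma generated_0: "function_ring A \<Longrightarrow> (\<lambda>_. 0) \<in> generated A h m"
  unfolding generated_def
  by (intro CollectI exI[of _ "\<lambda>i x. 0"]) (auto simp: function_ringD(1))

lemma generated_sum:
  assumes "function_ring A" "\<And>i. i \<in> I \<Longrightarrow> u i \<in> generated A h m"
  shows "(\<lambda>x. \<Sum>i\<in>I. u i x) \<in> generated A h m"
  using assms(2)
proof (induction I rule: infinite_finite_induct)
  case (insert i I)
  then show ?case
    using generated_add[OF assms(1), of "u i" h m "\<lambda>x. \<Sum>i\<in>I. u i x"] by simp
qed (simp_all add: generated_0[OF assms(1)])

lemma generated_base:
  assumes "function_ring A" "j < m"
  shows "h j \<in> generated A h m"
  unfolding generated_def
proof (intro CollectI exI conjI allI impI)
  show "(\<lambda>x. if i = j then 1 else 0) \<in> A" for i using function_ringD(1)[OF assms(1)] by auto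
  show "h j = (\<lambda>x. \<Sum>i<m. (if i = j then 1 else 0) * h i x)"
    using assms(2) by (auto simp: if_distrib[of "\<lambda>t. t * _"] cong: if_cong)
qed

lemma generated_subset:
  assumes "function_ring A" "\<And>i. i < r \<Longrightarrow> h i \<in> generated A f m"
  shows "generated A h r \<subseteq> generated A f m"
proof
  fix u assume "u \<in> generated A h r"
  then obtain g where g: "\<forall>i<r. g i \<in> A" "u = (\<lambda>x. \<Sum>i<r. g i x * h i x)"
    by (auto simp: generated_def)
  show "u \<in> generated A f m"
    unfolding g(2) using g(1) assms by (intro generated_sum generated_mult) auto
qed

lemma generated_mono:
  assumes "function_ring A" "m \<le> m'"
  shows "generated A h m \<subseteq> generated A h m'"
  using assms by (intro generated_subset generated_base) auto

section \<open>Adjoining one function to a ring of functions\<close>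

text \<open>The function \<open>t\<close> may be algebraic over \<open>A\<close>, so representations
  are not unique. The degree of a function is read as the least \<open>d\<close> for which one
  exists.\<close>

definition poly_lt :: "('x \<Rightarrow> 'k::field) set \<Rightarrow> ('x \<Rightarrow> 'k) \<Rightarrow> nat \<Rightarrow> ('x \<Rightarrow> 'k) set" where
  "poly_lt A t d = {f. \<exists>a. (\<forall>i. a i \<in> A) \<and> f = (\<lambda>x. \<Sum>i<d. a i x * t x ^ i)}"

definition adjoin :: "('x \<Rightarrow> 'k::field) set \<Rightarrow> ('x \<Rightarrow> 'k) \<Rightarrow> ('x \<Rightarrow> 'k) set" where
  "adjoin A t = (\<Union>d. poly_lt A t d)"

lemma poly_lt_add:
  assumes "function_ring A" "f \<in> poly_lt A t d" "g \<in> poly_lt A t d"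
  shows "(\<lambda>x. f x + g x) \<in> poly_lt A t d"
proof -
  obtain a b where ab: "\<forall>i. a i \<in> A" "f = (\<lambda>x. \<Sum>i<d. a i x * t x ^ i)"
    "\<forall>i. b i \<in> A" "g = (\<lambda>x. \<Sum>i<d. b i x * t x ^ i)"
    using assms(2,3) by (auto simp: poly_lt_def)
  have "\<forall>i. (\<lambda>x. a i x + b i x) \<in> A" using ab function_ringD(2)[OF assms(1)] by blast
  moreover have "(\<lambda>x. f x + g x) = (\<lambda>x. \<Sum>i<d. (a i x + b i x) * t x ^ i)"
    by (simp add: ab distrib_right sum.distrib)
  ultimately show ?thesis unfolding poly_lt_def by (intro CollectI exI[of _ "\<lambda>i x. a i x + b i x"]) blast
qed

lemma poly_lt_term:
  assumes "function_ring A" "a \<in> A" "j < d"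
  shows "(\<lambda>x. a x * t x ^ j) \<in> poly_lt A t d"
  unfolding poly_lt_def
proof (intro CollectI exI conjI allI)
  show "(\<lambda>x. if i = j then a x else 0) \<in> A" for i
    using function_ringD(1)[OF assms(1)] assms(2) by (cases "i = j") auto
  show "(\<lambda>x. a x * t x ^ j) = (\<lambda>x. \<Sum>i<d. (if i = j then a x else 0) * t x ^ i)"
    using assms(3) by (auto simp: if_distrib[of "\<lambda>t. t * _"] cong: if_cong)
qed

lemma poly_lt_0: "function_ring A \<Longrightarrow> (\<lambda>_. 0) \<in> poly_lt A t d"
  unfolding poly_lt_def
  by (intro CollectI exI[of _ "\<lambda>i x. 0"]) (auto simp: function_ringD(1))

lemma poly_lt_sum:
  assumes "function_ring A" "\<And>i. i \<in> I \<Longrightarrow> f i \<in> poly_lt A t d"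
  shows "(\<lambda>x. \<Sum>i\<in>I. f i x) \<in> poly_lt A t d"
  using assms(2)
proof (induction I rule: infinite_finite_induct)
  case (insert i I)
  then show ?case
    using poly_lt_add[OF assms(1), of "f i" t d "\<lambda>x. \<Sum>i\<in>I. f i x"] by simp
qed (simp_all add: poly_lt_0[OF assms(1)])

lemma poly_lt_mono:
  assumes "function_ring A" "d \<le> d'"
  shows "poly_lt A t d \<subseteq> poly_lt A t d'"
proof
  fix f assume "f \<in> poly_lt A t d"
  then obtain a where a: "\<forall>i. a i \<in> A" "f = (\<lambda>x. \<Sum>i<d. a i x * t x ^ i)" by (auto simp: poly_lt_def)
  show "f \<in> poly_lt A t d'"
    unfolding a(2) using a(1) assms by (intro poly_lt_sum poly_lt_term) auto
qed

lemma poly_lt_mult_monomial: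
  assumes A: "function_ring A" and "u \<in> A" "f \<in> poly_lt A t d" "d + k \<le> d'"
  shows "(\<lambda>x. u x * t x ^ k * f x) \<in> poly_lt A t d'"
proof -
  obtain a where a: "\<forall>i. a i \<in> A" "f = (\<lambda>x. \<Sum>i<d. a i x * t x ^ i)"
    using assms by (auto simp: poly_lt_def)
  have "(\<lambda>x. u x * t x ^ k * f x) = (\<lambda>x. \<Sum>i<d. (u x * a i x) * t x ^ (k + i))"
    by (simp add: a sum_distrib_left power_add mult_ac)
  moreover have "(\<lambda>x. \<Sum>i<d. (u x * a i x) * t x ^ (k + i)) \<in> poly_lt A t d'"
    using a(1) assms by (intro poly_lt_sum poly_lt_term function_ringD(3)[OF A]) auto
  ultimately show ?thesis by simp
qed

lemma poly_lt_mult: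
  assumes A: "function_ring A" and "f \<in> poly_lt A t d" "g \<in> poly_lt A t d'"
  shows "(\<lambda>x. f x * g x) \<in> poly_lt A t (d + d')"
proof -
  obtain a where a: "\<forall>i. a i \<in> A" "f = (\<lambda>x. \<Sum>i<d. a i x * t x ^ i)"
    using assms by (auto simp: poly_lt_def)
  have "(\<lambda>x. \<Sum>i<d. a i x * t x ^ i * g x) \<in> poly_lt A t (d + d')"
    using a(1) assms by (intro poly_lt_sum poly_lt_mult_monomial[of A _ _ _ d']) auto
  then show ?thesis by (simp add: a(2) sum_distrib_right)
qed

lemma function_ring_adjoin:
  assumes A: "function_ring A"
  shows "function_ring (adjoin A t)"
  unfolding function_ring_def
proof (intro conjI allI ballI)
  fix c
  show "(\<lambda>_. c) \<in> adjoin A t"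
    using poly_lt_term[OF A function_ringD(1)[OF A, of c], of 0 1 t] by (auto simp: adjoin_def)
next
  fix f g assume "f \<in> adjoin A t" "g \<in> adjoin A t"
  then obtain d d' where d: "f \<in> poly_lt A t d" "g \<in> poly_lt A t d'" by (auto simp: adjoin_def)
  then have "f \<in> poly_lt A t (max d d')" "g \<in> poly_lt A t (max d d')"
    using poly_lt_mono[OF A, of _ "max d d'" t] by (meson max.cobounded1 max.cobounded2 subsetD)+
  then show "(\<lambda>x. f x + g x) \<in> adjoin A t"
    using poly_lt_add[OF A] unfolding adjoin_def by blast
  show "(\<lambda>x. f x * g x) \<in> adjoin A t"
    using poly_lt_mult[OF A d] unfolding adjoin_def by blast
qed

lemma adjoin_base: "function_ring A \<Longrightarrow> A \<subseteq> adjoin A t"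
  using poly_lt_term[of A _ 0 1 t] by (fastforce simp: adjoin_def)

lemma adjoin_self: "function_ring A \<Longrightarrow> t \<in> adjoin A t"
  using poly_lt_term[of A "\<lambda>_. 1" 1 2 t] function_ringD(1)[of A 1] by (auto simp: adjoin_def)

text \<open>
  Hilbert's basis theorem by Sarges' argument: a sequence of elements of minimal degree, each outside
  the ideal generated by its predecessors, has leading coefficients contradicting noetherianity.
\<close>

lemma noetherian_adjoin:
  assumes A: "function_ring A" and noeth: "noetherian A"
  shows "noetherian (adjoin A t)"
proof (rule ccontr)
  let ?R = "adjoin A t"
  have R: "function_ring ?R" using A by (rule function_ring_adjoin)
  assume "\<not> noetherian ?R"
  then obtain f :: "nat \<Rightarrow> 'a \<Rightarrow> 'b" where f: "\<And>i. f i \<in> ?R" "\<And>m. f m \<notin> generated ?R f m"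
    by (auto simp: noetherian_def)
  define J where "J = (\<Union>m. generated ?R f m)"
  have JR: "J \<subseteq> ?R"
  proof
    fix u assume "u \<in> J"
    then obtain m where "u \<in> generated ?R f m" by (auto simp: J_def)
    then show "u \<in> ?R"
    proof -
      assume "u \<in> generated ?R f m"
      then obtain g where g: "\<forall>i<m. g i \<in> ?R" "u = (\<lambda>x. \<Sum>i<m. g i x * f i x)"
        by (auto simp: generated_def)
      have "(\<lambda>x. \<Sum>i<k. g i x * f i x) \<in> ?R" if "k \<le> m" for k
        using that
      proof (induction k)
        case (Suc k)
        then show ?case
          using g f by (auto intro!: function_ringD(2,3)[OF R])
      qed (simp add: function_ringD(1)[OF R])
      then show ?thesis by (simp add: g(2))
    qed
  qed
  \<comment> \<open>Finitely many members of \<open>J\<close> lie in one ideal of the strictly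
    growing chain, so they never generate \<open>J\<close>; the choice below therefore never gets
    stuck.\<close>
  have common: "\<exists>m. \<forall>i<r. h i \<in> generated ?R f m" if "\<And>i. i < r \<Longrightarrow> h i \<in> J" for r and h :: "nat \<Rightarrow> _"
    using that
  proof (induction r)
    case (Suc r)
    then obtain m where m: "\<forall>i<r. h i \<in> generated ?R f m" by auto
    obtain m' where m': "h r \<in> generated ?R f m'" using Suc.prems[of r] by (auto simp: J_def)
    have "h i \<in> generated ?R f (max m m')" if "i < Suc r" for i
      using m m' that generated_mono[OF R, of m "max m m'" f] generated_mono[OF R, of m' "max m m'" f]
      by (auto simp: less_Suc_eq)
    then show ?case by blast
  qed simp
  \<comment> \<open>\<open>P h r y\<close> asks for \<open>y\<close> of least degree among the
    members of \<open>J\<close> outside the ideal generated by the first \<open>r\<close> chosen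
    elements.\<close>
  define P where "P = (\<lambda>(h::nat\<Rightarrow>'a\<Rightarrow>'b) r y. y \<in> J \<and> y \<notin> generated ?R h r \<and>
    (\<forall>z d. z \<in> J \<longrightarrow> z \<notin> generated ?R h r \<longrightarrow> z \<in> poly_lt A t d \<longrightarrow> y \<in> poly_lt A t d))"
  have "\<exists>h. \<forall>r. P h r (h r)"
  proof (rule dependent_wellorder_choice)
    fix r and f g :: "nat \<Rightarrow> 'a \<Rightarrow> 'b" and x
    assume "\<And>y. y < x \<Longrightarrow> f y = g y"
    then have "generated ?R f x = generated ?R g x"
      by (auto simp: generated_def)
    then show "P f x r = P g x r" by (simp add: P_def)
  next
    fix r :: nat and h :: "nat \<Rightarrow> 'a \<Rightarrow> 'b"
    assume "\<And>i. i < r \<Longrightarrow> P h i (h i)"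
    then have "\<And>i. i < r \<Longrightarrow> h i \<in> J" by (simp add: P_def)
    then obtain m where m: "\<forall>i<r. h i \<in> generated ?R f m" using common by blast
    then have "f m \<notin> generated ?R h r" using f(2)[of m] generated_subset[OF R, of r h f m] by blast
    moreover have fJ: "f m \<in> J" using generated_base[OF R, of m "Suc m" f] by (auto simp: J_def)
    moreover obtain d where "f m \<in> poly_lt A t d" using f(1)[of m] by (auto simp: adjoin_def)
    ultimately have ex: "\<exists>d z. z \<in> J \<and> z \<notin> generated ?R h r \<and> z \<in> poly_lt A t d" by blast
    define d0 where "d0 = (LEAST d. \<exists>z. z \<in> J \<and> z \<notin> generated ?R h r \<and> z \<in> poly_lt A t d)"
    obtain z where z: "z \<in> J" "z \<notin> generated ?R h r" "z \<in> poly_lt A t d0"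
      using LeastI_ex[OF ex] unfolding d0_def by blast
    have "P h r z"
      unfolding P_def
    proof (intro conjI allI impI)
      fix z' d assume "z' \<in> J" "z' \<notin> generated ?R h r" "z' \<in> poly_lt A t d"
      then have "d0 \<le> d" unfolding d0_def by (intro Least_le) blast
      then show "z \<in> poly_lt A t d" using z(3) poly_lt_mono[OF A] by blast
    qed (use z in auto)
    then show "\<exists>y. P h r y" by blast
  qed
  then obtain h where h: "\<And>r. h r \<in> J" "\<And>r. h r \<notin> generated ?R h r"
    "\<And>r z d. z \<in> J \<Longrightarrow> z \<notin> generated ?R h r \<Longrightarrow> z \<in> poly_lt A t d \<Longrightarrow> h r \<in> poly_lt A t d"
    unfolding P_def by blast
  define Q where "Q = (\<lambda>r e lead low. lead \<in> A \<and> low \<in> poly_lt A t e \<and>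
    h r = (\<lambda>x. low x + lead x * t x ^ e) \<and> h r \<notin> poly_lt A t e)"
  have "\<exists>e lead low. Q r e lead low" for r
  proof -
    define d where "d = (LEAST d. h r \<in> poly_lt A t d)"
    have ex: "\<exists>d. h r \<in> poly_lt A t d" using h(1)[of r] JR by (auto simp: adjoin_def)
    have d: "h r \<in> poly_lt A t d" unfolding d_def by (rule LeastI_ex[OF ex])
    have "d \<noteq> 0"
    proof
      assume "d = 0"
      then have "h r = (\<lambda>_. 0)" using d by (auto simp: poly_lt_def)
      then show False using h(2)[of r] generated_0[OF R] by metis
    qed
    then obtain e where e: "d = Suc e" by (cases d) auto
    then have "h r \<notin> poly_lt A t e" using not_less_Least[of e "\<lambda>d. h r \<in> poly_lt A t d"] by (simp add: d_def)
    moreover obtain a where a: "\<forall>i. a i \<in> A" "h r = (\<lambda>x. \<Sum>i<Suc e. a i x * t x ^ i)"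
      using d e by (auto simp: poly_lt_def)
    moreover have "(\<lambda>x. \<Sum>i<e. a i x * t x ^ i) \<in> poly_lt A t e"
      using a by (auto simp: poly_lt_def)
    ultimately show ?thesis
      unfolding Q_def by (intro exI[of _ e] exI[of _ "a e"] exI[of _ "\<lambda>x. \<Sum>i<e. a i x * t x ^ i"]) simp
  qed
  then obtain e lead low where "\<And>r. Q r (e r) (lead r) (low r)" by metis
  then have hr: "\<And>r. lead r \<in> A" "\<And>r. low r \<in> poly_lt A t (e r)"
    "\<And>r. h r = (\<lambda>x. low r x + lead r x * t x ^ e r)" "\<And>r. h r \<notin> poly_lt A t (e r)"
    unfolding Q_def by blast+
  \<comment> \<open>\<open>h m\<close> was still a candidate when \<open>h i\<close> was chosen, so
    its degree is not smaller.\<close>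
  have e_mono: "e i \<le> e m" if "i \<le> m" for i m
  proof (rule ccontr)
    assume "\<not> e i \<le> e m"
    have "(\<lambda>x. lead m x * t x ^ e m) \<in> poly_lt A t (Suc (e m))"
      using A hr(1) by (intro poly_lt_term) auto
    moreover have "low m \<in> poly_lt A t (Suc (e m))" using poly_lt_mono[OF A, of "e m" "Suc (e m)" t] hr(2) by auto
    ultimately have "h m \<in> poly_lt A t (Suc (e m))" using hr(3)[of m] poly_lt_add[OF A] by simp
    moreover have "h m \<notin> generated ?R h i" using h(2)[of m] generated_mono[OF R that] by blast
    ultimately have "h i \<in> poly_lt A t (Suc (e m))" using h(1,3) by blast
    then show False using hr(4)[of i] poly_lt_mono[OF A, of "Suc (e m)" "e i" t] \<open>\<not> e i \<le> e m\<close> by auto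
  qed
  obtain m where "lead m \<in> generated A lead m" using noeth hr(1) unfolding noetherian_def by blast
  then obtain g where g: "\<forall>i<m. g i \<in> A" "lead m = (\<lambda>x. \<Sum>i<m. g i x * lead i x)"
    by (auto simp: generated_def)
  \<comment> \<open>Shifting the earlier elements to degree \<open>e m\<close> makes their leading
    coefficients add up to that of \<open>h m\<close>. The difference \<open>z\<close> has smaller
    degree and still lies outside the ideal of the predecessors, against the choice of
    \<open>h m\<close>.\<close>
  define w where "w = (\<lambda>x. \<Sum>i<m. (g i x * t x ^ (e m - e i)) * h i x)"
  define z where "z = (\<lambda>x. h m x + - 1 * w x)"
  have coeff: "(\<lambda>x. g i x * t x ^ (e m - e i)) \<in> ?R" if "i < m" for i
    using poly_lt_term[OF A, of "g i" "e m - e i" "Suc (e m - e i)" t] g(1) that by (auto simp: adjoin_def)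
  have w: "w \<in> generated ?R h m"
    unfolding w_def using coeff by (intro generated_sum[OF R] generated_mult[OF R] generated_base[OF R]) auto
  obtain M where M: "\<forall>i<Suc m. h i \<in> generated ?R f M" using common[of "Suc m" h] h(1) by blast
  have "generated ?R h m \<subseteq> generated ?R f M" using M by (intro generated_subset[OF R]) auto
  then have "z \<in> generated ?R f M"
    unfolding z_def using w M
    by (intro generated_add[OF R] generated_mult[OF R function_ringD(1)[OF R]]) auto
  then have "z \<in> J" by (auto simp: J_def)
  moreover have "z \<notin> generated ?R h m"
  proof
    assume "z \<in> generated ?R h m"
    then have "(\<lambda>x. z x + w x) \<in> generated ?R h m" using w by (rule generated_add[OF R])
    then show False using h(2)[of m] by (simp add: z_def)
  qed
  moreover have "z \<in> poly_lt A t (e m)"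
  proof -
    have "z = (\<lambda>x. low m x + - 1 * t x ^ 0 * (\<Sum>i<m. g i x * t x ^ (e m - e i) * low i x))"
    proof
      fix x
      have "(\<Sum>i<m. g i x * t x ^ (e m - e i) * (lead i x * t x ^ e i)) = lead m x * t x ^ e m"
        unfolding g(2) sum_distrib_right
      proof (rule sum.cong[OF refl])
        fix i assume "i \<in> {..<m}"
        then have "t x ^ e m = t x ^ (e m - e i) * t x ^ e i"
          using e_mono[of i m] by (simp add: power_add[symmetric])
        then show "g i x * t x ^ (e m - e i) * (lead i x * t x ^ e i) = g i x * lead i x * t x ^ e m" by simp
      qed
      then show "z x = low m x + - 1 * t x ^ 0 * (\<Sum>i<m. g i x * t x ^ (e m - e i) * low i x)"
        by (simp add: z_def w_def hr(3) distrib_left sum.distrib)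
    qed
    moreover have "(\<lambda>x. low m x + - 1 * t x ^ 0 * (\<Sum>i<m. g i x * t x ^ (e m - e i) * low i x)) \<in> poly_lt A t (e m)"
    proof (rule poly_lt_add[OF A hr(2)], rule poly_lt_mult_monomial[OF A function_ringD(1)[OF A]])
      show "(\<lambda>x. \<Sum>i<m. g i x * t x ^ (e m - e i) * low i x) \<in> poly_lt A t (e m)"
        using g(1) hr(2) e_mono by (intro poly_lt_sum[OF A] poly_lt_mult_monomial[OF A, of _ _ _ "e _"]) auto
    qed simp
    ultimately show ?thesis by simp
  qed
  ultimately have "h m \<in> poly_lt A t (e m)" by (rule h(3))
  then show False using hr(4) by blast
qed

lemma noetherian_constants: "noetherian {f :: 'x \<Rightarrow> 'k::field. \<exists>c. f = (\<lambda>_. c)}"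
  unfolding noetherian_def
proof (intro allI impI)
  fix f :: "nat \<Rightarrow> 'x \<Rightarrow> 'k" assume "\<forall>i. f i \<in> {f. \<exists>c. f = (\<lambda>_. c)}"
  then obtain c where c: "\<And>i. f i = (\<lambda>_. c i)" by (auto simp: choice_iff)
  show "\<exists>m. f m \<in> generated {f. \<exists>c. f = (\<lambda>_. c)} f m"
  proof (cases "c 0 = 0")
    case True
    then show ?thesis by (intro exI[of _ 0]) (auto simp: generated_def c)
  next
    case False
    then show ?thesis
      by (intro exI[of _ 1]) (auto simp: generated_def c fun_eq_iff intro!: exI[of _ "\<lambda>_ _. c 1 / c 0"])
  qed
qed

section \<open>Ideals of polynomial functions\<close>

lemma infinite_alg_closed_field: "infinite (UNIV :: 'k::alg_closed_field set)"
proof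
  assume fin: "finite (UNIV :: 'k set)"
  let ?q = "(\<Prod>a\<in>UNIV. [:- a, 1:]) + 1 :: 'k poly"
  have "degree (\<Prod>a\<in>UNIV. [:- a, 1:] :: 'k poly) = card (UNIV :: 'k set)"
    by (subst degree_prod_eq_sum_degree) auto
  moreover have "card (UNIV :: 'k set) > 0" using fin by (simp add: card_gt_0_iff)
  ultimately have "degree ?q > 0" by (subst degree_add_eq_left) auto
  then obtain x where "poly ?q x = 0" using alg_closed_imp_poly_has_root by blast
  moreover have "poly (\<Prod>a\<in>UNIV. [:- a, 1:]) x = (0::'k)"
    unfolding poly_prod using fin by (intro prod_zero) auto
  ultimately show False by simp
qed

context zariski_vector_space
begin

lemma function_ring_polynomial_functions: "function_ring polynomial_functions"
  by (simp add: function_ring_def polynomial_functions_intros)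

section \<open>Ideals and finite-dimensional quotients\<close>

definition is_ideal :: "('b \<Rightarrow> 'a) set \<Rightarrow> bool" where
  "is_ideal I \<longleftrightarrow> (\<lambda>_. 0) \<in> I \<and> (\<forall>f\<in>I. \<forall>g\<in>I. (\<lambda>x. f x + g x) \<in> I) \<and>
     (\<forall>f\<in>I. \<forall>g\<in>polynomial_functions. (\<lambda>x. f x * g x) \<in> I)"

lemma ideal_0: "is_ideal I \<Longrightarrow> (\<lambda>_. 0) \<in> I"
  by (simp add: is_ideal_def)

lemma ideal_add: "is_ideal I \<Longrightarrow> f \<in> I \<Longrightarrow> g \<in> I \<Longrightarrow> (\<lambda>x. f x + g x) \<in> I"
  by (simp add: is_ideal_def)

lemma ideal_mult_right: "is_ideal I \<Longrightarrow> f \<in> I \<Longrightarrow> g \<in> polynomial_functions \<Longrightarrow> (\<lambda>x. f x * g x) \<in> I"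
  by (simp add: is_ideal_def)

lemma ideal_mult_left: "is_ideal I \<Longrightarrow> f \<in> I \<Longrightarrow> g \<in> polynomial_functions \<Longrightarrow> (\<lambda>x. g x * f x) \<in> I"
  by (simp add: is_ideal_def mult.commute)

lemma ideal_diff: "is_ideal I \<Longrightarrow> f \<in> I \<Longrightarrow> g \<in> I \<Longrightarrow> (\<lambda>x. f x - g x) \<in> I"
  using ideal_add[of I f "\<lambda>x. -1 * g x"] ideal_mult_left[of I g "\<lambda>_. -1"]
  by (simp add: polynomial_functions.const)

lemma ideal_sum:
  assumes "is_ideal I" "\<And>i. i \<in> A \<Longrightarrow> f i \<in> I"
  shows "(\<lambda>x. \<Sum>i\<in>A. f i x) \<in> I"
  using assms(2)
proof (induction A rule: infinite_finite_induct)
  case (insert i A)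
  then show ?case using ideal_add[OF assms(1), of "f i" "\<lambda>x. \<Sum>i\<in>A. f i x"] by simp
qed (simp_all add: ideal_0[OF assms(1)])

definition extend_ideal :: "('b \<Rightarrow> 'a) set \<Rightarrow> ('b \<Rightarrow> 'a) \<Rightarrow> ('b \<Rightarrow> 'a) set" where
  "extend_ideal I g = {f. \<exists>h\<in>I. \<exists>u\<in>polynomial_functions. f = (\<lambda>x. h x + g x * u x)}"

lemma extend_idealI:
  "h \<in> I \<Longrightarrow> u \<in> polynomial_functions \<Longrightarrow> (\<lambda>x. h x + g x * u x) \<in> extend_ideal I g"
  by (auto simp: extend_ideal_def)

lemma is_ideal_extend_ideal:
  assumes "is_ideal I"
  shows "is_ideal (extend_ideal I g)"
  unfolding is_ideal_def
proof (intro conjI ballI)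
  show "(\<lambda>_. 0) \<in> extend_ideal I g"
    using extend_idealI[OF ideal_0[OF assms] polynomial_functions.const[of 0], of g] by simp
  fix f f' assume "f \<in> extend_ideal I g"
  then obtain h u where f: "h \<in> I" "u \<in> polynomial_functions" "f = (\<lambda>x. h x + g x * u x)"
    by (auto simp: extend_ideal_def)
  show "(\<lambda>x. f x + f' x) \<in> extend_ideal I g" if "f' \<in> extend_ideal I g"
  proof -
    from that obtain h' u' where f': "h' \<in> I" "u' \<in> polynomial_functions" "f' = (\<lambda>x. h' x + g x * u' x)"
      by (auto simp: extend_ideal_def)
    show ?thesis
      using extend_idealI[OF ideal_add[OF assms f(1) f'(1)] polynomial_functions.add[OF f(2) f'(2)], of g]
      by (simp add: f f' algebra_simps)
  qed
  show "(\<lambda>x. f x * f' x) \<in> extend_ideal I g" if "f' \<in> polynomial_functions"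
    using extend_idealI[OF ideal_mult_right[OF assms f(1) that] polynomial_functions.mult[OF f(2) that], of g]
    by (simp add: f algebra_simps)
qed

lemma subset_extend_ideal: "I \<subseteq> extend_ideal I g"
  using extend_idealI[OF _ polynomial_functions.const[of 0], of _ I g] by auto

lemma self_in_extend_ideal: "is_ideal I \<Longrightarrow> g \<in> extend_ideal I g"
  using extend_idealI[OF ideal_0 polynomial_functions.const[of 1], of I g] by simp

text \<open>The quotient by \<open>I\<close> is a vector space of dimension at most
  \<open>card S\<close>. This replaces the statement on finitely generated field extensions in the
  usual Nullstellensatz.\<close>

definition spans_mod :: "'i set \<Rightarrow> ('i \<Rightarrow> 'b \<Rightarrow> 'a) \<Rightarrow> ('b \<Rightarrow> 'a) set \<Rightarrow> bool" where
  "spans_mod S B I \<longleftrightarrow> finite S \<and> (\<forall>f\<in>polynomial_functions. \<exists>k. (\<lambda>x. f x - (\<Sum>r\<in>S. k r * B r x)) \<in> I)"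

lemma spans_mod_mono: "spans_mod S B I \<Longrightarrow> I \<subseteq> I' \<Longrightarrow> spans_mod S B I'"
  unfolding spans_mod_def by blast

text \<open>The powers of \<open>f\<close> with exponents from 0 to \<open>card S\<close> are one
  too many to be independent modulo \<open>I\<close>.\<close>

lemma algebraic_relation_mod:
  fixes S :: "'i set"
  assumes I: "is_ideal I" and S: "spans_mod S B I" and f: "f \<in> polynomial_functions"
  obtains q where "q \<noteq> 0" "degree q \<le> card S" "(\<lambda>x. poly q (f x)) \<in> I"
proof -
  have "\<forall>i. \<exists>k. (\<lambda>x. f x ^ i - (\<Sum>r\<in>S. k r * B r x)) \<in> I"
    using S f by (auto simp: spans_mod_def intro!: polynomial_functions_power)
  then obtain k where k: "\<And>i. (\<lambda>x. f x ^ i - (\<Sum>r\<in>S. k i r * B r x)) \<in> I" by metis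
  have fin: "finite S" using S by (simp add: spans_mod_def)
  \<comment> \<open>The rows of coefficients become functions on the index type, so that the
    dependence lemma for families of functions applies to them.\<close>
  define \<delta> where "\<delta> = (\<lambda>(r::'i) r'. if r' = r then 1 else 0 :: 'a)"
  define v where "v = (\<lambda>i (r'::'i). \<Sum>r\<in>S. k i r * \<delta> r r')"
  have v: "v i r = k i r" if "r \<in> S" for i r
    using fin that by (simp add: v_def \<delta>_def if_distrib[of "\<lambda>t. _ * t"] cong: if_cong)
  have "v i \<in> fs.span (\<delta> ` S)" for i
    unfolding v_def by (rule span_imageI) (auto intro: fs.span_base)
  moreover have "card (\<delta> ` S) < card {..card S}" using card_image_le[OF fin, of \<delta>] by simp
  ultimately obtain \<alpha> where \<alpha>: "\<exists>i\<in>{..card S}. \<alpha> i \<noteq> 0" "\<And>r. (\<Sum>i\<le>card S. \<alpha> i * v i r) = 0"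
    using family_dependent[of "{..card S}" v "\<delta> ` S"] fin by auto
  define q where "q = (\<Sum>i\<le>card S. monom (\<alpha> i) i)"
  have coeff: "coeff q i = (if i \<le> card S then \<alpha> i else 0)" for i
    by (simp add: q_def coeff_sum)
  show ?thesis
  proof
    show "q \<noteq> 0" using \<alpha>(1) coeff by (metis atMost_iff coeff_0)
    show "degree q \<le> card S" by (rule degree_le) (simp add: coeff)
    have "poly q (f x) = (\<Sum>i\<le>card S. \<alpha> i * (f x ^ i - (\<Sum>r\<in>S. k i r * B r x)))" for x
    proof -
      have "(\<Sum>i\<le>card S. \<alpha> i * (\<Sum>r\<in>S. k i r * B r x)) = (\<Sum>r\<in>S. (\<Sum>i\<le>card S. \<alpha> i * v i r) * B r x)"
        by (subst (1) sum_distrib_left, subst sum.swap) (simp add: v sum_distrib_right mult.assoc)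
      also have "\<dots> = 0" by (simp add: \<alpha>(2))
      finally show ?thesis
        by (simp add: q_def poly_sum poly_monom right_diff_distrib sum_subtractf)
    qed
    moreover have "(\<lambda>x. \<Sum>i\<le>card S. \<alpha> i * (f x ^ i - (\<Sum>r\<in>S. k i r * B r x))) \<in> I"
      by (intro ideal_sum[OF I] ideal_mult_left[OF I k] polynomial_functions.const)
    ultimately show "(\<lambda>x. poly q (f x)) \<in> I" by simp
  qed
qed

text \<open>Nakayama's lemma, by eliminating one unknown at a time.\<close>

lemma elimination:
  fixes r :: nat
  assumes A: "function_ring A"
    and "\<And>i j. i < r \<Longrightarrow> j < r \<Longrightarrow> m i j \<in> A \<and> m i j x0 = 0"
    and "u \<in> A" "u x0 = 1"
    and "\<And>i z. i < r \<Longrightarrow> z \<in> Z \<Longrightarrow> u z * b i z = (\<Sum>j<r. m i j z * b j z)"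
  shows "\<exists>w\<in>A. w x0 = 1 \<and> (\<forall>i<r. \<forall>z\<in>Z. w z * b i z = 0)"
  using assms(2-)
proof (induction r arbitrary: m u)
  case 0
  then show ?case by auto
next
  case (Suc r)
  \<comment> \<open>The diagonal entry moves to the left side. Since it vanishes at
    \<open>x0\<close>, the new factor still has value 1 there.\<close>
  define v where "v = (\<lambda>z. u z + - m r r z)"
  have vA: "v \<in> A" "v x0 = 1"
    using Suc.prems(1)[of r r] Suc.prems(2,3) function_ringD(2)[OF A, of u "\<lambda>z. - m r r z"]
      function_ring_uminus[OF A, of "m r r"] unfolding v_def by simp_all
  have br: "v z * b r z = (\<Sum>j<r. m r j z * b j z)" if "z \<in> Z" for z
    using Suc.prems(4)[of r z] that by (simp add: v_def algebra_simps)
  \<comment> \<open>Row \<open>i\<close> is multiplied by \<open>v\<close> before the last unknown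
    is substituted, because \<open>v\<close> is not invertible in \<open>A\<close>.\<close>
  have "\<exists>w\<in>A. w x0 = 1 \<and> (\<forall>i<r. \<forall>z\<in>Z. w z * b i z = 0)"
  proof (rule Suc.IH[of "\<lambda>i j z. v z * m i j z + m i r z * m r j z" "\<lambda>z. v z * u z"])
    show "(\<lambda>z. v z * m i j z + m i r z * m r j z) \<in> A \<and> v x0 * m i j x0 + m i r x0 * m r j x0 = 0"
      if "i < r" "j < r" for i j
      using Suc.prems(1)[of i j] Suc.prems(1)[of i r] Suc.prems(1)[of r j] vA that
        function_ringD(2,3)[OF A] by simp
    show "(\<lambda>z. v z * u z) \<in> A" "v x0 * u x0 = 1"
      using vA Suc.prems function_ringD(3)[OF A] by auto
    fix i z assume iz: "i < r" "z \<in> Z"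
    have "v z * u z * b i z = v z * (\<Sum>j<r. m i j z * b j z) + m i r z * (v z * b r z)"
    proof -
      have "u z * b i z = (\<Sum>j<r. m i j z * b j z) + m i r z * b r z"
        using Suc.prems(4)[of i z] iz by simp
      then have "v z * (u z * b i z) = v z * ((\<Sum>j<r. m i j z * b j z) + m i r z * b r z)" by simp
      then show ?thesis by (simp add: algebra_simps)
    qed
    also have "\<dots> = (\<Sum>j<r. (v z * m i j z + m i r z * m r j z) * b j z)"
      unfolding br[OF iz(2)] by (simp add: sum_distrib_left sum.distrib[symmetric] algebra_simps)
    finally show "v z * u z * b i z = (\<Sum>j<r. (v z * m i j z + m i r z * m r j z) * b j z)" .
  qed
  then obtain w where w: "w \<in> A" "w x0 = 1" "\<And>i z. i < r \<Longrightarrow> z \<in> Z \<Longrightarrow> w z * b i z = 0" by blast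
  show ?case
  proof (intro bexI[of _ "\<lambda>z. w z * v z"] conjI allI impI ballI)
    show "(\<lambda>z. w z * v z) \<in> A" using w vA function_ringD(3)[OF A] by blast
    fix i z assume iz: "i < Suc r" "z \<in> Z"
    show "w z * v z * b i z = 0"
    proof (cases "i = r")
      case True
      have "w z * v z * b i z = w z * (v z * b r z)" by (simp add: True)
      also have "\<dots> = (\<Sum>j<r. m r j z * (w z * b j z))"
        unfolding br[OF iz(2)] by (simp add: sum_distrib_left mult_ac)
      finally have "w z * v z * b i z = (\<Sum>j<r. m r j z * (w z * b j z))" .
      then show ?thesis using w(3) iz by simp
    next
      case False
      have "w z * v z * b i z = v z * (w z * b i z)" by simp
      then show ?thesis using w(3) iz False by simp
    qed
  qed (use w vA in auto)
qed

end

section \<open>A Nullstellensatz for finite-dimensional quotients\<close>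

locale closed_coordinates = coordinates scale n bs X
  for scale :: "'a::alg_closed_field \<Rightarrow> 'b::ab_group_add \<Rightarrow> 'b" (infixr \<open>*s\<close> 75)
    and n bs X
begin

text \<open>Roots of \<open>q\<close> are tried one at a time. If \<open>1 = h + (f - c) * u\<close>
  with \<open>h\<close> in \<open>I\<close>, then multiplying by \<open>q1 (f)\<close> shows that
  the cofactor \<open>q1\<close> also gives a member of \<open>I\<close>, of smaller degree. The
  process stops, since a nonzero constant cannot lie in a proper ideal.\<close>

lemma proper_extension:
  assumes I: "is_ideal I" "(\<lambda>_. 1) \<notin> I" and f: "f \<in> polynomial_functions"
    and "q \<noteq> 0" "(\<lambda>x. poly q (f x)) \<in> I"
  shows "\<exists>c. (\<lambda>_. 1) \<notin> extend_ideal I (\<lambda>x. f x - c)"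
  using assms(4,5)
proof (induction "degree q" arbitrary: q rule: less_induct)
  case less
  show ?case
  proof (cases "degree q = 0")
    case True
    then obtain a where a: "q = [:a:]" by (metis degree_eq_zeroE)
    then have "(\<lambda>x. inverse a * a) \<in> I"
      using ideal_mult_left[OF I(1) less(3) polynomial_functions.const[of "inverse a"]] by simp
    then show ?thesis using less(2) a I(2) by simp
  next
    case False
    then obtain c where "poly q c = 0" using alg_closed_imp_poly_has_root by blast
    then obtain q1 where q1: "q = [:- c, 1:] * q1" by (auto simp: poly_eq_0_iff_dvd)
    show ?thesis
    proof (cases "(\<lambda>_. 1) \<in> extend_ideal I (\<lambda>x. f x - c)")
      case True
      then obtain h u where hu: "h \<in> I" "u \<in> polynomial_functions"
        and eq: "\<And>x. 1 = h x + (f x - c) * u x" by (auto simp: extend_ideal_def fun_eq_iff)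
      have "poly q1 (f x) = h x * poly q1 (f x) + u x * poly q (f x)" for x
      proof -
        have "poly q1 (f x) = (h x + (f x - c) * u x) * poly q1 (f x)" using eq[of x] by simp
        then show ?thesis by (simp add: q1 algebra_simps)
      qed
      then have "(\<lambda>x. poly q1 (f x)) = (\<lambda>x. h x * poly q1 (f x) + u x * poly q (f x))" by blast
      moreover have "(\<lambda>x. h x * poly q1 (f x) + u x * poly q (f x)) \<in> I"
        by (intro ideal_add[OF I(1)] ideal_mult_right[OF I(1) hu(1)] ideal_mult_left[OF I(1) less(3) hu(2)]
            polynomial_functions_poly f)
      ultimately have "(\<lambda>x. poly q1 (f x)) \<in> I" by simp
      moreover have "q1 \<noteq> 0" using less(2) q1 by auto
      moreover from this have "degree q1 < degree q"
        using degree_mult_eq[of "[:- c, 1:]" q1] unfolding q1 by simp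
      ultimately show ?thesis using less(1) by blast
    qed blast
  qed
qed

text \<open>Adjoin \<open>X l - c l\<close> for one coordinate after the other while keeping the
  ideal proper. By Taylor expansion, the final ideal contains \<open>f - f x0\<close> for the point
  \<open>x0\<close> with coordinates \<open>c\<close>, so \<open>f x0 \<noteq> 0\<close> with
  \<open>f\<close> in \<open>I\<close> would make it improper.\<close>

lemma common_zero_exists:
  assumes I: "is_ideal I" "(\<lambda>_. 1) \<notin> I" "I \<subseteq> polynomial_functions" and S: "spans_mod S B I"
  shows "\<exists>x. \<forall>f\<in>I. f x = 0"
proof -
  have "\<exists>I' c. is_ideal I' \<and> (\<lambda>_. 1) \<notin> I' \<and> I \<subseteq> I' \<and> (\<forall>l<m. (\<lambda>x. X l x - c l) \<in> I')" if "m \<le> n" for m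
    using that
  proof (induction m)
    case 0
    then show ?case using I by blast
  next
    case (Suc m)
    then obtain I' c where I': "is_ideal I'" "(\<lambda>_. 1) \<notin> I'" "I \<subseteq> I'" "\<And>l. l < m \<Longrightarrow> (\<lambda>x. X l x - c l) \<in> I'"
      by auto
    have Xm: "X m \<in> polynomial_functions" using Suc.prems by (intro X_poly) simp
    obtain q where "q \<noteq> 0" "(\<lambda>x. poly q (X m x)) \<in> I'"
      using algebraic_relation_mod[OF I'(1) spans_mod_mono[OF S I'(3)] Xm] by blast
    then obtain d where d: "(\<lambda>_. 1) \<notin> extend_ideal I' (\<lambda>x. X m x - d)"
      using proper_extension[OF I'(1,2) Xm] by blast
    show ?case
    proof (intro exI conjI allI impI)
      show "is_ideal (extend_ideal I' (\<lambda>x. X m x - d))" using I'(1) by (rule is_ideal_extend_ideal)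
      show "I \<subseteq> extend_ideal I' (\<lambda>x. X m x - d)" using I'(3) subset_extend_ideal by blast
      show "(\<lambda>x. X l x - (c(m := d)) l) \<in> extend_ideal I' (\<lambda>x. X m x - d)" if "l < Suc m" for l
      proof (cases "l = m")
        case True
        then show ?thesis using self_in_extend_ideal[OF I'(1)] by simp
      next
        case False
        then show ?thesis using I'(4)[of l] that subset_extend_ideal by auto
      qed
    qed (fact d)
  qed
  then obtain I' c where I': "is_ideal I'" "(\<lambda>_. 1) \<notin> I'" "I \<subseteq> I'" "\<And>l. l < n \<Longrightarrow> (\<lambda>x. X l x - c l) \<in> I'"
    by blast
  let ?x0 = "\<Sum>l<n. c l *s bs l"
  have X0: "X l ?x0 = c l" if "l < n" for l using X_comb[of l "{..<n}" c] that by simp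
  have "f ?x0 = 0" if fI: "f \<in> I" for f
  proof (rule ccontr)
    assume nz: "f ?x0 \<noteq> 0"
    obtain g where g: "\<And>l. g l \<in> polynomial_functions"
      "\<And>x. f x - f ?x0 = (\<Sum>l<n. (X l x - X l ?x0) * g l x)"
      using polynomial_function_taylor[of f ?x0] fI I(3) by blast
    have "(\<lambda>x. \<Sum>l<n. (X l x - c l) * g l x) \<in> I'"
      using I'(4) g(1) by (intro ideal_sum[OF I'(1)] ideal_mult_right[OF I'(1)]) auto
    moreover have "f x - f ?x0 = (\<Sum>l<n. (X l x - c l) * g l x)" for x
      unfolding g(2) by (intro sum.cong) (simp_all only: X0 lessThan_iff)
    ultimately have "(\<lambda>x. f x - f ?x0) \<in> I'" by simp
    then have "(\<lambda>x. f x - (f x - f ?x0)) \<in> I'" using fI I'(3)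
      by (intro ideal_diff[OF I'(1), of f "\<lambda>x. f x - f ?x0"]) auto
    then have "(\<lambda>x. inverse (f ?x0) * f ?x0) \<in> I'"
      using ideal_mult_left[OF I'(1) _ polynomial_functions.const[of "inverse (f ?x0)"]] by fastforce
    then show False using nz I'(2) by simp
  qed
  then show ?thesis by blast
qed

text \<open>The exponent depends on \<open>S\<close> only, neither on \<open>f\<close> nor on the
  ideal. In a relation \<open>q (f)\<close> split off the power of the variable; the remaining
  factor takes a nonzero value wherever \<open>f\<close> vanishes.\<close>

lemma finite_nullstellensatz:
  assumes I: "is_ideal I" "I \<subseteq> polynomial_functions" and S: "spans_mod S B I"
    and f: "f \<in> polynomial_functions" and van: "\<And>x. (\<And>g. g \<in> I \<Longrightarrow> g x = 0) \<Longrightarrow> f x = 0"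
  shows "(\<lambda>x. f x ^ card S) \<in> I"
proof -
  obtain q where q: "q \<noteq> 0" "degree q \<le> card S" "(\<lambda>x. poly q (f x)) \<in> I"
    using algebraic_relation_mod[OF I(1) S f] by blast
  obtain q1 where q1: "q = [:0, 1:] ^ order 0 q * q1" "\<not> [:0, 1:] dvd q1"
    using order_decomp[OF q(1), of 0] by auto
  define j where "j = order 0 q"
  have j: "j \<le> card S" using order_degree[OF q(1), of 0] q(2) by (simp add: j_def)
  have nz: "poly q1 0 \<noteq> 0" using q1(2) by (simp add: poly_eq_0_iff_dvd)
  let ?g = "\<lambda>x. poly q1 (f x)"
  \<comment> \<open>\<open>?g\<close> has no common zero with \<open>I\<close>, because
    \<open>f\<close> vanishes at such a point and \<open>poly q1 0\<close> is nonzero. So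
    \<open>?g\<close> is invertible modulo \<open>I\<close> and can be cancelled from the
    relation.\<close>
  have "(\<lambda>_. 1) \<in> extend_ideal I ?g"
  proof (rule ccontr)
    assume "(\<lambda>_. 1) \<notin> extend_ideal I ?g"
    moreover have "extend_ideal I ?g \<subseteq> polynomial_functions"
      using I(2) f by (auto simp: extend_ideal_def intro!: polynomial_functions_intros polynomial_functions_poly)
    ultimately obtain x where x: "\<And>g. g \<in> extend_ideal I ?g \<Longrightarrow> g x = 0"
      using common_zero_exists[OF is_ideal_extend_ideal[OF I(1)] _ _ spans_mod_mono[OF S subset_extend_ideal]]
      by blast
    then have "f x = 0" using van subset_extend_ideal by blast
    moreover have "poly q1 (f x) = 0" using x[OF self_in_extend_ideal[OF I(1)]] .
    ultimately show False using nz by simp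
  qed
  then obtain h u where hu: "h \<in> I" "u \<in> polynomial_functions"
    and eq: "\<And>x. 1 = h x + ?g x * u x" by (auto simp: extend_ideal_def fun_eq_iff)
  have "f x ^ card S = h x * f x ^ card S + poly q (f x) * (u x * f x ^ (card S - j))" for x
  proof -
    have "f x ^ card S = (h x + ?g x * u x) * (f x ^ j * f x ^ (card S - j))"
      using eq[of x] j by (simp add: power_add[symmetric])
    also have "\<dots> = h x * (f x ^ j * f x ^ (card S - j)) + f x ^ j * ?g x * (u x * f x ^ (card S - j))"
      by (simp add: algebra_simps)
    also have "f x ^ j * ?g x = poly q (f x)"
      by (subst q1(1)) (simp add: j_def)
    finally show ?thesis using j by (simp add: power_add[symmetric])
  qed
  then have "(\<lambda>x. f x ^ card S) = (\<lambda>x. h x * f x ^ card S + poly q (f x) * (u x * f x ^ (card S - j)))"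
    by blast
  moreover have "(\<lambda>x. h x * f x ^ card S + poly q (f x) * (u x * f x ^ (card S - j))) \<in> I"
    using hu f by (intro ideal_add[OF I(1)] ideal_mult_right[OF I(1)] q(3) polynomial_functions_intros)
  ultimately show ?thesis by simp
qed

end

section \<open>Decomposition into irreducible closed sets\<close>

context coordinates
begin

lemma noetherian_polynomial_functions: "noetherian polynomial_functions"
proof -
  define A where "A = rec_nat {f :: 'b \<Rightarrow> 'a. \<exists>c. f = (\<lambda>_. c)} (\<lambda>j A. adjoin A (X j))"
  have A0: "A 0 = {f. \<exists>c. f = (\<lambda>_. c)}" and AS: "A (Suc j) = adjoin (A j) (X j)" for j
    by (simp_all add: A_def)
  have A: "function_ring (A j) \<and> noetherian (A j) \<and> (\<forall>i<j. X i \<in> A j)" for j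
  proof (induction j)
    case 0
    show ?case using noetherian_constants by (auto simp: A0 function_ring_def)
  next
    case (Suc j)
    then show ?case
      using adjoin_self[of "A j" "X j"] adjoin_base[of "A j" "X j"]
      by (auto simp: AS less_Suc_eq intro: function_ring_adjoin noetherian_adjoin)
  qed
  have sub: "A j \<subseteq> polynomial_functions" if "j \<le> n" for j
    using that
  proof (induction j)
    case 0
    show ?case by (auto simp: A0 intro: polynomial_functions.const)
  next
    case (Suc j)
    then show ?case
      by (auto simp: AS adjoin_def poly_lt_def intro!: polynomial_functions_intros X_poly)
  qed
  have "polynomial_functions \<subseteq> A n"
  proof
    fix f assume "f \<in> polynomial_functions"
    then show "f \<in> A n"
    proof (induction rule: polynomial_functions_coordinate_induct)
      case (const c)
      show ?case using A[of n] by (intro function_ringD(1)) simp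
    next
      case (X i)
      then show ?case using A[of n] by simp
    next
      case (add f g)
      then show ?case using A[of n] function_ringD(2)[of "A n" f g] by simp
    next
      case (mult f g)
      then show ?case using A[of n] function_ringD(3)[of "A n" f g] by simp
    qed
  qed
  then have "A n = polynomial_functions" using sub[of n] by blast
  then show ?thesis using A[of n] by simp
qed

text \<open>Choose \<open>f i\<close> that vanishes on the next set of the chain but not on the
  present one. Some \<open>f m\<close> lies in the ideal of its predecessors, all of which vanish on
  \<open>C m\<close>.\<close>

lemma wf_closed: "wf {(C', C). closedin zariski C' \<and> closedin zariski C \<and> C' \<subset> C}"
  unfolding wf_iff_no_infinite_down_chain
proof
  assume "\<exists>C. \<forall>i. (C (Suc i), C i) \<in> {(C', C). closedin zariski C' \<and> closedin zariski C \<and> C' \<subset> C}"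
  then obtain C where "\<forall>i. (C (Suc i), C i) \<in> {(C', C). closedin zariski C' \<and> closedin zariski C \<and> C' \<subset> C}" ..
  then have C: "closedin zariski (C i)" "C (Suc i) \<subset> C i" for i by simp_all
  have mono: "C j \<subseteq> C i" if "i \<le> j" for i j
    using that C(2) by (induction rule: dec_induct) auto
  have "\<exists>f\<in>polynomial_functions. (\<forall>x\<in>C (Suc i). f x = 0) \<and> (\<exists>x\<in>C i. f x \<noteq> 0)" for i
  proof -
    obtain F where F: "F \<subseteq> polynomial_functions" "C (Suc i) = zero_locus F"
      using C(1)[of "Suc i"] by (auto simp: closedin_zariski)
    moreover obtain x where "x \<in> C i" "x \<notin> C (Suc i)" using C(2)[of i] by blast
    ultimately show ?thesis by (auto simp: zero_locus_def)
  qed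
  then obtain f where f: "\<And>i. f i \<in> polynomial_functions" "\<And>i x. x \<in> C (Suc i) \<Longrightarrow> f i x = 0"
    "\<And>i. \<exists>x\<in>C i. f i x \<noteq> 0" by metis
  obtain m where "f m \<in> generated polynomial_functions f m"
    using noetherian_polynomial_functions f(1) by (auto simp: noetherian_def)
  then obtain g where g: "f m = (\<lambda>x. \<Sum>i<m. g i x * f i x)" by (auto simp: generated_def)
  obtain x where x: "x \<in> C m" "f m x \<noteq> 0" using f(3) by blast
  have "f i x = 0" if "i < m" for i using f(2)[of x i] mono[of "Suc i" m] x(1) that by auto
  then show False using x(2) by (simp add: g)
qed

lemma closed_decomposition:
  assumes "closedin zariski C"
  shows "\<exists>\<C>. finite \<C> \<and> (\<forall>D\<in>\<C>. closedin zariski D \<and> prime_set D) \<and> C = \<Union>\<C>"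
  using assms
proof (induction C rule: wf_induct_rule[OF wf_closed])
  case (1 C)
  show ?case
  proof (cases "C = {} \<or> prime_set C")
    case True
    then show ?thesis using 1(2) by (auto intro: exI[of _ "{}"] exI[of _ "{C}"])
  next
    case False
    then have "\<not> irreducible_in zariski C" by (simp add: irreducible_in_zariski_iff)
    then obtain A B where AB: "closedin zariski A" "closedin zariski B" "C \<subseteq> A \<union> B" "\<not> C \<subseteq> A" "\<not> C \<subseteq> B"
      using False by (auto simp: irreducible_in_def)
    have "\<exists>\<C>. finite \<C> \<and> (\<forall>D\<in>\<C>. closedin zariski D \<and> prime_set D) \<and> C \<inter> A = \<Union>\<C>"
      "\<exists>\<C>. finite \<C> \<and> (\<forall>D\<in>\<C>. closedin zariski D \<and> prime_set D) \<and> C \<inter> B = \<Union>\<C>"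
      using AB 1(2) by (auto intro!: 1(1))
    then obtain \<A> \<B> where "finite \<A>" "\<forall>D\<in>\<A>. closedin zariski D \<and> prime_set D" "C \<inter> A = \<Union>\<A>"
      "finite \<B>" "\<forall>D\<in>\<B>. closedin zariski D \<and> prime_set D" "C \<inter> B = \<Union>\<B>" by blast
    moreover have "C = (C \<inter> A) \<union> (C \<inter> B)" using AB(3) by blast
    ultimately show ?thesis by (intro exI[of _ "\<A> \<union> \<B>"]) (auto simp only: finite_Un Union_Un_distrib)
  qed
qed

end

lemma prod_fun_upd:
  assumes "finite A" "j \<in> A" "F j k = t * F j (a j)"
  shows "(\<Prod>i\<in>A. F i ((a(j := k)) i)) = t * (\<Prod>i\<in>A. F i (a i) :: 'k::comm_semiring_1)"
proof -
  have "(\<Prod>i\<in>A - {j}. F i ((a(j := k)) i)) = (\<Prod>i\<in>A - {j}. F i (a i))"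
    by (intro prod.cong) auto
  then show ?thesis using assms by (simp add: prod.remove[OF assms(1,2)] mult.assoc)
qed

section \<open>Freeness over a system of parameters\<close>

context coordinates
begin

text \<open>
  A weight that decreases when a power of \<open>X j\<close> is replaced by monomials of the same degree in
  \<open>X 0, \<dots>, X j\<close> with a smaller exponent of \<open>X j\<close>.
\<close>

definition wt :: "(nat \<Rightarrow> nat) \<Rightarrow> nat" where
  "wt a = (\<Sum>i<n. Suc i * a i)"

lemma wt_add: "wt (\<lambda>i. a i + b i) = wt a + wt b"
  by (simp add: wt_def sum.distrib add_mult_distrib2)

lemma exps_upd_add:
  assumes "j < n" "a \<in> exps n d"
  shows "a(j := a j + k) \<in> exps n (d + k)"
proof -
  have eq: "a(j := a j + k) = (\<lambda>i. a i + (if i = j then k else 0))" by auto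
  have "(\<lambda>i. if i = j then k else 0) \<in> exps n k"
    using assms(1) by (auto simp: exps_def wdeg_single)
  then show ?thesis unfolding eq by (rule exps_add[OF assms(2)])
qed

lemma exps_upd_diff:
  assumes "j < n" "a \<in> exps n d" "k \<le> a j"
  shows "a(j := a j - k) \<in> exps n (d - k)" "k \<le> d" "wt a = wt (a(j := a j - k)) + Suc j * k"
    "mon a x = X j x ^ k * mon (a(j := a j - k)) x"
proof -
  let ?a = "a(j := a j - k)" and ?e = "\<lambda>i. if i = j then k else 0"
  have eq: "a = (\<lambda>i. ?a i + ?e i)" using assms(3) by auto
  have "wdeg a = wdeg ?a + k"
    by (subst eq) (simp only: wdeg_add wdeg_single[OF assms(1)])
  then show "?a \<in> exps n (d - k)" "k \<le> d" using assms(1,2) by (auto simp: exps_def)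
  have "wt ?e = Suc j * k"
    using assms(1) by (simp add: wt_def if_distrib[of "\<lambda>t. _ * t"] cong: if_cong)
  then show "wt a = wt ?a + Suc j * k" by (subst eq) (simp only: wt_add)
  show "mon a x = X j x ^ k * mon ?a x"
    by (subst eq) (simp only: mon_add mon_single[OF assms(1)] mult.commute)
qed

end

text \<open>\<open>Suc j * D j\<close> is the weight of \<open>X j ^ D j\<close>, so
  \<open>g\<close> collects terms of no larger degree and of smaller weight. The cofactors obey the
  degree bounds that keep a rewriting step within the filtration. For \<open>D i > D j\<close> the
  cofactor has to be 0: truncated subtraction would admit a constant there.\<close>

locale parameter_system = closed_coordinates scale n bs X
  for scale :: "'a::alg_closed_field \<Rightarrow> 'b::ab_group_add \<Rightarrow> 'b" (infixr \<open>*s\<close> 75)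
    and n bs X +
  fixes s :: nat and D :: "nat \<Rightarrow> nat" and \<psi> :: "nat \<Rightarrow> 'b \<Rightarrow> 'a"
  assumes s_le_n: "s \<le> n"
    and D_pos: "j < s \<Longrightarrow> 0 < D j"
    and \<psi>_poly: "j < s \<Longrightarrow> \<psi> j \<in> polynomial_functions"
    and reduction: "j < s \<Longrightarrow> \<exists>g f h. g \<in> fs.span (mon ` {a \<in> exps n (D j). wt a < Suc j * D j}) \<and>
      (\<forall>i<s. if D i \<le> D j then f i \<in> polys n (D j - D i) else f i = (\<lambda>_. 0)) \<and>
      (\<forall>l. h l \<in> polys n (D j - 1)) \<and>
      (\<forall>x. X j x ^ D j = g x + (\<Sum>i<s. \<psi> i x * f i x) + (\<Sum>l\<in>{s..<n}. X l x * h l x))"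
begin

text \<open>
  A basis of the polynomial functions that is adapted to the parameters \<open>\<psi> j\<close> and \<open>X l - c l\<close>.
  Division with remainder of the exponent of \<open>X j\<close> by \<open>D j = deg (\<psi> j)\<close> lets the monomials index
  it, so that spanning implies independence by counting.
\<close>

definition \<Phi> :: "(nat \<Rightarrow> 'a) \<Rightarrow> (nat \<Rightarrow> nat) \<Rightarrow> 'b \<Rightarrow> 'a" where
  "\<Phi> c a x = (\<Prod>j<s. \<psi> j x ^ (a j div D j) * X j x ^ (a j mod D j)) * (\<Prod>l\<in>{s..<n}. (X l x - c l) ^ a l)"

lemma \<Phi>_poly: "\<Phi> c a \<in> polynomial_functions"
  unfolding \<Phi>_def[abs_def] using s_le_n
  by (auto intro!: polynomial_functions_intros X_poly \<psi>_poly)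

lemma \<Phi>_mult_\<psi>:
  assumes "j < s"
  shows "\<Phi> c (a(j := a j + D j)) x = \<psi> j x * \<Phi> c a x"
proof -
  have "(\<Prod>i<s. \<psi> i x ^ ((a(j := a j + D j)) i div D i) * X i x ^ ((a(j := a j + D j)) i mod D i)) =
      \<psi> j x * (\<Prod>i<s. \<psi> i x ^ (a i div D i) * X i x ^ (a i mod D i))"
    using assms D_pos[OF assms]
    by (intro prod_fun_upd[where F = "\<lambda>i m. \<psi> i x ^ (m div D i) * X i x ^ (m mod D i)"]) auto
  moreover have "(\<Prod>l\<in>{s..<n}. (X l x - c l) ^ (a(j := a j + D j)) l) = (\<Prod>l\<in>{s..<n}. (X l x - c l) ^ a l)"
    using assms by (intro prod.cong) auto
  ultimately show ?thesis by (simp only: \<Phi>_def mult.assoc)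
qed

lemma \<Phi>_mult_X:
  assumes "l \<in> {s..<n}"
  shows "\<Phi> c (a(l := Suc (a l))) x = (X l x - c l) * \<Phi> c a x"
proof -
  have "(\<Prod>i\<in>{s..<n}. (X i x - c i) ^ (a(l := Suc (a l))) i) =
      (X l x - c l) * (\<Prod>i\<in>{s..<n}. (X i x - c i) ^ a i)"
    using assms by (intro prod_fun_upd[where F = "\<lambda>i m. (X i x - c i) ^ m"]) auto
  moreover have "(\<Prod>j<s. \<psi> j x ^ ((a(l := Suc (a l))) j div D j) * X j x ^ ((a(l := Suc (a l))) j mod D j)) =
      (\<Prod>j<s. \<psi> j x ^ (a j div D j) * X j x ^ (a j mod D j))"
    using assms by (intro prod.cong) auto
  ultimately show ?thesis by (simp only: \<Phi>_def mult_ac)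
qed

text \<open>The exponents for which \<open>\<Phi> c a\<close> has no parameter as a factor; their
  number is the product of the \<open>D j\<close>.\<close>

definition small :: "(nat \<Rightarrow> nat) set" where
  "small = {a. (\<forall>i. a i \<noteq> 0 \<longrightarrow> i < s) \<and> (\<forall>j<s. a j < D j)}"

lemma \<Phi>_eq_mon:
  assumes "\<And>j. j < s \<Longrightarrow> a j < D j"
  shows "\<Phi> (\<lambda>_. 0) a x = mon a x"
proof -
  have "{..<n} = {..<s} \<union> {s..<n}" using s_le_n by auto
  moreover have "{..<s} \<inter> {s..<n} = {}" by auto
  ultimately have "mon a x = (\<Prod>i<s. X i x ^ a i) * (\<Prod>i\<in>{s..<n}. X i x ^ a i)"
    unfolding mon_def by (simp add: prod.union_disjoint)
  then show ?thesis using assms by (simp add: \<Phi>_def)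
qed

lemma \<Phi>_small: "a \<in> small \<Longrightarrow> \<Phi> c a x = mon a x"
proof -
  assume a: "a \<in> small"
  have "\<Phi> c a x = \<Phi> (\<lambda>_. 0) a x"
  proof -
    have "(\<Prod>l\<in>{s..<n}. (X l x - c l) ^ a l) = (\<Prod>l\<in>{s..<n}. (X l x - 0) ^ a l)"
    proof (rule prod.cong[OF refl])
      fix l assume "l \<in> {s..<n}"
      then have "a l = 0" using a by (force simp: small_def)
      then show "(X l x - c l) ^ a l = (X l x - 0) ^ a l" by simp
    qed
    then show ?thesis by (simp add: \<Phi>_def)
  qed
  also have "\<dots> = mon a x" using a by (intro \<Phi>_eq_mon) (auto simp: small_def)
  finally show ?thesis .
qed

definition \<Phi>_span :: "(nat \<Rightarrow> 'a) \<Rightarrow> nat \<Rightarrow> ('b \<Rightarrow> 'a) set" where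
  "\<Phi>_span c d = fs.span (\<Phi> c ` exps n d)"

lemma \<Phi>_span_mono: "d \<le> d' \<Longrightarrow> \<Phi>_span c d \<subseteq> \<Phi>_span c d'"
  unfolding \<Phi>_span_def by (intro fs.span_mono image_mono exps_mono order_refl)

text \<open>A multiple of a parameter avoids the basis elements indexed by \<open>small\<close>.
  Independence modulo the parameters depends on this sharper target.\<close>

lemma \<Phi>_span_mult_\<psi>:
  assumes "j < s" "f \<in> \<Phi>_span c d"
  shows "(\<lambda>x. \<psi> j x * f x) \<in> fs.span (\<Phi> c ` (exps n (d + D j) - small))"
  using assms(2) unfolding \<Phi>_span_def
proof (rule fspan_mult)
  fix b assume "b \<in> \<Phi> c ` exps n d"
  then obtain a where a: "a \<in> exps n d" "b = \<Phi> c a" by auto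
  have "a(j := a j + D j) \<in> exps n (d + D j) - small"
    using exps_upd_add[OF _ a(1), of j "D j"] assms(1) s_le_n by (auto simp: small_def)
  then have "\<Phi> c (a(j := a j + D j)) \<in> fs.span (\<Phi> c ` (exps n (d + D j) - small))"
    by (intro fs.span_base imageI)
  moreover have "\<Phi> c (a(j := a j + D j)) = (\<lambda>x. \<psi> j x * b x)"
    using \<Phi>_mult_\<psi>[OF assms(1), of c a] by (simp add: a(2) fun_eq_iff)
  ultimately show "(\<lambda>x. \<psi> j x * b x) \<in> fs.span (\<Phi> c ` (exps n (d + D j) - small))" by simp
qed

lemma \<Phi>_span_mult_X:
  assumes "l \<in> {s..<n}" "f \<in> \<Phi>_span c d"
  shows "(\<lambda>x. (X l x - c l) * f x) \<in> fs.span (\<Phi> c ` (exps n (Suc d) - small))"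
  using assms(2) unfolding \<Phi>_span_def
proof (rule fspan_mult)
  fix b assume "b \<in> \<Phi> c ` exps n d"
  then obtain a where a: "a \<in> exps n d" "b = \<Phi> c a" by auto
  have "a(l := Suc (a l)) \<in> exps n (Suc d) - small"
    using exps_upd_add[OF _ a(1), of l 1] assms(1) by (auto simp: small_def)
  then have "\<Phi> c (a(l := Suc (a l))) \<in> fs.span (\<Phi> c ` (exps n (Suc d) - small))"
    by (intro fs.span_base imageI)
  moreover have "\<Phi> c (a(l := Suc (a l))) = (\<lambda>x. (X l x - c l) * b x)"
    using \<Phi>_mult_X[OF assms(1), of c a] by (simp add: a(2) fun_eq_iff)
  ultimately show "(\<lambda>x. (X l x - c l) * b x) \<in> fs.span (\<Phi> c ` (exps n (Suc d) - small))" by simp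
qed

lemma nonsmall_span_subset: "fs.span (\<Phi> c ` (exps n d - small)) \<subseteq> \<Phi>_span c d"
  unfolding \<Phi>_span_def by (intro fs.span_mono image_mono) auto

text \<open>A rewriting argument, by induction on the degree and then on the weight. Replacing
  \<open>X j ^ D j\<close> yields monomials of smaller weight, and multiples of some
  \<open>\<psi> i\<close> or \<open>X l\<close> whose cofactors have smaller degree; multiplication
  by \<open>\<psi> i\<close> or \<open>X l - c l\<close> maps basis elements to basis
  elements.\<close>

lemma mon_in_\<Phi>_span: "a \<in> exps n d \<Longrightarrow> mon a \<in> \<Phi>_span c d"
proof (induction d arbitrary: a rule: less_induct)
  case (less d)
  have IH: "polys n d' \<subseteq> \<Phi>_span c d'" if "d' < d" for d'
  proof -
    have "mon ` exps n d' \<subseteq> fs.span (\<Phi> c ` exps n d')"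
      using less.IH[OF that] by (auto simp: \<Phi>_span_def)
    then show ?thesis unfolding polys_def \<Phi>_span_def by (rule fs.span_minimal) (rule fs.subspace_span)
  qed
  \<comment> \<open>Only \<open>X l - c l\<close> shifts the basis. The correction
    \<open>c l\<close> costs nothing, as the cofactor has degree below \<open>d\<close>.\<close>
  have y: "(\<lambda>x. X l x * f x) \<in> \<Phi>_span c d" if l: "l \<in> {s..<n}" and d: "d \<ge> 1" and f: "f \<in> polys n (d - 1)" for l f
  proof -
    have f': "f \<in> \<Phi>_span c (d - 1)" using IH[of "d - 1"] f d by auto
    have "(\<lambda>x. (X l x - c l) * f x) \<in> \<Phi>_span c d"
      using \<Phi>_span_mult_X[OF l f'] d nonsmall_span_subset[of c d] by auto
    moreover have "f \<in> \<Phi>_span c d" using f' \<Phi>_span_mono[of "d - 1" d c] by auto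
    ultimately have "(\<lambda>x. (X l x - c l) * f x + c l * f x) \<in> \<Phi>_span c d"
      unfolding \<Phi>_span_def by (intro fspan_add fspan_scale)
    then show ?thesis by (simp add: algebra_simps)
  qed
  show ?case
    using less.prems
  proof (induction "wt a" arbitrary: a rule: less_induct)
    case inner: (less a)
    consider l where "l \<in> {s..<n}" "a l > 0" | j where "j < s" "D j \<le> a j"
      | "\<And>j. j < s \<Longrightarrow> a j < D j" "\<And>l. l \<in> {s..<n} \<Longrightarrow> a l = 0"
      by (metis gr0I not_le)
    then show ?case
    proof cases
      case 1
      have red: "a(l := a l - 1) \<in> exps n (d - 1)" "1 \<le> d" "mon a = (\<lambda>x. X l x * mon (a(l := a l - 1)) x)"
        using exps_upd_diff[OF _ inner.prems, of l 1] 1 by auto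
      then show ?thesis unfolding red(3) using 1 by (intro y mon_polys) auto
    next
      case 2
      have jn: "j < n" using 2 s_le_n by simp
      let ?a = "a(j := a j - D j)"
      note red = exps_upd_diff[OF jn inner.prems 2(2)]
      obtain g f h where g: "g \<in> fs.span (mon ` {a \<in> exps n (D j). wt a < Suc j * D j})"
        and f: "\<And>i. i < s \<Longrightarrow> if D i \<le> D j then f i \<in> polys n (D j - D i) else f i = (\<lambda>_. 0)"
        and h: "\<And>l. h l \<in> polys n (D j - 1)"
        and eq: "\<And>x. X j x ^ D j = g x + (\<Sum>i<s. \<psi> i x * f i x) + (\<Sum>l\<in>{s..<n}. X l x * h l x)"
        using reduction[OF 2(1)] by blast
      have "mon a = (\<lambda>x. mon ?a x * g x + (\<Sum>i<s. \<psi> i x * (f i x * mon ?a x)) +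
          (\<Sum>l\<in>{s..<n}. X l x * (h l x * mon ?a x)))"
        unfolding red(4) eq by (simp add: algebra_simps sum_distrib_left sum_distrib_right)
      moreover have "(\<lambda>x. mon ?a x * g x) \<in> \<Phi>_span c d"
        using g unfolding \<Phi>_span_def
      proof (rule fspan_mult)
        fix b assume "b \<in> mon ` {a \<in> exps n (D j). wt a < Suc j * D j}"
        then obtain a' where a': "a' \<in> exps n (D j)" "wt a' < Suc j * D j" "b = mon a'" by auto
        have "(\<lambda>i. ?a i + a' i) \<in> exps n d"
          using exps_add[OF red(1) a'(1)] red(2) by simp
        moreover have "wt (\<lambda>i. ?a i + a' i) < wt a" using a'(2) red(3) by (simp only: wt_add)
        ultimately have "mon (\<lambda>i. ?a i + a' i) \<in> \<Phi>_span c d" using inner.hyps by blast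
        then show "(\<lambda>x. mon ?a x * b x) \<in> fs.span (\<Phi> c ` exps n d)"
          by (simp only: a'(3) mon_add[abs_def] \<Phi>_span_def)
      qed
      moreover have "(\<lambda>x. \<Sum>i<s. \<psi> i x * (f i x * mon ?a x)) \<in> \<Phi>_span c d"
        unfolding \<Phi>_span_def
      proof (rule fspan_sum, unfold lessThan_iff)
        fix i assume i: "i < s"
        show "(\<lambda>x. \<psi> i x * (f i x * mon ?a x)) \<in> fs.span (\<Phi> c ` exps n d)"
        proof (cases "D i \<le> D j")
          case True
          then have "(\<lambda>x. f i x * mon ?a x) \<in> polys n ((D j - D i) + (d - D j))"
            using f[OF i] by (intro polys_mult mon_polys red(1)) simp
          moreover have "(D j - D i) + (d - D j) = d - D i" using True red(2) by simp
          ultimately have "(\<lambda>x. f i x * mon ?a x) \<in> \<Phi>_span c (d - D i)"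
            using IH[of "d - D i"] D_pos[OF i] True red(2) by auto
          then have "(\<lambda>x. \<psi> i x * (f i x * mon ?a x)) \<in> fs.span (\<Phi> c ` (exps n (d - D i + D i) - small))"
            by (rule \<Phi>_span_mult_\<psi>[OF i])
          then show ?thesis
            using nonsmall_span_subset[of c d] True red(2) by (auto simp: \<Phi>_span_def)
        next
          case False
          then show ?thesis using f[OF i] by (simp add: fspan_zero)
        qed
      qed
      moreover have "(\<lambda>x. \<Sum>l\<in>{s..<n}. X l x * (h l x * mon ?a x)) \<in> \<Phi>_span c d"
        unfolding \<Phi>_span_def
      proof (rule fspan_sum)
        fix l assume l: "l \<in> {s..<n}"
        have "(\<lambda>x. h l x * mon ?a x) \<in> polys n ((D j - 1) + (d - D j))"
          using h by (intro polys_mult mon_polys red(1))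
        moreover have "(D j - 1) + (d - D j) = d - 1" "d \<ge> 1" using red(2) D_pos[OF 2(1)] by auto
        ultimately show "(\<lambda>x. X l x * (h l x * mon ?a x)) \<in> fs.span (\<Phi> c ` exps n d)"
          using y[OF l] by (simp add: \<Phi>_span_def)
      qed
      ultimately show ?thesis
        unfolding \<Phi>_span_def by (simp only:) (intro fspan_add)
    next
      case 3
      have "i < s" if "a i \<noteq> 0" for i
        using 3(2)[of i] inner.prems that by (cases "i < s") (auto simp: exps_def)
      then have "a \<in> small" using 3(1) by (simp add: small_def)
      then have "mon a = \<Phi> c a" using \<Phi>_small by auto
      then show ?thesis using inner.prems by (simp add: \<Phi>_span_def fs.span_base)
    qed
  qed
qed

lemma polys_subset_\<Phi>_span: "polys n d \<subseteq> \<Phi>_span c d"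
proof -
  have "mon ` exps n d \<subseteq> fs.span (\<Phi> c ` exps n d)"
    using mon_in_\<Phi>_span by (auto simp: \<Phi>_span_def)
  then show ?thesis unfolding polys_def \<Phi>_span_def by (rule fs.span_minimal) (rule fs.subspace_span)
qed

lemma \<Phi>_independent: "family_independent (exps n d) (\<Phi> c)"
  using finite_exps mon_independent
  by (rule family_independent_if_spans) (use mon_in_\<Phi>_span in \<open>auto simp: \<Phi>_span_def\<close>)

lemma polynomial_in_\<Phi>_span: "f \<in> polynomial_functions \<Longrightarrow> \<exists>d. f \<in> \<Phi>_span c d"
  using polynomial_function_in_polys polys_subset_\<Phi>_span by blast

lemma polynomials_in_\<Phi>_span:
  assumes "finite A" "\<And>i. i \<in> A \<Longrightarrow> f i \<in> polynomial_functions"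
  shows "\<exists>d. \<forall>i\<in>A. f i \<in> \<Phi>_span c d"
  using assms
proof (induction A rule: finite_induct)
  case (insert i A)
  then obtain d d' where "\<forall>i\<in>A. f i \<in> \<Phi>_span c d" "f i \<in> \<Phi>_span c d'"
    using polynomial_in_\<Phi>_span by (metis insertCI)
  then show ?case
    using \<Phi>_span_mono[of d "max d d'" c] \<Phi>_span_mono[of d' "max d d'" c]
    by (intro exI[of _ "max d d'"]) auto
qed simp

lemma small_subset_exps: "small \<subseteq> exps n (\<Sum>j<s. D j)"
proof
  fix a assume a: "a \<in> small"
  have "wdeg a = (\<Sum>i<s. a i)"
    unfolding wdeg_def using a s_le_n by (intro sum.mono_neutral_right) (auto simp: small_def)
  also have "\<dots> \<le> (\<Sum>j<s. D j)" using a by (intro sum_mono) (auto simp: small_def intro: less_imp_le)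
  finally show "a \<in> exps n (\<Sum>j<s. D j)" using a s_le_n
    by (auto simp: small_def exps_def intro: less_le_trans)
qed

lemma finite_small: "finite small"
  using small_subset_exps finite_exps by (rule finite_subset)

section \<open>The ideals of the fibres\<close>

text \<open>The ideal of the fibre, over the point with coordinates \<open>c l\<close>, of the
  common zeros of the \<open>\<psi> i\<close>. It may fail to be radical.\<close>

definition param_ideal :: "(nat \<Rightarrow> 'a) \<Rightarrow> ('b \<Rightarrow> 'a) set" where
  "param_ideal c = {\<lambda>x. (\<Sum>i<s. \<psi> i x * f i x) + (\<Sum>l\<in>{s..<n}. (X l x - c l) * g l x) | f g.
     (\<forall>i. f i \<in> polynomial_functions) \<and> (\<forall>l. g l \<in> polynomial_functions)}"

lemma param_idealI:
  "(\<And>i. f i \<in> polynomial_functions) \<Longrightarrow> (\<And>l. g l \<in> polynomial_functions) \<Longrightarrow>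
    (\<lambda>x. (\<Sum>i<s. \<psi> i x * f i x) + (\<Sum>l\<in>{s..<n}. (X l x - c l) * g l x)) \<in> param_ideal c"
  unfolding param_ideal_def by blast

lemma param_ideal_subset: "param_ideal c \<subseteq> polynomial_functions"
  unfolding param_ideal_def using s_le_n by (auto intro!: polynomial_functions_intros X_poly \<psi>_poly)

lemma is_ideal_param_ideal: "is_ideal (param_ideal c)"
  unfolding is_ideal_def
proof (intro conjI ballI)
  show "(\<lambda>_. 0) \<in> param_ideal c"
    using param_idealI[of "\<lambda>_ _. 0" "\<lambda>_ _. 0" c] by (simp add: polynomial_functions.const)
  fix u v assume "u \<in> param_ideal c"
  then obtain f g where u: "\<And>i. f i \<in> polynomial_functions" "\<And>l. g l \<in> polynomial_functions"
    "u = (\<lambda>x. (\<Sum>i<s. \<psi> i x * f i x) + (\<Sum>l\<in>{s..<n}. (X l x - c l) * g l x))"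
    by (auto simp: param_ideal_def)
  show "(\<lambda>x. u x + v x) \<in> param_ideal c" if "v \<in> param_ideal c"
  proof -
    from that obtain f' g' where v: "\<And>i. f' i \<in> polynomial_functions" "\<And>l. g' l \<in> polynomial_functions"
      "v = (\<lambda>x. (\<Sum>i<s. \<psi> i x * f' i x) + (\<Sum>l\<in>{s..<n}. (X l x - c l) * g' l x))"
      by (auto simp: param_ideal_def)
    have "(\<lambda>x. u x + v x) = (\<lambda>x. (\<Sum>i<s. \<psi> i x * (f i x + f' i x)) +
        (\<Sum>l\<in>{s..<n}. (X l x - c l) * (g l x + g' l x)))"
      by (simp add: u(3) v(3) distrib_left sum.distrib add_ac)
    then show ?thesis
      using u(1,2) v(1,2) by (simp only:) (intro param_idealI polynomial_functions_intros)
  qed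
  show "(\<lambda>x. u x * v x) \<in> param_ideal c" if "v \<in> polynomial_functions"
  proof -
    have "(\<lambda>x. u x * v x) = (\<lambda>x. (\<Sum>i<s. \<psi> i x * (f i x * v x)) +
        (\<Sum>l\<in>{s..<n}. (X l x - c l) * (g l x * v x)))"
      by (simp add: u(3) distrib_right sum_distrib_right mult.assoc)
    then show ?thesis
      using u(1,2) that by (simp only:) (intro param_idealI polynomial_functions_intros)
  qed
qed

lemma \<psi>_in_param_ideal: "j < s \<Longrightarrow> \<psi> j \<in> param_ideal c"
  using param_idealI[of "\<lambda>i _. if i = j then 1 else 0" "\<lambda>_ _. 0" c]
  by (simp add: polynomial_functions.const if_distrib[of "\<lambda>t. _ * t"] cong: if_cong)

lemma X_in_param_ideal: "l \<in> {s..<n} \<Longrightarrow> (\<lambda>x. X l x - c l) \<in> param_ideal c"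
  using param_idealI[of "\<lambda>_ _. 0" "\<lambda>i _. if i = l then 1 else 0" c]
  by (simp add: polynomial_functions.const if_distrib[of "\<lambda>t. _ * t"] cong: if_cong)

lemma \<Phi>_in_param_ideal:
  assumes "a \<in> exps n d" "a \<notin> small"
  shows "\<Phi> c a \<in> param_ideal c"
proof -
  consider j where "j < s" "D j \<le> a j" | l where "l \<in> {s..<n}" "a l > 0"
    using assms by (auto simp: small_def exps_def) (meson atLeastLessThan_iff gr0I not_le)+
  then show ?thesis
  proof cases
    case 1
    then have "\<Phi> c a = (\<lambda>x. \<psi> j x * \<Phi> c (a(j := a j - D j)) x)"
      using \<Phi>_mult_\<psi>[OF 1(1), of c "a(j := a j - D j)"] by auto
    then show ?thesis
      using ideal_mult_right[OF is_ideal_param_ideal \<psi>_in_param_ideal[OF 1(1)] \<Phi>_poly] by simp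
  next
    case 2
    then have "\<Phi> c a = (\<lambda>x. (X l x - c l) * \<Phi> c (a(l := a l - 1)) x)"
      using \<Phi>_mult_X[OF 2(1), of c "a(l := a l - 1)"] by auto
    then show ?thesis
      using ideal_mult_right[OF is_ideal_param_ideal X_in_param_ideal[OF 2(1)] \<Phi>_poly] by simp
  qed
qed

lemma spans_mod_param_ideal: "spans_mod small mon (param_ideal c)"
  unfolding spans_mod_def
proof (intro conjI ballI finite_small)
  fix f assume "f \<in> polynomial_functions"
  then obtain d where d: "f \<in> \<Phi>_span c d" using polynomial_in_\<Phi>_span by blast
  then obtain k where k: "f = (\<lambda>x. \<Sum>a\<in>exps n d. k a * \<Phi> c a x)"
    unfolding \<Phi>_span_def using finite_exps by (rule span_imageE)
  have "f x - (\<Sum>r\<in>small. (if r \<in> exps n d then k r else 0) * mon r x) =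
      (\<Sum>a\<in>exps n d - small. k a * \<Phi> c a x)" for x
  proof -
    have "(\<Sum>r\<in>small. (if r \<in> exps n d then k r else 0) * mon r x) = (\<Sum>a\<in>exps n d \<inter> small. k a * \<Phi> c a x)"
      by (rule sum.mono_neutral_cong_right) (auto simp: finite_small \<Phi>_small)
    moreover have "f x = (\<Sum>a\<in>exps n d - small. k a * \<Phi> c a x) + (\<Sum>a\<in>exps n d \<inter> small. k a * \<Phi> c a x)"
      unfolding k by (subst sum.Int_Diff[OF finite_exps, of _ _ _ small]) simp
    ultimately show ?thesis by simp
  qed
  moreover have "(\<lambda>x. \<Sum>a\<in>exps n d - small. k a * \<Phi> c a x) \<in> param_ideal c"
    by (intro ideal_sum[OF is_ideal_param_ideal] ideal_mult_left[OF is_ideal_param_ideal]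
        polynomial_functions.const \<Phi>_in_param_ideal) auto
  ultimately show "\<exists>k. (\<lambda>x. f x - (\<Sum>r\<in>small. k r * mon r x)) \<in> param_ideal c"
    by (intro exI[of _ "\<lambda>r. if r \<in> exps n d then k r else 0"]) simp
qed

text \<open>Together with the spanning statement, the monomials from \<open>small\<close> are a
  basis modulo \<open>param_ideal c\<close> for every \<open>c\<close>, and this constancy is the
  freeness used later. A member of the ideal involves only \<open>\<Phi> c a\<close> with
  \<open>a\<close> outside \<open>small\<close>, the given sum only those inside.\<close>

lemma small_independent_mod:
  assumes "(\<lambda>x. \<Sum>r\<in>small. k r * mon r x) \<in> param_ideal c" "r \<in> small"
  shows "k r = 0"
proof -
  obtain f g where fg: "\<And>i. f i \<in> polynomial_functions" "\<And>l. g l \<in> polynomial_functions"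
    and eq: "(\<lambda>x. \<Sum>r\<in>small. k r * mon r x) = (\<lambda>x. (\<Sum>i<s. \<psi> i x * f i x) + (\<Sum>l\<in>{s..<n}. (X l x - c l) * g l x))"
    using assms(1) unfolding param_ideal_def by blast
  obtain d1 where d1: "\<forall>i\<in>{..<s}. f i \<in> \<Phi>_span c d1"
    using polynomials_in_\<Phi>_span[of "{..<s}" f] fg by blast
  obtain d2 where d2: "\<forall>l\<in>{s..<n}. g l \<in> \<Phi>_span c d2"
    using polynomials_in_\<Phi>_span[of "{s..<n}" g] fg by blast
  \<comment> \<open>A common degree bound for \<open>small\<close> and for the products with each
    \<open>\<psi> i\<close> and each \<open>X l - c l\<close>.\<close>
  define d where "d = d1 + Suc d2 + (\<Sum>j<s. D j)"
  let ?E = "exps n d"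
  have "small \<subseteq> ?E" using small_subset_exps exps_mono[of n n "\<Sum>j<s. D j" d] by (auto simp: d_def)
  have "(\<lambda>x. \<psi> i x * f i x) \<in> fs.span (\<Phi> c ` (?E - small))" if i: "i < s" for i
  proof -
    have "D i \<le> (\<Sum>j<s. D j)" using i by (intro member_le_sum) auto
    then have "d1 + D i \<le> d" by (simp add: d_def)
    then have "\<Phi> c ` (exps n (d1 + D i) - small) \<subseteq> \<Phi> c ` (?E - small)"
      using exps_mono[of n n "d1 + D i" d] by auto
    then show ?thesis using \<Phi>_span_mult_\<psi>[OF i, of "f i" c d1] d1 i fs.span_mono by blast
  qed
  moreover have "(\<lambda>x. (X l x - c l) * g l x) \<in> fs.span (\<Phi> c ` (?E - small))" if l: "l \<in> {s..<n}" for l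
  proof -
    have "\<Phi> c ` (exps n (Suc d2) - small) \<subseteq> \<Phi> c ` (?E - small)"
      using exps_mono[of n n "Suc d2" d] by (auto simp: d_def)
    then show ?thesis using \<Phi>_span_mult_X[OF l, of "g l" c d2] d2 l fs.span_mono by blast
  qed
  ultimately have "(\<lambda>x. \<Sum>r\<in>small. k r * mon r x) \<in> fs.span (\<Phi> c ` (?E - small))"
    unfolding eq by (intro fspan_add fspan_sum) auto
  then obtain k' where k': "(\<lambda>x. \<Sum>r\<in>small. k r * mon r x) = (\<lambda>x. \<Sum>a\<in>?E - small. k' a * \<Phi> c a x)"
    using finite_exps by (auto elim: span_imageE)
  have "(\<Sum>a\<in>?E. (if a \<in> small then k a else - k' a) * \<Phi> c a x) = 0" for x
  proof -
    have "(\<Sum>a\<in>?E. (if a \<in> small then k a else - k' a) * \<Phi> c a x) =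
        (\<Sum>a\<in>?E \<inter> small. k a * \<Phi> c a x) + (\<Sum>a\<in>?E - small. - k' a * \<Phi> c a x)"
      by (subst sum.Int_Diff[OF finite_exps, of _ _ _ small]) (auto intro!: arg_cong2[of _ _ _ _ "(+)"] sum.cong)
    also have "(\<Sum>a\<in>?E \<inter> small. k a * \<Phi> c a x) = (\<Sum>r\<in>small. k r * mon r x)"
      using \<open>small \<subseteq> ?E\<close> by (intro sum.cong) (auto simp: \<Phi>_small)
    also have "\<dots> = (\<Sum>a\<in>?E - small. k' a * \<Phi> c a x)" using k' by meson
    finally show ?thesis by (simp add: sum_negf)
  qed
  then have "\<forall>a\<in>?E. (if a \<in> small then k a else - k' a) = 0"
    using \<Phi>_independent[of d c, unfolded family_independent_def, THEN spec,
      of "\<lambda>a. if a \<in> small then k a else - k' a"] by simp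
  then show ?thesis using assms(2) \<open>small \<subseteq> ?E\<close> by (metis subsetD)
qed

end

section \<open>Components of the zero locus\<close>

lemma irreducible_in_subtopology:
  "irreducible_in (subtopology T S) C \<longleftrightarrow> C \<subseteq> S \<and> irreducible_in T C"
proof
  assume irr: "irreducible_in (subtopology T S) C"
  then have C: "C \<subseteq> S" "C \<subseteq> topspace T" "C \<noteq> {}" by (auto simp: irreducible_in_def)
  have "C \<subseteq> A \<or> C \<subseteq> B" if "closedin T A" "closedin T B" "C \<subseteq> A \<union> B" for A B
  proof -
    have "closedin (subtopology T S) (A \<inter> S)" "closedin (subtopology T S) (B \<inter> S)"
      using that by (auto simp: closedin_subtopology)
    moreover have "C \<subseteq> (A \<inter> S) \<union> (B \<inter> S)" using that C by auto
    ultimately have "C \<subseteq> A \<inter> S \<or> C \<subseteq> B \<inter> S" using irr unfolding irreducible_in_def by blast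
    then show ?thesis by auto
  qed
  then show "C \<subseteq> S \<and> irreducible_in T C" using C by (simp add: irreducible_in_def)
next
  assume irr: "C \<subseteq> S \<and> irreducible_in T C"
  have "C \<subseteq> A \<or> C \<subseteq> B" if "closedin (subtopology T S) A" "closedin (subtopology T S) B" "C \<subseteq> A \<union> B" for A B
  proof -
    from that(1,2) obtain A' B' where AB: "closedin T A'" "A = A' \<inter> S" "closedin T B'" "B = B' \<inter> S"
      unfolding closedin_subtopology by blast
    then have "C \<subseteq> A' \<union> B'" using that by auto
    then have "C \<subseteq> A' \<or> C \<subseteq> B'" using irr AB unfolding irreducible_in_def by blast
    then show ?thesis using AB irr by auto
  qed
  then show "irreducible_in (subtopology T S) C"
    using irr by (auto simp: irreducible_in_def)
qed

lemma irreducible_in_finite_union: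
  assumes "irreducible_in T C" "finite \<C>" "\<And>D. D \<in> \<C> \<Longrightarrow> closedin T D" "C \<subseteq> \<Union>\<C>"
  shows "\<exists>D\<in>\<C>. C \<subseteq> D"
  using assms(2-)
proof (induction \<C> rule: finite_induct)
  case empty
  then show ?case using assms(1) by (simp add: irreducible_in_def)
next
  case (insert D \<C>)
  have "closedin T (\<Union>\<C>)" using insert by (intro closedin_Union) auto
  then have "C \<subseteq> D \<or> C \<subseteq> \<Union>\<C>"
    using assms(1) insert.prems unfolding irreducible_in_def by auto
  then show ?case using insert by auto
qed

definition box :: "nat set \<Rightarrow> nat \<Rightarrow> (nat \<Rightarrow> nat) set" where
  "box J K = {a. (\<forall>i. a i \<noteq> 0 \<longrightarrow> i \<in> J) \<and> (\<forall>i\<in>J. a i \<le> K)}"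

lemma card_box:
  assumes "finite J"
  shows "finite (box J K)" "card (box J K) = Suc K ^ card J"
proof -
  define z where "z = (\<lambda>f i. if i \<in> J then f i else 0 :: nat)"
  have eq: "box J K = z ` (J \<rightarrow>\<^sub>E {..K})"
  proof (intro equalityI subsetI)
    fix a assume "a \<in> box J K"
    then have "a = z (restrict a J)" "restrict a J \<in> J \<rightarrow>\<^sub>E {..K}" by (auto simp: z_def box_def fun_eq_iff)
    then show "a \<in> z ` (J \<rightarrow>\<^sub>E {..K})" by blast
  qed (auto simp: z_def box_def PiE_def Pi_def split: if_splits)
  have "inj_on z (J \<rightarrow>\<^sub>E {..K})"
  proof (rule inj_onI)
    fix f g assume fg: "f \<in> J \<rightarrow>\<^sub>E {..K}" "g \<in> J \<rightarrow>\<^sub>E {..K}" "z f = z g"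
    show "f = g"
    proof (rule PiE_ext[OF fg(1,2)])
      fix i assume "i \<in> J"
      then show "f i = g i" using fun_cong[OF fg(3), of i] by (simp add: z_def)
    qed
  qed
  then show "card (box J K) = Suc K ^ card J" using assms by (simp add: eq card_image card_PiE)
  show "finite (box J K)" unfolding eq using assms by (intro finite_imageI finite_PiE) auto
qed

context parameter_system
begin

lemma closedin_zero_locus: "F \<subseteq> polynomial_functions \<Longrightarrow> closedin zariski (zero_locus F)"
  unfolding closedin_zariski by blast

section \<open>Polynomials in the coordinates off the torus\<close>

text \<open>That \<open>f\<close> depends only on the first \<open>i\<close> coordinates off the
  torus is expressed as \<open>f (pr i x) = f x\<close>, so that all functions stay on the same
  space.\<close>

definition pr :: "nat \<Rightarrow> 'b \<Rightarrow> 'b" where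
  "pr i x = (\<Sum>l\<in>{s..<s + i}. X l x *s bs l)"

definition N :: "'b set" where
  "N = {x. \<forall>i<s. \<psi> i x = 0}"

lemma X_pr: "s + i \<le> n \<Longrightarrow> l < n \<Longrightarrow> X l (pr i x) = (if l \<in> {s..<s + i} then X l x else 0)"
  unfolding pr_def by (rule X_comb) auto

lemma pr_cong: "(\<And>l. l \<in> {s..<s + i} \<Longrightarrow> X l x = X l y) \<Longrightarrow> pr i x = pr i y"
  unfolding pr_def by (intro sum.cong) auto

lemma pr_pr: "s + i \<le> n \<Longrightarrow> pr i (pr i x) = pr i x"
  by (intro pr_cong) (auto simp: X_pr)

lemma polynomial_functions_pr:
  assumes "s + i \<le> n" "f \<in> polynomial_functions"
  shows "(\<lambda>x. f (pr i x)) \<in> polynomial_functions"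
  using assms(2)
proof (rule polynomial_functions_compose_polynomial_map)
  fix \<phi> assume "Vector_Spaces.linear scale (*) \<phi>"
  then have "(\<lambda>x. \<phi> (pr i x)) = (\<lambda>x. \<Sum>l\<in>{s..<s + i}. X l x * \<phi> (bs l))"
    by (simp add: pr_def linear_functionalD)
  then show "(\<lambda>x. \<phi> (pr i x)) \<in> polynomial_functions"
    using assms(1) by (auto intro!: polynomial_functions_intros X_poly)
qed

lemma function_ring_pr_invariant:
  "function_ring {f \<in> polynomial_functions. \<forall>x. f (pr i x) = f x}"
  by (auto simp: function_ring_def polynomial_functions_intros)

abbreviation dim_y :: nat where
  "dim_y \<equiv> n - s"

text \<open>For \<open>c = 0\<close> a basis element either has a factor \<open>\<psi> j\<close> or
  is a monomial, which splits into one from \<open>small\<close> and one in the coordinates from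
  \<open>s\<close> on.\<close>

lemma module_expansion:
  assumes "f \<in> polynomial_functions"
  shows "\<exists>c h. (\<forall>r. c r \<in> polynomial_functions \<and> (\<forall>x. c r (pr dim_y x) = c r x)) \<and>
    (\<forall>i. h i \<in> polynomial_functions) \<and>
    (\<forall>x. f x = (\<Sum>r\<in>small. c r x * mon r x) + (\<Sum>i<s. \<psi> i x * h i x))"
proof -
  define Q where "Q = (\<lambda>f c h. (\<forall>r. c r \<in> polynomial_functions \<and> (\<forall>x. c r (pr dim_y x) = c r x)) \<and>
    (\<forall>i. h i \<in> polynomial_functions) \<and>
    (\<forall>x. f x = (\<Sum>r\<in>small. c r x * mon r x) + (\<Sum>i<s. \<psi> i x * h i x)))"
  obtain d where "f \<in> \<Phi>_span (\<lambda>_. 0) d" using polynomial_in_\<Phi>_span[OF assms] by blast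
  then have "\<exists>c h. Q f c h"
    unfolding \<Phi>_span_def
  proof (induction rule: fs.span_induct_alt)
    case base
    show ?case
      by (intro exI[of _ "\<lambda>_ _. 0"]) (auto simp: Q_def intro: polynomial_functions.const)
  next
    case (step k b y)
    then obtain a where a: "a \<in> exps n d" "b = \<Phi> (\<lambda>_. 0) a" by auto
    obtain c h where ch: "Q y c h" using step by blast
    have "\<exists>c' h'. Q b c' h'"
    proof (cases "\<exists>j<s. D j \<le> a j")
      case True
      then obtain j where j: "j < s" "D j \<le> a j" by blast
      have "b = (\<lambda>x. \<psi> j x * \<Phi> (\<lambda>_. 0) (a(j := a j - D j)) x)"
        using \<Phi>_mult_\<psi>[OF j(1), of "\<lambda>_. 0" "a(j := a j - D j)"] j by (auto simp: a(2))
      then have "Q b (\<lambda>_ _. 0) (\<lambda>i. if i = j then \<Phi> (\<lambda>_. 0) (a(j := a j - D j)) else (\<lambda>_. 0))"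
        using j by (auto simp: Q_def \<Phi>_poly polynomial_functions.const if_distrib[of "\<lambda>t. t _"]
            if_distrib[of "\<lambda>t. _ * t"] cong: if_cong)
      then show ?thesis by blast
    next
      case False
      define r0 where "r0 = (\<lambda>i. if i < s then a i else 0)"
      define r1 where "r1 = (\<lambda>i. if i < s then 0 else a i)"
      have "b x = mon r0 x * mon r1 x" for x
      proof -
        have "b x = mon a x" using False by (simp add: a(2) \<Phi>_eq_mon not_le)
        also have "a = (\<lambda>i. r0 i + r1 i)" by (auto simp: r0_def r1_def)
        finally show ?thesis by (simp only: mon_add)
      qed
      moreover have "r0 \<in> small" using False by (auto simp: small_def r0_def not_le split: if_splits)
      moreover have "mon r1 (pr dim_y x) = mon r1 x" for x
        unfolding mon_def using s_le_n by (intro prod.cong) (auto simp: X_pr r1_def)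
      ultimately have "Q b (\<lambda>r. if r = r0 then mon r1 else (\<lambda>_. 0)) (\<lambda>_ _. 0)"
        by (auto simp: Q_def mon_poly polynomial_functions.const if_distrib[of "\<lambda>t. t _"]
            if_distrib[of "\<lambda>t. t * _"] if_distrib[of "\<lambda>t. _ * t"] finite_small mult.commute cong: if_cong)
      then show ?thesis by blast
    qed
    then obtain c' h' where ch': "Q b c' h'" by blast
    have "Q (fscale k b + y) (\<lambda>r x. k * c' r x + c r x) (\<lambda>i x. k * h' i x + h i x)"
      using ch ch' by (auto simp: Q_def fscale_apply distrib_left distrib_right sum.distrib sum_distrib_left
          mult_ac intro!: polynomial_functions_intros)
    then show ?case by blast
  qed
  then show ?thesis unfolding Q_def .
qed

lemma param_ideal_common_zero:
  assumes "\<And>g. g \<in> param_ideal a \<Longrightarrow> g y = 0"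
  shows "y \<in> N" "l \<in> {s..<n} \<Longrightarrow> X l y = a l"
  using assms \<psi>_in_param_ideal assms[OF X_in_param_ideal, of l] by (auto simp: N_def)

text \<open>
  Where \<open>g\<close> does not vanish, \<open>f\<close> is nilpotent on the fibre of \<open>N\<close>, so the coefficients of a power of
  \<open>f\<close> with respect to the free basis \<open>small\<close> vanish there, hence everywhere.
\<close>

lemma vanishes_if_generically_vanishes:
  assumes f: "f \<in> polynomial_functions" and g: "g \<in> polynomial_functions" "g (pr dim_y x1) \<noteq> 0"
    and van: "\<And>x. x \<in> N \<Longrightarrow> g (pr dim_y x) \<noteq> 0 \<Longrightarrow> f x = 0" and x: "x \<in> N"
  shows "f x = 0"
proof -
  have sn: "s + dim_y \<le> n" using s_le_n by simp
  \<comment> \<open>One exponent serves all fibres, so a single expansion of \<open>f ^ ?M\<close>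
    provides the coefficients to be tested at every point.\<close>
  let ?M = "card small"
  obtain c h where c: "\<And>r. c r \<in> polynomial_functions" "\<And>r x. c r (pr dim_y x) = c r x"
    and h: "\<And>i. h i \<in> polynomial_functions"
    and eq: "\<And>x. f x ^ ?M = (\<Sum>r\<in>small. c r x * mon r x) + (\<Sum>i<s. \<psi> i x * h i x)"
    using module_expansion[OF polynomial_functions_power[OF f, of ?M]] by blast
  have c0: "c r x = 0" if r: "r \<in> small" and gx: "g (pr dim_y x) \<noteq> 0" for r x
  proof -
    define a where "a = (\<lambda>l. X l x)"
    let ?J = "param_ideal a"
    note J = is_ideal_param_ideal[of a]
    have "(\<lambda>y. f y ^ ?M) \<in> ?J"
    proof (rule finite_nullstellensatz[OF J param_ideal_subset spans_mod_param_ideal f])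
      fix y assume y: "\<And>g. g \<in> ?J \<Longrightarrow> g y = 0"
      have "X l y = X l x" if "l \<in> {s..<n}" for l
        using param_ideal_common_zero(2)[of a y l] y that by (simp add: a_def)
      then have "pr dim_y y = pr dim_y x" using sn by (intro pr_cong) auto
      moreover have "y \<in> N" using param_ideal_common_zero(1)[of a y] y by blast
      ultimately show "f y = 0" using van[of y] gx by simp
    qed
    \<comment> \<open>A coefficient depends only on the coordinates that are fixed along the fibre,
      so it is constant modulo the ideal of the fibre.\<close>
    moreover have cJ: "(\<lambda>y. c r y - c r x) \<in> ?J" for r
    proof -
      from polynomial_function_taylor[OF c(1), of r "pr dim_y x"]
      obtain u where "(\<forall>l. u l \<in> polynomial_functions) \<and>
          (\<forall>y. c r y - c r (pr dim_y x) = (\<Sum>l<n. (X l y - X l (pr dim_y x)) * u l y))" ..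
      then have u: "u l \<in> polynomial_functions"
        "c r y - c r (pr dim_y x) = (\<Sum>l<n. (X l y - X l (pr dim_y x)) * u l y)" for l y by blast+
      have "c r y - c r x = (\<Sum>l\<in>{s..<n}. (X l y - a l) * u l (pr dim_y y))" for y
      proof -
        have "c r y - c r x = (\<Sum>l<n. (X l (pr dim_y y) - X l (pr dim_y x)) * u l (pr dim_y y))"
          using u(2)[of "pr dim_y y"] by (simp add: c(2))
        also have "\<dots> = (\<Sum>l\<in>{s..<n}. (X l y - a l) * u l (pr dim_y y))"
          using sn by (intro sum.mono_neutral_cong_right) (auto simp: X_pr a_def)
        finally show ?thesis .
      qed
      moreover have "(\<lambda>y. \<Sum>l\<in>{s..<n}. (X l y - a l) * u l (pr dim_y y)) \<in> ?J"
        using u(1) sn by (intro ideal_sum[OF J] ideal_mult_right[OF J] X_in_param_ideal polynomial_functions_pr)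
      ultimately show ?thesis by simp
    qed
    moreover have "(\<lambda>y. f y ^ ?M - (\<Sum>i<s. \<psi> i y * h i y) - (\<Sum>r\<in>small. (c r y - c r x) * mon r y)) \<in> ?J"
    proof -
      have "(\<lambda>y. \<Sum>i<s. \<psi> i y * h i y) \<in> ?J"
        using h by (intro ideal_sum[OF J] ideal_mult_right[OF J] \<psi>_in_param_ideal) auto
      moreover have "(\<lambda>y. \<Sum>r\<in>small. (c r y - c r x) * mon r y) \<in> ?J"
        by (intro ideal_sum[OF J] ideal_mult_right[OF J cJ mon_poly])
      ultimately show ?thesis using \<open>(\<lambda>y. f y ^ ?M) \<in> ?J\<close> by (intro ideal_diff[OF J])
    qed
    moreover have "f y ^ ?M - (\<Sum>i<s. \<psi> i y * h i y) - (\<Sum>r\<in>small. (c r y - c r x) * mon r y) =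
        (\<Sum>r\<in>small. c r x * mon r y)" for y
      by (simp add: eq left_diff_distrib sum_subtractf)
    ultimately have "(\<lambda>y. \<Sum>r\<in>small. c r x * mon r y) \<in> ?J" by simp
    then show ?thesis using r by (rule small_independent_mod)
  qed
  \<comment> \<open>The coefficient vanishes wherever \<open>g\<close> composed with the projection
    does not, and the whole space is irreducible.\<close>
  have "c r x = 0" if r: "r \<in> small" for r
  proof (rule prime_setD[OF prime_set_UNIV polynomial_functions_pr[OF sn g(1)] c(1)])
    show "g (pr dim_y x) * c r x = 0" for x using c0[OF r] by auto
  qed (use g(2) in auto)
  then have "f x ^ ?M = 0" using x by (simp add: eq N_def)
  then show ?thesis by simp
qed

section \<open>Lying over and chains of length \<open>n - s\<close>\<close>

text \<open>The image of \<open>Z\<close> under \<open>pr i\<close> is Zariski dense in the image of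
  the whole space.\<close>

definition dominant :: "nat \<Rightarrow> 'b set \<Rightarrow> bool" where
  "dominant i Z \<longleftrightarrow> (\<forall>g\<in>polynomial_functions. (\<forall>z\<in>Z. g (pr i z) = 0) \<longrightarrow> (\<forall>x. g (pr i x) = 0))"

text \<open>Finite and dominant implies surjective. Let \<open>I\<close> be generated by the
  vanishing ideal of \<open>Z\<close> and the ideal of the fibre over \<open>w\<close>. If
  \<open>I\<close> contained 1, Nakayama's lemma for the functions on \<open>Z\<close>, a finite
  module over polynomials in the first \<open>i\<close> coordinates off the torus, would give such a
  polynomial \<open>v\<close> with \<open>v w = 1\<close> that annihilates the module, against
  dominance.\<close>

lemma dominant_closed_surjective:
  assumes Z: "closedin zariski Z" "Z \<subseteq> N" and i: "s + i \<le> n"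
    and zero: "\<And>z l. z \<in> Z \<Longrightarrow> l \<in> {s + i..<n} \<Longrightarrow> X l z = 0" and dom: "dominant i Z"
  shows "\<exists>z\<in>Z. pr i z = pr i w"
proof -
  obtain F where F: "F \<subseteq> polynomial_functions" "Z = zero_locus F" using Z by (auto simp: closedin_zariski)
  define a where "a = (\<lambda>l. X l (pr i w))"
  note J = is_ideal_param_ideal[of a]
  define I where "I = {\<lambda>x. h x + k x | h k. h \<in> polynomial_functions \<and> (\<forall>z\<in>Z. h z = 0) \<and> k \<in> param_ideal a}"
  have II: "(\<lambda>x. h x + k x) \<in> I" if "h \<in> polynomial_functions" "\<And>z. z \<in> Z \<Longrightarrow> h z = 0" "k \<in> param_ideal a" for h k
    using that unfolding I_def by blast
  have I: "is_ideal I"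
    unfolding is_ideal_def
  proof (intro conjI ballI)
    show "(\<lambda>_. 0) \<in> I" using II[OF polynomial_functions.const[of 0] _ ideal_0[OF J]] by simp
    fix u v assume "u \<in> I"
    then obtain h k where u: "h \<in> polynomial_functions" "\<And>z. z \<in> Z \<Longrightarrow> h z = 0" "k \<in> param_ideal a"
      "u = (\<lambda>x. h x + k x)" by (auto simp: I_def)
    show "(\<lambda>x. u x + v x) \<in> I" if "v \<in> I"
    proof -
      from that obtain h' k' where v: "h' \<in> polynomial_functions" "\<And>z. z \<in> Z \<Longrightarrow> h' z = 0"
        "k' \<in> param_ideal a" "v = (\<lambda>x. h' x + k' x)" by (auto simp: I_def)
      show ?thesis
        using II[OF polynomial_functions.add[OF u(1) v(1)] _ ideal_add[OF J u(3) v(3)]] u(2) v(2)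
        by (simp add: u(4) v(4) add_ac)
    qed
    show "(\<lambda>x. u x * v x) \<in> I" if "v \<in> polynomial_functions"
      using II[OF polynomial_functions.mult[OF u(1) that] _ ideal_mult_right[OF J u(3) that]] u(2)
      by (simp add: u(4) distrib_right)
  qed
  have sub: "param_ideal a \<subseteq> I"
    using II[OF polynomial_functions.const[of 0]] by auto
  have Isub: "I \<subseteq> polynomial_functions"
    using param_ideal_subset by (auto simp: I_def intro!: polynomial_functions.add)
  have "(\<lambda>_. 1) \<notin> I"
  proof
    assume "(\<lambda>_. 1) \<in> I"
    then obtain h k where hk: "\<And>z. z \<in> Z \<Longrightarrow> h z = 0" "k \<in> param_ideal a" "(\<lambda>_. 1) = (\<lambda>x. h x + k x)"
      by (auto simp: I_def)
    then obtain f g where fg: "\<And>i. f i \<in> polynomial_functions" "\<And>l. g l \<in> polynomial_functions"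
      and k: "k = (\<lambda>x. (\<Sum>i<s. \<psi> i x * f i x) + (\<Sum>l\<in>{s..<n}. (X l x - a l) * g l x))"
      unfolding param_ideal_def by blast
    \<comment> \<open>The coordinates from \<open>s + i\<close> on vanish both on \<open>Z\<close>
      and at \<open>pr i w\<close>, so they drop out.\<close>
    have one: "(\<Sum>l\<in>{s..<s + i}. (X l z - a l) * g l z) = 1" if z: "z \<in> Z" for z
    proof -
      have "1 = h z + k z" using hk(3) by meson
      also have "\<dots> = (\<Sum>l\<in>{s..<n}. (X l z - a l) * g l z)"
        using hk(1)[OF z] z Z(2) by (auto simp: k N_def)
      also have "\<dots> = (\<Sum>l\<in>{s..<s + i}. (X l z - a l) * g l z)"
        using i zero[OF z] by (intro sum.mono_neutral_right) (auto simp: a_def X_pr)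
      finally show ?thesis by simp
    qed
    define A where "A = {f \<in> polynomial_functions. \<forall>x. f (pr i x) = f x}"
    have A: "function_ring A" unfolding A_def by (rule function_ring_pr_invariant)
    \<comment> \<open>Composing the coefficients with \<open>pr i\<close> changes nothing on
      \<open>Z\<close> and makes them elements of \<open>A\<close>.\<close>
    have "\<exists>c. \<forall>r'. c r' \<in> A \<and> (\<forall>z\<in>Z. g l z * mon r z = (\<Sum>r'\<in>small. c r' z * mon r' z))" for l r
    proof -
      obtain c h where c: "\<And>r. c r \<in> polynomial_functions" "\<And>r x. c r (pr dim_y x) = c r x"
        and eq: "\<And>x. g l x * mon r x = (\<Sum>r\<in>small. c r x * mon r x) + (\<Sum>i<s. \<psi> i x * h i x)"
        using module_expansion[OF polynomial_functions.mult[OF fg(2)[of l] mon_poly[of r]]] by blast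
      show ?thesis
      proof (intro exI[of _ "\<lambda>r' x. c r' (pr i x)"] allI conjI ballI)
        show "(\<lambda>x. c r' (pr i x)) \<in> A" for r'
          using polynomial_functions_pr[OF i c(1)] by (simp add: A_def pr_pr[OF i])
        fix z assume z: "z \<in> Z"
        have "pr dim_y (pr i z) = pr dim_y z"
          using i zero[OF z] by (intro pr_cong) (auto simp: X_pr)
        then have "c r' (pr i z) = c r' z" for r' using c(2)[of r' "pr i z"] c(2)[of r' z] by simp
        then show "g l z * mon r z = (\<Sum>r'\<in>small. c r' (pr i z) * mon r' z)"
          using z Z(2) by (auto simp: eq N_def)
      qed
    qed
    then obtain c where c: "\<And>l r r'. c l r r' \<in> A"
      "\<And>l r r' z. z \<in> Z \<Longrightarrow> g l z * mon r z = (\<Sum>r'\<in>small. c l r r' z * mon r' z)" by metis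
    define M where "M = card small"
    obtain e where e: "bij_betw e {..<M} small"
      using ex_bij_betw_nat_finite[OF finite_small] by (auto simp: M_def lessThan_atLeast0)
    define m where "m = (\<lambda>p q x. \<Sum>l\<in>{s..<s + i}. (X l x - a l) * c l (e p) (e q) x)"
    have "\<exists>v\<in>A. v w = 1 \<and> (\<forall>p<M. \<forall>z\<in>Z. v z * mon (e p) z = 0)"
    proof (rule elimination[OF A, where m = m and u = "\<lambda>_. 1"])
      show "(\<lambda>_. 1) \<in> A" by (simp add: A_def polynomial_functions.const)
      show "m p q \<in> A \<and> m p q w = 0" if "p < M" "q < M" for p q
      proof
        show "m p q \<in> A"
          using c(1) i unfolding m_def A_def
          by (auto intro!: polynomial_functions_intros X_poly sum.cong simp: X_pr)
        show "m p q w = 0" using i by (auto simp: m_def a_def X_pr intro!: sum.neutral)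
      qed
      fix p z assume pz: "p < M" "z \<in> Z"
      have "mon (e p) z = (\<Sum>l\<in>{s..<s + i}. (X l z - a l) * g l z) * mon (e p) z"
        using one[OF pz(2)] by simp
      also have "\<dots> = (\<Sum>l\<in>{s..<s + i}. (X l z - a l) * (g l z * mon (e p) z))"
        by (simp add: sum_distrib_right mult.assoc)
      also have "\<dots> = (\<Sum>r'\<in>small. (\<Sum>l\<in>{s..<s + i}. (X l z - a l) * c l (e p) r' z) * mon r' z)"
        unfolding c(2)[OF pz(2)] sum_distrib_left sum_distrib_right
        by (subst sum.swap) (simp add: mult.assoc)
      also have "\<dots> = (\<Sum>q<M. m p q z * mon (e q) z)"
        unfolding m_def by (rule sum.reindex_bij_betw[OF e, symmetric])
      finally show "1 * mon (e p) z = (\<Sum>q<M. m p q z * mon (e q) z)" by simp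
    qed simp
    then obtain v where v: "v \<in> A" "v w = 1" "\<And>p z. p < M \<Longrightarrow> z \<in> Z \<Longrightarrow> v z * mon (e p) z = 0" by blast
    \<comment> \<open>The constant monomial is among the generators, so \<open>v\<close> itself
      vanishes on \<open>Z\<close>.\<close>
    have "(\<lambda>_. 0) \<in> small" using D_pos by (simp add: small_def)
    then have "(\<lambda>_. 0) \<in> e ` {..<M}" using e by (simp add: bij_betw_def)
    then obtain p where p: "p < M" "e p = (\<lambda>_. 0)" by (metis imageE lessThan_iff)
    have "v (pr i z) = 0" if "z \<in> Z" for z
      using v(1) v(3)[OF p(1) that] by (simp add: p(2) mon_0 A_def)
    then have "v (pr i w) = 0" using dom v(1) by (auto simp: dominant_def A_def)
    then show False using v(1,2) by (simp add: A_def)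
  qed
  then obtain z where z: "\<And>f. f \<in> I \<Longrightarrow> f z = 0"
    using common_zero_exists[OF I _ Isub spans_mod_mono[OF spans_mod_param_ideal sub]] by blast
  have "z \<in> Z"
  proof -
    have "f \<in> I" if "f \<in> F" for f
      using II[of f, OF _ _ ideal_0[OF J]] that F by (auto simp: zero_locus_def)
    then show ?thesis using z by (auto simp: F(2) zero_locus_def)
  qed
  moreover have "pr i z = pr i w"
  proof (rule pr_cong)
    fix l assume l: "l \<in> {s..<s + i}"
    then have "X l z = a l" using param_ideal_common_zero(2)[of a z l] z sub i by auto
    then show "X l z = X l w" using l i by (simp add: a_def X_pr)
  qed
  ultimately show ?thesis by blast
qed

text \<open>The section of \<open>Z\<close> by \<open>X (s + i) = 0\<close> still projects onto the
  space of the first \<open>i\<close> coordinates, and one of its finitely many irreducible pieces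
  has to dominate that space.\<close>

lemma chain_exists:
  assumes "s + i \<le> n" "closedin zariski Z" "prime_set Z" "Z \<subseteq> N"
    "\<And>z l. z \<in> Z \<Longrightarrow> l \<in> {s + i..<n} \<Longrightarrow> X l z = 0" "dominant i Z"
  shows "\<exists>C. C i = Z \<and> (\<forall>j\<le>i. closedin zariski (C j) \<and> prime_set (C j)) \<and> (\<forall>j<i. C j \<subset> C (Suc j))"
  using assms
proof (induction i arbitrary: Z)
  case 0
  then show ?case by (intro exI[of _ "\<lambda>_. Z"]) auto
next
  case (Suc i)
  have i: "s + i < n" using Suc.prems by simp
  have Xi: "X (s + i) \<in> polynomial_functions" using i by (rule X_poly)
  define Z' where "Z' = Z \<inter> zero_locus {X (s + i)}"
  have "closedin zariski Z'"
    unfolding Z'_def using Suc.prems(2) Xi by (intro closedin_Int closedin_zero_locus) auto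
  from closed_decomposition[OF this] obtain \<C>
    where "finite \<C> \<and> (\<forall>D\<in>\<C>. closedin zariski D \<and> prime_set D) \<and> Z' = \<Union>\<C>" ..
  then have \<C>: "finite \<C>" "D \<in> \<C> \<Longrightarrow> closedin zariski D \<and> prime_set D" "Z' = \<Union>\<C>" for D
    by simp_all
  have surj: "\<exists>z\<in>Z'. pr i z = pr i w" for w
  proof -
    \<comment> \<open>The point \<open>pr i w\<close> has coordinate 0 at \<open>s + i\<close>, so a
      preimage of it lies in the section.\<close>
    obtain z where z: "z \<in> Z" "pr (Suc i) z = pr (Suc i) (pr i w)"
      using dominant_closed_surjective[OF Suc.prems(2,4,1,5,6)] by blast
    have X: "X l z = X l (pr i w)" if "l \<in> {s..<s + Suc i}" for l
      using arg_cong[OF z(2), of "X l"] that Suc.prems(1) by (simp add: X_pr)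
    have "X (s + i) z = 0" using X[of "s + i"] i by (simp add: X_pr)
    moreover have "pr i z = pr i (pr i w)" using X by (intro pr_cong) auto
    ultimately show ?thesis using z(1) i by (auto simp: Z'_def zero_locus_def pr_pr)
  qed
  \<comment> \<open>Otherwise each piece is killed by a nonzero function of the projection. The
    product of these functions is nonzero somewhere, although the pieces together project onto
    everything.\<close>
  have "\<exists>D\<in>\<C>. dominant i D"
  proof (rule ccontr)
    assume "\<not> ?thesis"
    then have "\<forall>D\<in>\<C>. \<exists>g\<in>polynomial_functions. (\<forall>z\<in>D. g (pr i z) = 0) \<and> (\<exists>x. g (pr i x) \<noteq> 0)"
      unfolding dominant_def by blast
    then obtain g where g: "\<And>D. D \<in> \<C> \<Longrightarrow> g D \<in> polynomial_functions"
      "\<And>D z. D \<in> \<C> \<Longrightarrow> z \<in> D \<Longrightarrow> g D (pr i z) = 0" "\<And>D. D \<in> \<C> \<Longrightarrow> \<exists>x. g D (pr i x) \<noteq> 0"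
      by metis
    have "\<exists>x\<in>UNIV. (\<Prod>D\<in>\<C>. g D (pr i x)) \<noteq> 0"
      using g(1,3) i by (intro prime_set_prod[OF prime_set_UNIV \<C>(1)] polynomial_functions_pr) auto
    then obtain x where x: "(\<Prod>D\<in>\<C>. g D (pr i x)) \<noteq> 0" by blast
    obtain z where z: "z \<in> Z'" "pr i z = pr i x" using surj by blast
    then obtain D where "D \<in> \<C>" "z \<in> D" using \<C>(3) by blast
    then have "g D (pr i x) = 0" using g(2) z(2) by metis
    then show False using x \<open>D \<in> \<C>\<close> \<C>(1) by (metis prod_zero_iff)
  qed
  then obtain D where D: "D \<in> \<C>" "dominant i D" by blast
  have DZ: "D \<subseteq> Z'" using D \<C>(3) by blast
  have "\<exists>C. C i = D \<and> (\<forall>j\<le>i. closedin zariski (C j) \<and> prime_set (C j)) \<and> (\<forall>j<i. C j \<subset> C (Suc j))"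
  proof (rule Suc.IH)
    fix z l assume zl: "z \<in> D" "l \<in> {s + i..<n}"
    then show "X l z = 0"
      using DZ Suc.prems(5)[of z l] by (cases "l = s + i") (auto simp: Z'_def zero_locus_def)
  qed (use D \<C> DZ Suc.prems in \<open>auto simp: Z'_def\<close>)
  then obtain C where C: "C i = D" "\<forall>j\<le>i. closedin zariski (C j) \<and> prime_set (C j)"
    "\<forall>j<i. C j \<subset> C (Suc j)" by blast
  \<comment> \<open>The inclusion is strict because \<open>X (s + i)\<close>, seen through the
    projection, is nonzero at \<open>bs (s + i)\<close>; by dominance it cannot vanish on
    \<open>Z\<close>.\<close>
  have "\<exists>z\<in>Z. X (s + i) z \<noteq> 0"
  proof (rule ccontr)
    assume "\<not> ?thesis"
    then have "X (s + i) (pr (Suc i) z) = 0" if "z \<in> Z" for z using that i by (simp add: X_pr)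
    then have "X (s + i) (pr (Suc i) (bs (s + i))) = 0"
      using Suc.prems(6) Xi unfolding dominant_def by blast
    then show False using i by (simp add: X_pr X_bs)
  qed
  then have "D \<subset> Z" using DZ by (auto simp: Z'_def zero_locus_def)
  then show ?case
    using C Suc.prems(2,3) by (intro exI[of _ "C(Suc i := Z)"]) (auto simp: less_Suc_eq le_Suc_eq)
qed

section \<open>The upper bound for chains\<close>

lemma restriction_expansion:
  assumes "f \<in> polys n d"
  shows "\<exists>k. \<forall>x\<in>N. f x = (\<Sum>a\<in>{a \<in> exps n d. \<forall>j<s. a j < D j}. k a * mon a x)"
proof -
  have "f \<in> \<Phi>_span (\<lambda>_. 0) d" using assms polys_subset_\<Phi>_span by blast
  then obtain k where k: "f = (\<lambda>x. \<Sum>a\<in>exps n d. k a * \<Phi> (\<lambda>_. 0) a x)"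
    unfolding \<Phi>_span_def using finite_exps by (rule span_imageE)
  have "f x = (\<Sum>a\<in>{a \<in> exps n d. \<forall>j<s. a j < D j}. k a * mon a x)" if x: "x \<in> N" for x
    unfolding k
  proof (rule sum.mono_neutral_cong_right[OF finite_exps])
    show "\<forall>a\<in>exps n d - {a \<in> exps n d. \<forall>j<s. a j < D j}. k a * \<Phi> (\<lambda>_. 0) a x = 0"
    proof
      fix a assume "a \<in> exps n d - {a \<in> exps n d. \<forall>j<s. a j < D j}"
      then obtain j where j: "j < s" "D j \<le> a j" by (auto simp: not_less)
      then have "\<Phi> (\<lambda>_. 0) a x = \<psi> j x * \<Phi> (\<lambda>_. 0) (a(j := a j - D j)) x"
        using \<Phi>_mult_\<psi>[OF j(1), of "\<lambda>_. 0" "a(j := a j - D j)"] by simp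
      then show "k a * \<Phi> (\<lambda>_. 0) a x = 0" using x j(1) by (simp add: N_def)
    qed
  qed (auto simp: \<Phi>_eq_mon)
  then show ?thesis by blast
qed

text \<open>Two growth rates are compared. Products of the \<open>m\<close> separating functions
  with exponents up to \<open>K\<close> give \<open>Suc K ^ m\<close> independent functions on
  \<open>C m\<close>. Their degrees are at most \<open>K * \<Delta>\<close>, and the restrictions to
  \<open>N\<close> of functions of that degree span a space whose dimension grows at most like
  \<open>K ^ (n - s)\<close>.\<close>

lemma chain_length_le:
  assumes C: "\<And>i. i \<le> m \<Longrightarrow> closedin zariski (C i) \<and> prime_set (C i)" "\<And>i. i < m \<Longrightarrow> C i \<subset> C (Suc i)"
    "C m \<subseteq> N"
  shows "m \<le> dim_y"
proof (rule ccontr)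
  assume gt: "\<not> m \<le> dim_y"
  have "\<exists>f\<in>polynomial_functions. (\<forall>x\<in>C i. f x = 0) \<and> (\<exists>x\<in>C (Suc i). f x \<noteq> 0)" if i: "i < m" for i
  proof -
    obtain F where F: "F \<subseteq> polynomial_functions" "C i = zero_locus F"
      using C(1)[of i] i by (auto simp: closedin_zariski)
    moreover obtain x where "x \<in> C (Suc i)" "x \<notin> C i" using C(2)[OF i] by blast
    ultimately show ?thesis by (auto simp: zero_locus_def)
  qed
  then obtain f where f: "\<And>i. i < m \<Longrightarrow> f i \<in> polynomial_functions"
    "\<And>i x. i < m \<Longrightarrow> x \<in> C i \<Longrightarrow> f i x = 0" "\<And>i. i < m \<Longrightarrow> \<exists>x\<in>C (Suc i). f i x \<noteq> 0" by metis
  have "\<forall>i. \<exists>d. i < m \<longrightarrow> f i \<in> polys n d" using polynomial_function_in_polys f(1) by blast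
  then obtain \<delta> where \<delta>: "\<And>i. i < m \<Longrightarrow> f i \<in> polys n (\<delta> i)" by metis
  define \<Delta> where "\<Delta> = (\<Sum>i<m. \<delta> i)"
  let ?e = dim_y
  have main: "Suc K ^ m \<le> card small * Suc (K * \<Delta>) ^ ?e" for K
  proof -
    let ?d = "K * \<Delta>"
    define E where "E = {a \<in> exps n ?d. \<forall>j<s. a j < D j}"
    \<comment> \<open>Extension by 0 outside \<open>C m\<close> turns independence on
      \<open>C m\<close> into independence of functions on the whole space.\<close>
    define on where "on = (\<lambda>(h :: 'b \<Rightarrow> 'a) x. if x \<in> C m then h x else 0)"
    define v where "v = (\<lambda>a. on (\<lambda>x. \<Prod>i<m. f i x ^ a i))"
    have indep: "family_independent (box {..<m} K) v"
      unfolding family_independent_def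
    proof (intro allI impI ballI)
      fix c a assume c: "\<forall>x. (\<Sum>a\<in>box {..<m} K. c a * v a x) = 0" and a: "a \<in> box {..<m} K"
      show "c a = 0"
      proof (rule chain_independent[where m = m and C = C and f = f and A = "box {..<m} K" and c = c and a = a])
        show "(\<Sum>a\<in>box {..<m} K. c a * (\<Prod>i<m. f i x ^ a i)) = 0" if "x \<in> C m" for x
          using c[THEN spec, of x] that by (simp add: v_def on_def)
        show "finite (box {..<m} K)" by (rule card_box) simp
      qed (use a C f in \<open>auto simp: box_def not_less\<close>)
    qed
    have "v a \<in> fs.span ((\<lambda>b. on (mon b)) ` E)" if a: "a \<in> box {..<m} K" for a
    proof -
      have "(\<lambda>x. \<Prod>i<m. f i x ^ a i) \<in> polys n (\<Sum>i<m. a i * \<delta> i)"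
        using \<delta> by (intro polys_prod polys_power) auto
      moreover have "(\<Sum>i<m. a i * \<delta> i) \<le> ?d"
        unfolding \<Delta>_def sum_distrib_left using a by (intro sum_mono mult_right_mono) (auto simp: box_def)
      ultimately have "(\<lambda>x. \<Prod>i<m. f i x ^ a i) \<in> polys n ?d" using polys_mono by blast
      then obtain k where k: "\<And>x. x \<in> N \<Longrightarrow> (\<Prod>i<m. f i x ^ a i) = (\<Sum>b\<in>E. k b * mon b x)"
        unfolding E_def using restriction_expansion by blast
      have "v a = (\<lambda>x. \<Sum>b\<in>E. k b * on (mon b) x)"
        using k C(3) by (auto simp: v_def on_def fun_eq_iff)
      moreover have "(\<lambda>x. \<Sum>b\<in>E. k b * on (mon b) x) \<in> fs.span ((\<lambda>b. on (mon b)) ` E)"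
        by (rule span_imageI) (auto intro: fs.span_base)
      ultimately show ?thesis by simp
    qed
    moreover have finE: "finite E" using finite_exps by (simp add: E_def)
    ultimately have "card (box {..<m} K) \<le> card ((\<lambda>b. on (mon b)) ` E)"
      using card_box(1)[of "{..<m}" K] by (intro family_independent_card_le[OF indep]) auto
    also have "\<dots> \<le> card E" using finE by (rule card_image_le)
    also have "\<dots> \<le> card ((\<lambda>(r, b) i. r i + b i) ` (small \<times> box {s..<n} ?d))"
    proof (rule card_mono)
      show "finite ((\<lambda>(r, b) i. r i + b i) ` (small \<times> box {s..<n} ?d))"
        using finite_small card_box(1)[of "{s..<n}" ?d] by auto
      show "E \<subseteq> (\<lambda>(r, b) i. r i + b i) ` (small \<times> box {s..<n} ?d)"
      proof
        fix a assume a: "a \<in> E"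
        have "a i \<le> ?d" if "i < n" for i
          using a wdeg_ge[OF that, of a] by (auto simp: E_def exps_def)
        then have "(\<lambda>i. if i < s then a i else 0, \<lambda>i. if i < s then 0 else a i) \<in> small \<times> box {s..<n} ?d"
          using a by (auto simp: E_def small_def box_def exps_def)
        moreover have "a = (\<lambda>(r, b) i. r i + b i) (\<lambda>i. if i < s then a i else 0, \<lambda>i. if i < s then 0 else a i)"
          by auto
        ultimately show "a \<in> (\<lambda>(r, b) i. r i + b i) ` (small \<times> box {s..<n} ?d)" by (rule rev_image_eqI)
      qed
    qed
    also have "\<dots> \<le> card (small \<times> box {s..<n} ?d)"
      using finite_small card_box(1)[of "{s..<n}" ?d] by (intro card_image_le) auto
    also have "\<dots> = card small * Suc ?d ^ ?e"
      using card_box(2)[of "{s..<n}" ?d] by (simp add: card_cartesian_product)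
    finally show ?thesis using card_box(2)[of "{..<m}" K] by simp
  qed
  \<comment> \<open>Chosen so that \<open>main\<close> for \<open>K = B\<close> fails: its right
    side is at most \<open>B * Suc B ^ ?e\<close>, as \<open>Suc (B * \<Delta>)\<close> is at most
    \<open>Suc B * Suc \<Delta>\<close>.\<close>
  define B where "B = card small * Suc \<Delta> ^ ?e"
  have "Suc B ^ Suc ?e \<le> Suc B ^ m" using gt by (intro power_increasing) auto
  also have "\<dots> \<le> card small * Suc (B * \<Delta>) ^ ?e" by (rule main)
  also have "\<dots> \<le> card small * (Suc B * Suc \<Delta>) ^ ?e"
    by (intro mult_left_mono power_mono) auto
  also have "\<dots> = B * Suc B ^ ?e" by (simp add: B_def power_mult_distrib del: mult_Suc mult_Suc_right)
  also have "\<dots> < Suc B * Suc B ^ ?e" by simp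
  finally show False by simp
qed

text \<open>\<open>Z\<close> is closed, being one of finitely many closed irreducible pieces that
  cover \<open>N\<close>. So chains in the subspace \<open>Z\<close> are chains in the whole space,
  where both bounds are available.\<close>

theorem krull_dimension_component:
  assumes "Z \<in> irreducible_components (subtopology zariski N)"
  shows "krull_dimension (subtopology zariski Z) = enat dim_y"
proof -
  have sn: "s + dim_y \<le> n" using s_le_n by simp
  have Z: "prime_set Z" "Z \<subseteq> N" "\<And>Y. prime_set Y \<Longrightarrow> Y \<subseteq> N \<Longrightarrow> Z \<subseteq> Y \<Longrightarrow> Y = Z"
    using assms by (auto simp: irreducible_components_def irreducible_in_subtopology irreducible_in_zariski_iff)
  have "N = zero_locus (\<psi> ` {..<s})" by (auto simp: N_def zero_locus_def)
  then have "closedin zariski N"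
    using \<psi>_poly closedin_zero_locus[of "\<psi> ` {..<s}"] by auto
  from closed_decomposition[OF this] obtain \<C>
    where "finite \<C> \<and> (\<forall>D\<in>\<C>. closedin zariski D \<and> prime_set D) \<and> N = \<Union>\<C>" ..
  then have \<C>: "finite \<C>" "D \<in> \<C> \<Longrightarrow> closedin zariski D \<and> prime_set D" "N = \<Union>\<C>" for D
    by simp_all
  \<comment> \<open>\<open>Z\<close> lies in one member of the subfamily by irreducibility and
    equals it by maximality.\<close>
  have in_cover: "Z \<in> \<D>" if "\<D> \<subseteq> \<C>" "N \<subseteq> \<Union>\<D>" for \<D>
  proof -
    have "\<exists>D\<in>\<D>. Z \<subseteq> D"
      using Z(1,2) \<C> that finite_subset[OF that(1)]
      by (intro irreducible_in_finite_union[of zariski]) (auto simp: irreducible_in_zariski_iff)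
    then obtain D where "D \<in> \<D>" "Z \<subseteq> D" by blast
    then have "D = Z" using that \<C> by (intro Z(3)) auto
    then show ?thesis using \<open>D \<in> \<D>\<close> by simp
  qed
  have closed: "closedin zariski Z" using in_cover[of \<C>] \<C> by simp
  have "dominant dim_y Z"
    unfolding dominant_def
  proof (intro ballI impI allI, rule ccontr)
    fix g x assume g: "g \<in> polynomial_functions" "\<forall>z\<in>Z. g (pr dim_y z) = 0" "g (pr dim_y x) \<noteq> 0"
    \<comment> \<open>\<open>Z\<close> is not in \<open>\<D>\<close>. But \<open>\<D>\<close> covers
      the part of \<open>N\<close> where \<open>g\<close> does not vanish, hence all of
      \<open>N\<close>, since nonzero functions of the coordinates off the torus are not zero
      divisors.\<close>
    define \<D> where "\<D> = {D \<in> \<C>. \<exists>x\<in>D. g (pr dim_y x) \<noteq> 0}"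
    have "closedin zariski (\<Union>\<D>)" using \<C> by (intro closedin_Union) (auto simp: \<D>_def)
    then obtain F where F: "F \<subseteq> polynomial_functions" "\<Union>\<D> = zero_locus F" by (auto simp: closedin_zariski)
    have "y \<in> zero_locus F" if y: "y \<in> N" for y
      unfolding zero_locus_def
    proof (intro CollectI ballI)
      fix f assume f: "f \<in> F"
      show "f y = 0"
      proof (rule vanishes_if_generically_vanishes[OF _ g(1,3) _ y])
        fix u assume u: "u \<in> N" "g (pr dim_y u) \<noteq> 0"
        then have "u \<in> \<Union>\<D>" using \<C>(3) by (auto simp: \<D>_def)
        then show "f u = 0" using f by (auto simp: F(2) zero_locus_def)
      qed (use f F in auto)
    qed
    then have "N \<subseteq> \<Union>\<D>" using F by auto
    then have "Z \<in> \<D>" by (rule in_cover[rotated]) (auto simp: \<D>_def)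
    then show False using g(2) by (auto simp: \<D>_def)
  qed
  then obtain C where C: "C dim_y = Z" "\<forall>j\<le>dim_y. closedin zariski (C j) \<and> prime_set (C j)"
    "\<forall>j<dim_y. C j \<subset> C (Suc j)"
    using chain_exists[OF sn closed Z(1,2)] by auto
  have closed_iff: "closedin (subtopology zariski Z) A \<and> irreducible_in (subtopology zariski Z) A \<longleftrightarrow>
      A \<subseteq> Z \<and> closedin zariski A \<and> prime_set A" for A
    using closed by (auto simp: closedin_closed_subtopology irreducible_in_subtopology irreducible_in_zariski_iff)
  have mono: "A i \<subseteq> A m" if "i \<le> m" "\<forall>j<m. A j \<subset> A (Suc j)" for A :: "nat \<Rightarrow> 'b set" and i m
    using that by (induction rule: dec_induct) auto
  show ?thesis
    unfolding krull_dimension_def closed_iff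
  proof (rule antisym[OF Sup_least Sup_upper])
    fix x assume "x \<in> {enat m |m. \<exists>C. (\<forall>i\<le>m. C i \<subseteq> Z \<and> closedin zariski (C i) \<and> prime_set (C i)) \<and>
      (\<forall>i<m. C i \<subset> C (Suc i))}"
    then obtain m A where "x = enat m" "\<forall>i\<le>m. A i \<subseteq> Z \<and> closedin zariski (A i) \<and> prime_set (A i)"
      "\<forall>i<m. A i \<subset> A (Suc i)" by blast
    then show "x \<le> enat dim_y" using chain_length_le[of m A] Z(2) by force
  next
    have "C i \<subseteq> Z" if "i \<le> dim_y" for i using mono[OF that C(3)] C(1) by simp
    then show "enat dim_y \<in> {enat m |m. \<exists>C. (\<forall>i\<le>m. C i \<subseteq> Z \<and> closedin zariski (C i) \<and> prime_set (C i)) \<and>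
      (\<forall>i<m. C i \<subset> C (Suc i))}" using C by blast
  qed
qed

end

section \<open>Divided differences of additive polynomials\<close>

text \<open>Complete homogeneous symmetric polynomials: \<open>hs m vs\<close> is the divided difference of
  \<open>\<tau> ^ (m + length vs - 1)\<close> at the points \<open>vs\<close>.\<close>

fun hs :: "nat \<Rightarrow> 'k::comm_ring_1 list \<Rightarrow> 'k" where
  "hs 0 vs = 1"
| "hs (Suc m) [] = 0"
| "hs (Suc m) (v # vs) = hs (Suc m) vs + v * hs m (v # vs)"

lemma hs_swap: "hs m (v # w # vs) = hs m (w # v # vs)"
proof (induction m rule: less_induct)
  case (less m)
  show ?case
  proof (cases m)
    case (Suc k)
    have "(v - w) * hs k (v # w # vs) = v * hs k (v # vs) - w * hs k (w # vs)"
    proof (cases k)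
      case (Suc k')
      have "hs k (v # w # vs) = hs k (w # vs) + v * hs k' (v # w # vs)" by (simp add: Suc)
      then have 1: "w * hs k (v # w # vs) = w * hs k (w # vs) + w * v * hs k' (v # w # vs)"
        by (simp add: distrib_left mult.assoc)
      have "hs k (v # w # vs) = hs k (w # v # vs)" using \<open>m = Suc k\<close> by (intro less) simp
      also have "\<dots> = hs k (v # vs) + w * hs k' (w # v # vs)" by (simp add: Suc)
      also have "hs k' (w # v # vs) = hs k' (v # w # vs)" using \<open>m = Suc k\<close> Suc by (intro less[symmetric]) simp
      finally have "v * hs k (v # w # vs) = v * hs k (v # vs) + w * v * hs k' (v # w # vs)"
        by (metis distrib_left mult.assoc mult.commute)
      then show ?thesis using 1 by (simp add: left_diff_distrib)
    qed simp
    moreover have "hs k (w # v # vs) = hs k (v # w # vs)" using Suc by (intro less[symmetric]) simp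
    ultimately show ?thesis by (simp add: Suc algebra_simps)
  qed simp
qed

lemma hs_diff: "(v - w) * hs m (v # w # vs) = hs (Suc m) (v # vs) - hs (Suc m) (w # vs)"
proof -
  have "hs (Suc m) (v # w # vs) = hs (Suc m) (w # vs) + v * hs m (v # w # vs)" by simp
  moreover have "hs (Suc m) (v # w # vs) = hs (Suc m) (v # vs) + w * hs m (v # w # vs)"
    by (subst hs_swap) (simp add: hs_swap[of m w v])
  ultimately show ?thesis by (simp add: algebra_simps)
qed

lemma hs_single: "hs m [v] = v ^ m"
  by (induction m) auto

lemma hs_expand: "hs m (v # vs) = (\<Sum>i\<le>m. v ^ i * hs (m - i) vs)"
proof (induction m)
  case (Suc m)
  then show ?case by (simp add: sum.atMost_Suc_shift sum_distrib_left mult.assoc del: sum.atMost_Suc)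
qed simp

text \<open>The divided difference of the power with exponent \<open>m\<close>. More than
  \<open>m + 1\<close> points annihilate a polynomial of degree \<open>m\<close>, which accounts for
  the value 0.\<close>

definition divided_difference :: "nat \<Rightarrow> 'k::comm_ring_1 list \<Rightarrow> 'k" where
  "divided_difference m vs = (if length vs \<le> Suc m then hs (Suc m - length vs) vs else 0)"

lemma divided_difference_step:
  "(v - w) * divided_difference m (v # w # vs) = divided_difference m (v # vs) - divided_difference m (w # vs)"
proof -
  consider "Suc (length vs) \<le> m" | "length vs = m" | "length vs > m" by linarith
  then show ?thesis
  proof cases
    case 1
    then have "m - length vs = Suc (m - Suc (length vs))" by simp
    then show ?thesis using 1 hs_diff[of v w "m - Suc (length vs)" vs]
      by (simp add: divided_difference_def)
  qed (simp_all add: divided_difference_def)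
qed

text \<open>The recursion divides a difference of two shorter divided differences by
  \<open>v - w\<close>, which is nonzero for distinct points; at a single point the divided
  difference is the value.\<close>

lemma divided_difference_at_roots:
  fixes vs :: "'k::idom list"
  assumes "distinct vs" "vs \<noteq> []" "\<And>v. v \<in> set vs \<Longrightarrow> (\<Sum>i\<in>I. g i * v ^ e i) = 0"
  shows "(\<Sum>i\<in>I. g i * divided_difference (e i) vs) = 0"
  using assms
proof (induction "length vs" arbitrary: vs rule: less_induct)
  case less
  consider v where "vs = [v]" | v w us where "vs = v # w # us"
    using less.prems(2) by (metis neq_Nil_conv)
  then show ?case
  proof cases
    case 1
    then show ?thesis using less.prems(3) by (simp add: divided_difference_def hs_single)
  next
    case 2
    have "(\<Sum>i\<in>I. g i * divided_difference (e i) (v # us)) = 0"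
      "(\<Sum>i\<in>I. g i * divided_difference (e i) (w # us)) = 0"
      using less.prems 2 by (auto intro!: less.hyps)
    moreover have "(v - w) * (\<Sum>i\<in>I. g i * divided_difference (e i) vs) =
        (\<Sum>i\<in>I. g i * ((v - w) * divided_difference (e i) (v # w # us)))"
      by (simp add: 2 sum_distrib_left mult_ac)
    ultimately have "(v - w) * (\<Sum>i\<in>I. g i * divided_difference (e i) vs) = 0"
      by (simp add: divided_difference_step right_diff_distrib sum_subtractf)
    then show ?thesis using less.prems(1) 2 by simp
  qed
qed

section \<open>Frobenius powers\<close>

text \<open>Fermat's little theorem, as additivity of the Frobenius map on a sum of \<open>k\<close>
  ones.\<close>

lemma of_nat_power_char:
  assumes "prime CHAR('k::field)"
  shows "(of_nat k :: 'k) ^ (CHAR('k) ^ m) = of_nat k"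
  using freshmans_dream_sum'[OF assms refl, of "\<lambda>_. 1" "{..<k}" m] by simp

lemma power_char_diff:
  assumes "prime CHAR('k::field)"
  shows "(a - b :: 'k) ^ (CHAR('k) ^ m) = a ^ (CHAR('k) ^ m) - b ^ (CHAR('k) ^ m)"
  using freshmans_dream'[OF assms refl, of "a - b" b m] by simp

lemma power_char_inj:
  assumes "prime CHAR('k::field)" "(a :: 'k) ^ (CHAR('k) ^ m) = b ^ (CHAR('k) ^ m)"
  shows "a = b"
  using power_char_diff[OF assms(1), of a b m] assms(2) by simp

lemma of_nat_inj_char:
  assumes "of_nat a = (of_nat b :: 'k::field)" "a < CHAR('k)" "b < CHAR('k)"
  shows "a = b"
  using assms
proof (induction a b rule: linorder_wlog)
  case (le a b)
  then have "of_nat (b - a) = (0 :: 'k)" by (simp add: of_nat_diff)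
  then have "CHAR('k) dvd b - a" by (simp add: of_nat_eq_0_iff_char_dvd)
  moreover have "b - a < CHAR('k)" using le by simp
  ultimately have "b - a = 0" using nat_dvd_not_less by blast
  then show ?case using le by simp
qed simp

section \<open>The reduction relations\<close>

context closed_coordinates
begin

lemma polys_hs:
  assumes "\<And>f. f \<in> set fl \<Longrightarrow> f \<in> polys j q"
  shows "(\<lambda>x. hs m (map (\<lambda>f. f x) fl)) \<in> polys j (m * q)"
  using assms
proof (induction m fl rule: hs.induct)
  case (3 m v vs)
  have "(\<lambda>x. hs (Suc m) (map (\<lambda>f. f x) vs)) \<in> polys j (Suc m * q)" using 3 by simp
  moreover have "(\<lambda>x. v x * hs m (map (\<lambda>f. f x) (v # vs))) \<in> polys j (q + m * q)"
    using 3 by (intro polys_mult) auto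
  ultimately show ?case using polys_add by fastforce
qed (auto simp: polys_const polys_0)

text \<open>A monomial either contains some \<open>X l\<close> with \<open>l \<ge> s\<close>, which
  is split off and lowers the degree, or is unchanged by the projection \<open>P\<close> to the
  subspace.\<close>

lemma vanishing_on_subspace:
  assumes F: "F \<in> polys n d" and d: "d > 0" and s: "s \<le> n"
    and van: "\<And>x. (\<And>l. l \<in> {s..<n} \<Longrightarrow> X l x = 0) \<Longrightarrow> F x = 0"
  shows "\<exists>h. (\<forall>l. h l \<in> polys n (d - 1)) \<and> (\<forall>x. F x = (\<Sum>l\<in>{s..<n}. X l x * h l x))"
proof -
  define P where "P = (\<lambda>x. \<Sum>i<s. X i x *s bs i)"
  have XP: "X l (P x) = (if l < s then X l x else 0)" if "l < n" for l x
    using X_comb[OF that, of "{..<s}" "\<lambda>i. X i x"] s by (simp add: P_def)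
  have "\<exists>h. (\<forall>l. h l \<in> polys n (d - 1)) \<and> (\<forall>x. F x - F (P x) = (\<Sum>l\<in>{s..<n}. X l x * h l x))"
    using F unfolding polys_def[of n d]
  proof (induction rule: fs.span_induct_alt)
    case base
    then show ?case by (intro exI[of _ "\<lambda>_ _. 0"]) (simp add: polys_0)
  next
    case (step c b y)
    then obtain a where a: "a \<in> exps n d" "b = mon a" by auto
    obtain h where h: "\<And>l. h l \<in> polys n (d - 1)" "\<And>x. y x - y (P x) = (\<Sum>l\<in>{s..<n}. X l x * h l x)"
      using step by blast
    have "\<exists>h. (\<forall>l. h l \<in> polys n (d - 1)) \<and> (\<forall>x. b x - b (P x) = (\<Sum>l\<in>{s..<n}. X l x * h l x))"
    proof (cases "\<exists>l\<in>{s..<n}. a l \<noteq> 0")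
      case True
      then obtain l where l: "l \<in> {s..<n}" "1 \<le> a l" by auto
      then have red: "a(l := a l - 1) \<in> exps n (d - 1)" "mon a x = X l x * mon (a(l := a l - 1)) x" for x
        using exps_upd_diff[OF _ a(1), of l 1] by auto
      have "b (P x) = 0" for x
        using l red(2)[of "P x"] by (simp add: a(2) XP)
      then have "b x - b (P x) = (\<Sum>i\<in>{s..<n}. X i x * (if i = l then mon (a(l := a l - 1)) else (\<lambda>_. 0)) x)" for x
        using l red(2)[of x] by (simp add: a(2) if_distrib[of "\<lambda>t. t _"] if_distrib[of "\<lambda>t. _ * t"] cong: if_cong)
      then show ?thesis
        using red(1) by (intro exI[of _ "\<lambda>i. if i = l then mon (a(l := a l - 1)) else (\<lambda>_. 0)"])
          (auto simp: polys_0 mon_polys)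
    next
      case False
      have "b (P x) = b x" for x
        unfolding a(2) mon_def using False by (intro prod.cong) (auto simp: XP)
      then show ?thesis by (intro exI[of _ "\<lambda>_ _. 0"]) (simp add: polys_0)
    qed
    then obtain h' where h': "\<And>l. h' l \<in> polys n (d - 1)" "\<And>x. b x - b (P x) = (\<Sum>l\<in>{s..<n}. X l x * h' l x)"
      by blast
    have "(fscale c b + y) x - (fscale c b + y) (P x) = (\<Sum>l\<in>{s..<n}. X l x * (c * h' l x + h l x))" for x
    proof -
      have "(fscale c b + y) x - (fscale c b + y) (P x) = c * (b x - b (P x)) + (y x - y (P x))"
        by (simp add: fscale_apply algebra_simps)
      then show ?thesis
        unfolding h(2) h'(2) by (simp add: sum_distrib_left sum.distrib[symmetric] algebra_simps)
    qed
    then show ?case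
      using h(1) h'(1) by (intro exI[of _ "\<lambda>l x. c * h' l x + h l x"]) (auto intro!: polys_add polys_scale)
  qed
  moreover have "F (P x) = 0" for x using s by (intro van) (simp add: XP)
  ultimately show ?thesis by simp
qed

lemma wt_le:
  assumes "b \<in> exps j d"
  shows "wt b \<le> j * d"
proof -
  have "wt b \<le> (\<Sum>i<n. j * b i)"
    unfolding wt_def
  proof (rule sum_mono)
    show "Suc i * b i \<le> j * b i" for i
      using assms by (cases "b i = 0") (auto simp: exps_def Suc_le_eq simp del: mult_Suc)
  qed
  also have "\<dots> = j * wdeg b" by (simp add: wdeg_def sum_distrib_left)
  also have "\<dots> \<le> j * d" using assms by (simp add: exps_def)
  finally show ?thesis .
qed

text \<open>\<open>X 0, \<dots>, X (j - 1)\<close> weigh at most \<open>j\<close> each, while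
  \<open>X j\<close> weighs \<open>Suc j\<close>; positive degree of \<open>f\<close> makes the
  inequality strict.\<close>

lemma X_power_mult_lower_polys:
  assumes "j < n" "f \<in> polys j d" "d > 0"
  shows "(\<lambda>x. X j x ^ k * f x) \<in> fs.span (mon ` {a \<in> exps n (k + d). wt a < Suc j * (k + d)})"
  using assms(2) unfolding polys_def
proof (rule fspan_mult)
  fix b assume "b \<in> mon ` exps j d"
  then obtain a where a: "a \<in> exps j d" "b = mon a" by auto
  let ?e = "\<lambda>i. if i = j then k else 0"
  have e: "?e \<in> exps n k" using assms(1) by (auto simp: exps_def wdeg_single)
  have "wt ?e = Suc j * k"
    using assms(1) by (simp add: wt_def if_distrib[of "\<lambda>t. _ * t"] cong: if_cong)
  then have "wt (\<lambda>i. ?e i + a i) = Suc j * k + wt a" by (simp only: wt_add)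
  also have "\<dots> < Suc j * (k + d)"
    using wt_le[OF a(1)] assms(3) by (simp add: distrib_left)
  finally have "wt (\<lambda>i. ?e i + a i) < Suc j * (k + d)" .
  moreover have "(\<lambda>i. ?e i + a i) \<in> exps n (k + d)"
    using a(1) exps_mono[of j n d d] assms(1) by (intro exps_add[OF e]) auto
  ultimately have "mon (\<lambda>i. ?e i + a i) \<in> fs.span (mon ` {a \<in> exps n (k + d). wt a < Suc j * (k + d)})"
    by (intro fs.span_base imageI) simp
  moreover have "mon (\<lambda>i. ?e i + a i) = (\<lambda>x. X j x ^ k * b x)"
    by (rule ext) (simp only: mon_add mon_single[OF assms(1)] a(2))
  ultimately show "(\<lambda>x. X j x ^ k * b x) \<in> fs.span (mon ` {a \<in> exps n (k + d). wt a < Suc j * (k + d)})"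
    by simp
qed

text \<open>
  On the torus, the additive polynomial \<open>\<tau> ^ p ^ s - (\<Sum>i<s. \<psi> i * \<tau> ^ p ^ i)\<close> vanishes on
  the \<open>p ^ s\<close> combinations of the \<open>X i ^ p ^ e\<close> with coefficients in the prime field. Its
  divided difference at the \<open>p ^ j\<close> combinations of the first \<open>j\<close> of them together with
  \<open>X j ^ p ^ e\<close> has leading term \<open>X j ^ (p ^ (s + e) - p ^ (j + e))\<close>.
\<close>

lemma torus_relation:
  assumes p: "p = CHAR('a)" "prime p" and s: "s \<le> n" and j: "j < s"
    and \<psi>: "\<And>i. i < s \<Longrightarrow> \<psi> i \<in> polynomial_functions"
    and rel: "\<And>x i. (\<And>l. l \<in> {s..<n} \<Longrightarrow> X l x = 0) \<Longrightarrow> i < s \<Longrightarrow>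
      X i x ^ p ^ (s + e) = (\<Sum>l<s. \<psi> l x * X i x ^ p ^ (l + e))"
  shows "\<exists>fl. (\<forall>f\<in>set fl. f \<in> polys j (p ^ e)) \<and> length fl = p ^ j \<and>
    (\<forall>x. (\<forall>l\<in>{s..<n}. X l x = 0) \<longrightarrow>
      hs (p ^ s - p ^ j) (X j x ^ p ^ e # map (\<lambda>f. f x) fl) =
      (\<Sum>i<s. \<psi> i x * (if j \<le> i then hs (p ^ i - p ^ j) (X j x ^ p ^ e # map (\<lambda>f. f x) fl) else 0)))"
proof -
  note prime = p(2)[unfolded p(1)]
  define V where "V = {..<j} \<rightarrow>\<^sub>E {..<p}"
  have V: "finite V" "card V = p ^ j" by (simp_all add: V_def finite_PiE card_PiE)
  define L where "L = (\<lambda>c x. \<Sum>i<j. of_nat (c i) * X i x)"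
  have jn: "j < n" using j s by simp
  have L_polys: "L c \<in> polys j 1" for c
    unfolding L_def using jn by (intro polys_sum polys_scale polys_X) auto
  obtain cs where cs: "set cs = V" "distinct cs" using finite_distinct_list[OF V(1)] by blast
  define fl where "fl = map (\<lambda>c x. L c x ^ p ^ e) cs"
  define vs where "vs = (\<lambda>x. X j x ^ p ^ e # map (\<lambda>f. f x) fl)"
  have vs_eq: "vs x = X j x ^ p ^ e # map (\<lambda>c. L c x ^ p ^ e) cs" for x
    by (simp add: vs_def fl_def comp_def)
  have len: "length fl = p ^ j" using cs V distinct_card[of cs] by (simp add: fl_def)
  have fl: "f \<in> polys j (p ^ e)" if "f \<in> set fl" for f
  proof -
    have "f \<in> (\<lambda>c x. L c x ^ p ^ e) ` set cs" using that by (simp only: fl_def set_map)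
    then obtain c where "f = (\<lambda>x. L c x ^ p ^ e)" by (rule imageE)
    then show ?thesis using polys_power[OF L_polys, of c "p ^ e"] by simp
  qed
  let ?T = "{x. \<forall>l\<in>{s..<n}. l < n \<longrightarrow> X l x = 0}"
  have T: "prime_set ?T" by (rule prime_set_coordinate_subspace)
  have bsT: "bs i \<in> ?T" if "i < s" for i using that s by (auto simp: X_bs)
  have X_pf: "X j \<in> polynomial_functions" using jn by (rule X_poly)
  have L_pf: "L c \<in> polynomial_functions" for c using L_polys polys_subset by blast
  have L_bs: "L c (bs i) = (if i < j then of_nat (c i) else 0)" if "i < n" for c i
    using that jn by (auto simp: L_def X_bs if_distrib[of "\<lambda>t. _ * t"] cong: if_cong)
  define PP where "PP = {(c, c'). c \<in> V \<and> c' \<in> V \<and> c \<noteq> c'}"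
  \<comment> \<open>Where \<open>G1\<close> and \<open>G2\<close> are nonzero, the interpolation
    points are distinct. Both are nonzero somewhere on the irreducible set \<open>?T\<close>, so a
    relation proved at such points holds on all of \<open>?T\<close>.\<close>
  define G1 where "G1 = (\<lambda>x. \<Prod>cc\<in>PP. L (fst cc) x - L (snd cc) x)"
  define G2 where "G2 = (\<lambda>x. \<Prod>c\<in>V. X j x - L c x)"
  have "PP \<subseteq> V \<times> V" by (auto simp: PP_def)
  then have fin: "finite PP" using V by (auto intro: finite_subset)
  have G_pf: "G1 \<in> polynomial_functions" "G2 \<in> polynomial_functions"
    unfolding G1_def G2_def by (intro polynomial_functions_intros L_pf X_pf)+
  have G1: "\<exists>x\<in>?T. G1 x \<noteq> 0"
    unfolding G1_def
  proof (rule prime_set_prod[OF T fin])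
    fix cc assume "cc \<in> PP"
    then obtain c c' where cc: "cc = (c, c')" "c \<in> V" "c' \<in> V" "c \<noteq> c'" by (auto simp: PP_def)
    then obtain i where i: "i < j" "c i \<noteq> c' i" unfolding V_def by (metis PiE_ext lessThan_iff)
    have "L c (bs i) - L c' (bs i) \<noteq> 0"
      using i jn cc of_nat_inj_char[of "c i" "c' i", where 'k = 'a] by (force simp: L_bs V_def p(1)[symmetric])
    then show "\<exists>x\<in>?T. L (fst cc) x - L (snd cc) x \<noteq> 0" using bsT[of i] i j cc(1) by (intro bexI[of _ "bs i"]) auto
  qed (intro polynomial_functions_intros L_pf)
  have G2: "\<exists>x\<in>?T. G2 x \<noteq> 0"
    unfolding G2_def
  proof (rule prime_set_prod[OF T V(1)])
    fix c assume "c \<in> V"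
    have "X j (bs j) - L c (bs j) \<noteq> 0" using jn by (simp add: L_bs X_bs)
    then show "\<exists>x\<in>?T. X j x - L c x \<noteq> 0" using bsT[OF j] by blast
  qed (intro polynomial_functions_intros L_pf X_pf)
  have root: "v ^ p ^ s = (\<Sum>i<s. \<psi> i x * v ^ p ^ i)" if x: "x \<in> ?T" and v: "v \<in> set (vs x)" for x v
  proof -
    have Xrel: "X i x ^ p ^ (s + e) = (\<Sum>l<s. \<psi> l x * X i x ^ p ^ (l + e))" if "i < s" for i
      using x by (intro rel that) auto
    have pw: "(y ^ p ^ e) ^ p ^ m = y ^ p ^ (m + e)" for y :: 'a and m
      by (simp add: power_mult[symmetric] power_add mult.commute)
    consider "v = X j x ^ p ^ e" | c where "v = L c x ^ p ^ e" using v by (auto simp: vs_eq)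
    then show ?thesis
    proof cases
      case 1
      then show ?thesis using Xrel[OF j] by (simp add: pw)
    next
      case 2
      have Lp: "L c x ^ p ^ m = (\<Sum>i<j. of_nat (c i) * X i x ^ p ^ m)" for m
        unfolding L_def freshmans_dream_sum'[OF prime p(1)[THEN arg_cong[of _ _ "\<lambda>k. k ^ m"]]] power_mult_distrib
        by (simp add: p(1) of_nat_power_char[OF prime])
      have vp: "v ^ p ^ m = (\<Sum>i<j. of_nat (c i) * X i x ^ p ^ (m + e))" for m
        unfolding 2 pw by (rule Lp)
      have "v ^ p ^ s = (\<Sum>i<j. of_nat (c i) * (\<Sum>l<s. \<psi> l x * X i x ^ p ^ (l + e)))"
        unfolding vp using j by (intro sum.cong refl) (simp add: Xrel)
      also have "\<dots> = (\<Sum>l<s. \<psi> l x * (\<Sum>i<j. of_nat (c i) * X i x ^ p ^ (l + e)))"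
        unfolding sum_distrib_left by (subst sum.swap) (simp add: mult_ac)
      also have "\<dots> = (\<Sum>l<s. \<psi> l x * v ^ p ^ l)" by (simp only: vp)
      finally show ?thesis .
    qed
  qed
  \<comment> \<open>There are \<open>p ^ j + 1\<close> points, so the divided difference of the
    power with exponent \<open>p ^ i\<close> has degree \<open>p ^ i - p ^ j\<close> in them and is
    0 for \<open>i < j\<close>.\<close>
  define H where "H = (\<lambda>x. hs (p ^ s - p ^ j) (vs x) -
    (\<Sum>i<s. \<psi> i x * (if j \<le> i then hs (p ^ i - p ^ j) (vs x) else 0)))"
  have p1: "p > 1" using p(2) by (rule prime_gt_1_nat)
  have vs_list: "vs x = map (\<lambda>f. f x) ((\<lambda>x. X j x ^ p ^ e) # fl)" for x by (simp add: vs_def)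
  have hs_pf: "(\<lambda>x. hs m (vs x)) \<in> polynomial_functions" for m
  proof -
    have "f \<in> polys n (p ^ e)" if "f \<in> set ((\<lambda>x. X j x ^ p ^ e) # fl)" for f
      using that fl polys_mono[of j n "p ^ e" "p ^ e"] jn polys_X_power[OF jn jn] by auto
    then have "(\<lambda>x. hs m (vs x)) \<in> polys n (m * p ^ e)" unfolding vs_list by (rule polys_hs)
    then show ?thesis using polys_subset by blast
  qed
  have H_pf: "H \<in> polynomial_functions"
    unfolding H_def
  proof (intro polynomial_functions_intros hs_pf \<psi>)
    show "(\<lambda>x. if j \<le> i then hs (p ^ i - p ^ j) (vs x) else 0) \<in> polynomial_functions" for i
      using hs_pf polynomial_functions.const by (cases "j \<le> i") auto
  qed simp
  have "G1 x * (G2 x * H x) = 0" if x: "x \<in> ?T" for x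
  proof (cases "G1 x = 0 \<or> G2 x = 0")
    case False
    have "distinct (vs x)"
    proof -
      have "inj_on (\<lambda>c. L c x ^ p ^ e) (set cs)"
      proof (rule inj_onI)
        fix c c' assume c: "c \<in> set cs" "c' \<in> set cs" "L c x ^ p ^ e = L c' x ^ p ^ e"
        then have eq: "L c x = L c' x" using power_char_inj[OF prime] p(1) by blast
        show "c = c'"
        proof (rule ccontr)
          assume "c \<noteq> c'"
          then have "(c, c') \<in> PP" using c cs by (simp add: PP_def)
          then have "G1 x = 0" unfolding G1_def using eq fin by (intro prod_zero) (auto intro!: bexI[of _ "(c, c')"])
          then show False using False by simp
        qed
      qed
      moreover have "X j x ^ p ^ e \<noteq> L c x ^ p ^ e" if c: "c \<in> set cs" for c
      proof
        assume "X j x ^ p ^ e = L c x ^ p ^ e"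
        then have "X j x = L c x" using power_char_inj[OF prime] p(1) by blast
        then have "G2 x = 0" unfolding G2_def using V c cs by (intro prod_zero) auto
        then show False using False by simp
      qed
      ultimately show ?thesis using cs by (auto simp: vs_eq distinct_map)
    qed
    then have "(\<Sum>i\<le>s. (if i = s then 1 else - \<psi> i x) * divided_difference (p ^ i) (vs x)) = 0"
    proof (rule divided_difference_at_roots)
      fix v assume "v \<in> set (vs x)"
      from root[OF x this] show "(\<Sum>i\<le>s. (if i = s then 1 else - \<psi> i x) * v ^ p ^ i) = 0"
        by (simp add: lessThan_Suc_atMost[symmetric] sum_negf)
    qed (simp add: vs_def)
    then have "divided_difference (p ^ s) (vs x) = (\<Sum>i<s. \<psi> i x * divided_difference (p ^ i) (vs x))"
      by (simp add: lessThan_Suc_atMost[symmetric] sum_negf)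
    moreover have "divided_difference (p ^ i) (vs x) = (if j \<le> i then hs (p ^ i - p ^ j) (vs x) else 0)" for i
      using len p1 by (simp add: divided_difference_def vs_def power_increasing_iff)
    ultimately have "H x = 0" using j by (simp add: H_def)
    then show ?thesis by simp
  qed auto
  then have "G2 x * H x = 0" if "x \<in> ?T" for x
    using prime_setD[OF T G_pf(1) polynomial_functions.mult[OF G_pf(2) H_pf] _ G1 that] by blast
  then have H0: "H x = 0" if "x \<in> ?T" for x
    using prime_setD[OF T G_pf(2) H_pf _ G2 that] by blast
  show ?thesis
  proof (intro exI[of _ fl] conjI allI impI ballI fl len)
    fix x assume "\<forall>l\<in>{s..<n}. X l x = 0"
    then have "H x = 0" by (intro H0) auto
    then show "hs (p ^ s - p ^ j) (X j x ^ p ^ e # map (\<lambda>f. f x) fl) =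
      (\<Sum>i<s. \<psi> i x * (if j \<le> i then hs (p ^ i - p ^ j) (X j x ^ p ^ e # map (\<lambda>f. f x) fl) else 0))"
      unfolding H_def vs_def by simp
  qed
qed

text \<open>In the relation on the torus, expand the symmetric polynomial in powers of
  \<open>X j ^ p ^ e\<close>. The top term is \<open>X j\<close> to the power
  \<open>(p ^ s - p ^ j) * p ^ e\<close>, and every other term has a factor in earlier coordinates.
  Off the torus, the error vanishes on a coordinate subspace and is absorbed by the
  \<open>X l\<close>.\<close>

theorem parameter_system_if_torus_relation:
  assumes p: "p = CHAR('a)" "prime p" and s: "s \<le> n"
    and \<psi>: "\<And>i. i < s \<Longrightarrow> \<psi> i \<in> polys n (p ^ (s + e) - p ^ (i + e))"
    and rel: "\<And>x i. (\<And>l. l \<in> {s..<n} \<Longrightarrow> X l x = 0) \<Longrightarrow> i < s \<Longrightarrow>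
      X i x ^ p ^ (s + e) = (\<Sum>l<s. \<psi> l x * X i x ^ p ^ (l + e))"
  shows "parameter_system scale n bs X s (\<lambda>j. p ^ (s + e) - p ^ (j + e)) \<psi>"
proof unfold_locales
  have p1: "p > 1" using p(2) by (rule prime_gt_1_nat)
  define D where "D = (\<lambda>j. p ^ (s + e) - p ^ (j + e))"
  have D: "D j = (p ^ s - p ^ j) * p ^ e" for j by (simp add: D_def power_add diff_mult_distrib)
  show "s \<le> n" by (fact s)
  show "0 < p ^ (s + e) - p ^ (j + e)" if "j < s" for j using that p1 by simp
  show \<psi>_pf: "\<psi> j \<in> polynomial_functions" if "j < s" for j using \<psi>[OF that] polys_subset by blast
  fix j assume j: "j < s"
  have jn: "j < n" using j s by simp
  have Dj: "D j > 0" using j p1 by (simp add: D_def)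
  obtain fl where fl: "\<And>f. f \<in> set fl \<Longrightarrow> f \<in> polys j (p ^ e)" "length fl = p ^ j"
    and eq: "\<And>x. (\<And>l. l \<in> {s..<n} \<Longrightarrow> X l x = 0) \<Longrightarrow>
      hs (p ^ s - p ^ j) (X j x ^ p ^ e # map (\<lambda>f. f x) fl) =
      (\<Sum>i<s. \<psi> i x * (if j \<le> i then hs (p ^ i - p ^ j) (X j x ^ p ^ e # map (\<lambda>f. f x) fl) else 0))"
    using torus_relation[OF p s j \<psi>_pf rel] by blast
  let ?M = "p ^ s - p ^ j"
  define w where "w = (\<lambda>m x. hs m (map (\<lambda>f. f x) fl))"
  define g where "g = (\<lambda>x. \<Sum>k<?M. -1 * (X j x ^ (k * p ^ e) * w (?M - k) x))"
  define f where "f = (\<lambda>i x. if j \<le> i then hs (p ^ i - p ^ j) (X j x ^ p ^ e # map (\<lambda>f. f x) fl) else 0)"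
  have g: "g \<in> fs.span (mon ` {a \<in> exps n (D j). wt a < Suc j * D j})"
    unfolding g_def
  proof (intro fspan_sum fspan_scale)
    fix k assume "k \<in> {..<?M}"
    then have k: "k * p ^ e + (?M - k) * p ^ e = D j" "(?M - k) * p ^ e > 0"
      using p1 by (auto simp: D add_mult_distrib[symmetric])
    have "w (?M - k) \<in> polys j ((?M - k) * p ^ e)" unfolding w_def by (rule polys_hs) (rule fl)
    from X_power_mult_lower_polys[OF jn this k(2), of "k * p ^ e"]
    show "(\<lambda>x. X j x ^ (k * p ^ e) * w (?M - k) x) \<in> fs.span (mon ` {a \<in> exps n (D j). wt a < Suc j * D j})"
      unfolding k(1) .
  qed
  have f: "if D i \<le> D j then f i \<in> polys n (D j - D i) else f i = (\<lambda>_. 0)" if i: "i < s" for i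
  proof -
    \<comment> \<open>\<open>D\<close> decreases, so the condition on degrees in the locale is the
      condition \<open>j \<le> i\<close> that makes the divided difference nonzero.\<close>
    have "D i \<le> D j \<longleftrightarrow> j \<le> i"
    proof
      assume le: "D i \<le> D j"
      show "j \<le> i"
      proof (rule ccontr)
        assume "\<not> j \<le> i"
        then have "p ^ (i + e) < p ^ (j + e)" "p ^ (j + e) < p ^ (s + e)" using p1 j by (simp_all add: power_strict_increasing_iff)
        then show False using le by (simp add: D_def)
      qed
    next
      assume "j \<le> i"
      then have "p ^ (j + e) \<le> p ^ (i + e)" using p1 by (simp add: power_increasing_iff)
      then show "D i \<le> D j" by (simp add: D_def)
    qed
    moreover have "f i \<in> polys n (D j - D i)" if ji: "j \<le> i"
    proof -
      have "p ^ j \<le> p ^ i" "p ^ i \<le> p ^ s" using p1 ji i by (simp_all add: power_increasing_iff)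
      then have "D j - D i = (p ^ i - p ^ j) * p ^ e" by (simp add: D diff_mult_distrib[symmetric])
      moreover have "f i = (\<lambda>x. hs (p ^ i - p ^ j) (map (\<lambda>f. f x) ((\<lambda>x. X j x ^ p ^ e) # fl)))"
        using ji by (simp add: f_def)
      moreover have "(\<lambda>x. hs (p ^ i - p ^ j) (map (\<lambda>f. f x) ((\<lambda>x. X j x ^ p ^ e) # fl))) \<in> polys n ((p ^ i - p ^ j) * p ^ e)"
      proof (rule polys_hs)
        show "h \<in> polys n (p ^ e)" if "h \<in> set ((\<lambda>x. X j x ^ p ^ e) # fl)" for h
          using that fl polys_mono[of j n "p ^ e" "p ^ e"] jn polys_X_power[OF jn jn] by auto
      qed
      ultimately show ?thesis by simp
    qed
    ultimately show ?thesis by (auto simp: f_def)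
  qed
  define F where "F = (\<lambda>x. X j x ^ D j - g x - (\<Sum>i<s. \<psi> i x * f i x))"
  have "F \<in> polys n (D j)"
    unfolding F_def
  proof (intro polys_diff polys_sum)
    show "(\<lambda>x. X j x ^ D j) \<in> polys n (D j)" using polys_X_power[OF jn jn] .
    have "fs.span (mon ` {a \<in> exps n (D j). wt a < Suc j * D j}) \<subseteq> polys n (D j)"
      unfolding polys_def by (intro fs.span_mono image_mono) auto
    then show "g \<in> polys n (D j)" using g by blast
    fix i assume "i \<in> {..<s}"
    then have i: "i < s" by simp
    show "(\<lambda>x. \<psi> i x * f i x) \<in> polys n (D j)"
    proof (cases "D i \<le> D j")
      case True
      have "(\<lambda>x. \<psi> i x * f i x) \<in> polys n (D i + (D j - D i))"
        using f[OF i] True \<psi>[OF i] by (intro polys_mult) (simp_all add: D_def)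
      then show ?thesis using True by simp
    next
      case False
      then show ?thesis using f[OF i] by (simp add: polys_0)
    qed
  qed
  moreover have "F x = 0" if "\<And>l. l \<in> {s..<n} \<Longrightarrow> X l x = 0" for x
  proof -
    have "hs ?M (X j x ^ p ^ e # map (\<lambda>f. f x) fl) = (\<Sum>k\<le>?M. (X j x ^ p ^ e) ^ k * w (?M - k) x)"
      unfolding hs_expand w_def ..
    also have "\<dots> = (\<Sum>k<?M. X j x ^ (k * p ^ e) * w (?M - k) x) + X j x ^ D j"
      by (simp add: lessThan_Suc_atMost[symmetric] w_def D power_mult[symmetric] mult.commute)
    also have "\<dots> = X j x ^ D j - g x" by (simp add: g_def sum_negf)
    finally show ?thesis using eq[OF that] by (simp add: F_def f_def)
  qed
  ultimately obtain h where h: "\<forall>l. h l \<in> polys n (D j - 1)" "\<And>x. F x = (\<Sum>l\<in>{s..<n}. X l x * h l x)"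
    using vanishing_on_subspace[OF _ Dj s] by blast
  have "X j x ^ D j = g x + (\<Sum>i<s. \<psi> i x * f i x) + (\<Sum>l\<in>{s..<n}. X l x * h l x)" for x
    using h(2)[of x] by (simp add: F_def algebra_simps)
  then show "\<exists>g f h. g \<in> fs.span (mon ` {a \<in> exps n (p ^ (s + e) - p ^ (j + e)). wt a < Suc j * (p ^ (s + e) - p ^ (j + e))}) \<and>
      (\<forall>i<s. if p ^ (s + e) - p ^ (i + e) \<le> p ^ (s + e) - p ^ (j + e)
        then f i \<in> polys n (p ^ (s + e) - p ^ (j + e) - (p ^ (s + e) - p ^ (i + e))) else f i = (\<lambda>_. 0)) \<and>
      (\<forall>l. h l \<in> polys n (p ^ (s + e) - p ^ (j + e) - 1)) \<and>
      (\<forall>x. X j x ^ (p ^ (s + e) - p ^ (j + e)) = g x + (\<Sum>i<s. \<psi> i x * f i x) + (\<Sum>l\<in>{s..<n}. X l x * h l x))"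
    using g f h(1) unfolding D_def by blast
qed

end

section \<open>The power map on commuting elements\<close>

context restricted_lie_algebra
begin

lemma prime_CHAR: "prime CHAR('a)"
  using CHAR_positive by (rule prime_CHAR_semidom)

lemma lie_zero_left [simp]: "lie 0 x = 0"
  using lie_add_left[of 0 0 x] by simp

lemma lie_antisym: "lie y x = - lie x y"
proof -
  have "lie (x + y) (x + y) = (lie x x + lie x y) + (lie y x + lie y y)"
    unfolding lie_add_right[of "x + y" x y] lie_add_left[of x y x] lie_add_left[of x y y]
    by (simp only: add_ac)
  then have "lie y x + lie x y = 0" by (simp add: lie_self add.commute)
  then show ?thesis by (simp add: eq_neg_iff_add_eq_0)
qed

lemma lie_commute_zero: "lie x y = 0 \<Longrightarrow> lie y x = 0"
  using lie_antisym[of y x] by simp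

lemma lie_sum_left: "lie (sum f A) y = (\<Sum>i\<in>A. lie (f i) y)"
  by (induction A rule: infinite_finite_induct) (auto simp: lie_add_left)

lemma lie_funpow_zero [simp]: "(lie x ^^ m) 0 = 0"
  by (induction m) auto

lemma lie_funpow_eq_zero: "lie x y = 0 \<Longrightarrow> m > 0 \<Longrightarrow> (lie x ^^ m) y = 0"
  by (cases m) (auto simp: funpow_swap1)

lemma ad_coeff_commuting:
  assumes "lie x y = 0" "m > 0"
  shows "ad_coeff x y x m j = 0"
  using assms(2)
proof (induction m arbitrary: j)
  case (Suc m)
  show ?case
  proof (cases "m = 0")
    case True
    then show ?thesis using lie_commute_zero[OF assms(1)] by (cases j) (auto simp: lie_self)
  next
    case False
    then show ?thesis using Suc.IH by (cases j) auto
  qed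
qed simp

text \<open>Jacobson's terms apply \<open>p - 1 \<ge> 1\<close> adjoint operators to
  \<open>x\<close>, and the first one already gives 0.\<close>

lemma pmap_add_commuting: "lie x y = 0 \<Longrightarrow> pmap (x + y) = pmap x + pmap y"
  using prime_ge_2_nat[OF prime_CHAR]
  by (simp add: pmap_add jacobson_term_def ad_coeff_commuting)

lemma pmap_0 [simp]: "pmap 0 = 0"
  using pmap_scale[of 0 0] CHAR_positive by (simp add: power_0_left)

lemma pmap_funpow_0 [simp]: "(pmap ^^ m) 0 = 0"
  by (induction m) auto

lemma pmap_sum_commuting:
  assumes "\<And>i j. i \<in> A \<Longrightarrow> j \<in> A \<Longrightarrow> lie (z i) (z j) = 0"
  shows "pmap (\<Sum>i\<in>A. c i *s z i) = (\<Sum>i\<in>A. c i ^ CHAR('a) *s pmap (z i))"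
  using assms
proof (induction A rule: infinite_finite_induct)
  case (insert i A)
  have "lie (c i *s z i) (\<Sum>j\<in>A. c j *s z j) = 0"
    using insert by (simp add: lie_sum_right lie_scale_left lie_scale_right)
  then show ?case using insert by (simp add: pmap_add_commuting pmap_scale)
qed simp_all

lemma lie_pmap_funpow_zero: "lie x y = 0 \<Longrightarrow> lie ((pmap ^^ a) x) y = 0"
proof (induction a)
  case (Suc a)
  then show ?case using CHAR_positive by (simp add: lie_pmap lie_funpow_eq_zero)
qed simp

lemma lie_pmap_funpows: "lie ((pmap ^^ a) x) ((pmap ^^ b) x) = 0"
  by (intro lie_pmap_funpow_zero lie_commute_zero[OF lie_pmap_funpow_zero] lie_self)

lemma pmap_fixed_sum:
  assumes "\<And>i j. i \<in> A \<Longrightarrow> j \<in> A \<Longrightarrow> lie (h i) (h j) = 0" "\<And>i. i \<in> A \<Longrightarrow> pmap (h i) = h i"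
  shows "(pmap ^^ m) (\<Sum>i\<in>A. c i *s h i) = (\<Sum>i\<in>A. c i ^ (CHAR('a) ^ m) *s h i)"
proof (induction m)
  case (Suc m)
  then show ?case
    using assms by (simp add: pmap_sum_commuting power_mult[symmetric] mult.commute cong: sum.cong)
qed simp

end

section \<open>Tori\<close>

lemma (in vector_space) span_image_lessThan:
  fixes m :: nat
  assumes "y \<in> span (f ` {..<m})"
  shows "\<exists>a. y = (\<Sum>i<m. scale (a i) (f i))"
  using assms
proof (induction m arbitrary: y)
  case (Suc m)
  then obtain k where "y - scale k (f m) \<in> span (f ` {..<m})"
    by (auto simp: lessThan_Suc span_breakdown_eq)
  then obtain a where "y - scale k (f m) = (\<Sum>i<m. scale (a i) (f i))" using Suc.IH by blast
  then have "y = (\<Sum>i<Suc m. scale ((a(m := k)) i) (f i))" by (simp add: diff_eq_eq)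
  then show ?case by blast
qed simp

locale closed_restricted_lie_algebra = restricted_lie_algebra scale lie pmap +
  finite_dimensional_vector_space scale Basis
  for scale :: "'a::alg_closed_field \<Rightarrow> 'b::ab_group_add \<Rightarrow> 'b" (infixr \<open>*s\<close> 75)
    and lie pmap Basis
begin

text \<open>A sequence that always escapes the span of its predecessors would be independent and
  longer than \<open>Basis\<close>; adding \<open>F\<close> only enlarges the span.\<close>

lemma funpow_dependence:
  fixes w :: "nat \<Rightarrow> 'b"
  shows "\<exists>m. w m \<in> span (F \<union> w ` {..<m})"
proof (rule ccontr)
  assume "\<not> ?thesis"
  then have new: "w m \<notin> span (w ` {..<m})" for m
    using span_mono[of "w ` {..<m}" "F \<union> w ` {..<m}"] by auto
  have "independent (w ` {..<m}) \<and> card (w ` {..<m}) = m" for m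
  proof (induction m)
    case (Suc m)
    have "w m \<notin> w ` {..<m}" using new[of m] span_base[of "w m" "w ` {..<m}"] by argo
    then show ?case using Suc new[of m] by (simp add: lessThan_Suc independent_insert)
  qed (simp add: independent_empty)
  from this[of "Suc (card Basis)"] show False
    using independent_card_le_dim[OF subset_UNIV, of "w ` {..<Suc (card Basis)}"] by simp
qed

text \<open>The operator \<open>v \<mapsto> v\<^sup>[\<^sup>p\<^sup>]\<close> is semilinear and injective on \<open>S\<close>, so this is Lang's theorem for it.\<close>

lemma span_fixed_vectors:
  assumes S: "subspace S" "\<And>x y. x \<in> S \<Longrightarrow> y \<in> S \<Longrightarrow> lie x y = 0" "\<And>x. x \<in> S \<Longrightarrow> pmap x \<in> S" "inj_on pmap S"
  shows "S \<subseteq> span {h \<in> S. pmap h = h}"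
proof
  let ?p = "CHAR('a)"
  have p2: "?p \<ge> 2" using prime_CHAR by (rule prime_ge_2_nat)
  let ?F = "{h \<in> S. pmap h = h}"
  define U where "U = span ?F"
  have US: "U \<subseteq> S" unfolding U_def by (rule span_minimal) (use S(1) in auto)
  have U_expl: "\<exists>t c. finite t \<and> t \<subseteq> ?F \<and> u = (\<Sum>h\<in>t. c h *s h)" if "u \<in> U" for u
    using that unfolding U_def span_explicit by blast
  have pm: "pmap (\<Sum>h\<in>t. c h *s h) = (\<Sum>h\<in>t. c h ^ ?p *s h)" if "t \<subseteq> ?F" for t c
    using pmap_sum_commuting[of t "\<lambda>h. h" c] that S(2) by (simp add: subset_iff cong: sum.cong)
  have in_U: "(\<Sum>h\<in>t. c h *s h) \<in> U" if "t \<subseteq> ?F" for t c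
    unfolding U_def using that by (intro span_sum span_scale span_base) auto
  \<comment> \<open>\<open>U\<close> contains the preimages of its elements in \<open>S\<close>:
    take roots of the coefficients and use injectivity.\<close>
  have pull: "y \<in> U" if yS: "y \<in> S" and pyU: "pmap y \<in> U" for y
  proof -
    obtain t c where t: "t \<subseteq> ?F" "pmap y = (\<Sum>h\<in>t. c h *s h)" using U_expl[OF pyU] by blast
    have "\<forall>h. \<exists>d. d ^ ?p = c h" using nth_root_exists[OF CHAR_positive] by blast
    then obtain d where "\<forall>h. d h ^ ?p = c h" by (rule choice[THEN exE])
    then have "pmap (\<Sum>h\<in>t. d h *s h) = pmap y" using pm[OF t(1), of d] t(2) by simp
    then have "(\<Sum>h\<in>t. d h *s h) = y" using S(4) yS in_U[OF t(1), of d] US by (auto dest: inj_onD)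
    then show ?thesis using in_U[OF t(1), of d] by simp
  qed
  fix v assume v: "v \<in> S"
  show "v \<in> span ?F"
  proof (rule ccontr)
    assume nv: "v \<notin> span ?F"
    define w where "w = (\<lambda>i. (pmap ^^ i) v)"
    have wS: "w i \<in> S" for i unfolding w_def by (induction i) (auto simp: v S(3))
    \<comment> \<open>The first linear dependence among the iterates of \<open>v\<close> modulo
      \<open>U\<close>.\<close>
    define m where "m = (LEAST m. w m \<in> span (?F \<union> w ` {..<m}))"
    have m: "w m \<in> span (?F \<union> w ` {..<m})"
      unfolding m_def by (rule LeastI_ex) (rule funpow_dependence)
    have least: "w k \<notin> span (?F \<union> w ` {..<k})" if "k < m" for k
      using that not_less_Least unfolding m_def by blast
    have "m \<noteq> 0"
    proof
      assume "m = 0"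
      then show False using m nv by (simp add: w_def)
    qed
    then obtain m' where m': "m = Suc m'" by (cases m) auto
    obtain u y where uy: "u \<in> U" "y \<in> span (w ` {..<m})" "w m = u + y"
      using m unfolding span_Un U_def by blast
    obtain a where a: "y = (\<Sum>i<m. a i *s w i)" using span_image_lessThan[OF uy(2)] by blast
    have UF: "U \<subseteq> span (?F \<union> w ` {..<m'})" unfolding U_def by (rule span_mono) simp
    \<comment> \<open>Otherwise \<open>w m\<close> is in \<open>U\<close>, and \<open>pull\<close>
      gives an earlier dependence.\<close>
    have "\<exists>i<m. a i \<noteq> 0"
    proof (rule ccontr)
      assume "\<not> ?thesis"
      then have "y = 0" by (simp add: a)
      then have "pmap (w m') \<in> U" using uy m' by (simp add: w_def)
      then have "w m' \<in> U" using wS by (rule pull[rotated])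
      then show False using least[of m'] m' UF by auto
    qed
    then obtain i0 where i0: "i0 < m" "a i0 \<noteq> 0" by blast
    \<comment> \<open>A combination \<open>z\<close> of the \<open>w i\<close> with coefficients
      \<open>b i\<close> and \<open>pmap z = z + \<beta> ^ ?p *s u\<close> needs
      \<open>b 0 = \<beta> ^ ?p * a 0\<close>,
      \<open>b (Suc i) = b i ^ ?p + \<beta> ^ ?p * a (Suc i)\<close> and
      \<open>b m' = \<beta>\<close>. Solving the recursion and dividing the last condition by
      \<open>\<beta>\<close> says that \<open>\<beta>\<close> is a root of \<open>Q\<close>.\<close>
    define Q where "Q = (\<Sum>i<m. monom (a i ^ ?p ^ (m' - i)) (?p ^ (m - i) - 1)) - 1"
    have pos: "?p ^ (m - i) - 1 > 0" if "i < m" for i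
      using that p2 one_less_power[of ?p "m - i"] by simp
    have "coeff Q (?p ^ (m - i0) - 1) = (\<Sum>i<m. if i = i0 then a i ^ ?p ^ (m' - i) else 0)"
    proof -
      have "(?p ^ (m - i) - 1 = ?p ^ (m - i0) - 1) = (i = i0)" if "i < m" for i
      proof -
        have "(?p ^ (m - i) - 1 = ?p ^ (m - i0) - 1) = (?p ^ (m - i) = ?p ^ (m - i0))"
          using pos[OF that] pos[OF i0(1)] by linarith
        also have "\<dots> = (m - i = m - i0)" using p2 by (simp add: power_inject_exp)
        finally show ?thesis using that i0(1) by auto
      qed
      then have "(\<Sum>i<m. if ?p ^ (m - i) - 1 = ?p ^ (m - i0) - 1 then a i ^ ?p ^ (m' - i) else 0) =
          (\<Sum>i<m. if i = i0 then a i ^ ?p ^ (m' - i) else 0)"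
        by (intro sum.cong refl) (simp only: lessThan_iff)
      then show ?thesis using pos[OF i0(1)] by (simp only: Q_def coeff_sum coeff_monom coeff_diff coeff_1) simp
    qed
    also have "\<dots> = a i0 ^ ?p ^ (m' - i0)" using i0 by simp
    finally have "coeff Q (?p ^ (m - i0) - 1) \<noteq> 0" using i0 by simp
    then have "degree Q > 0" using le_degree[of Q "?p ^ (m - i0) - 1"] pos[OF i0(1)] by linarith
    then obtain \<beta> where \<beta>: "poly Q \<beta> = 0" using alg_closed_imp_poly_has_root by blast
    then have sum1: "(\<Sum>i<m. a i ^ ?p ^ (m' - i) * \<beta> ^ (?p ^ (m - i) - 1)) = 1"
      by (simp add: Q_def poly_sum poly_monom)
    have \<beta>0: "\<beta> \<noteq> 0"
    proof
      assume "\<beta> = 0"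
      have "(\<Sum>i<m. a i ^ ?p ^ (m' - i) * \<beta> ^ (?p ^ (m - i) - 1)) = 0"
        using pos \<open>\<beta> = 0\<close> by (intro sum.neutral) auto
      then show False using sum1 by simp
    qed
    define b where "b = (\<lambda>i. \<Sum>l\<le>i. a l ^ ?p ^ (i - l) * \<beta> ^ ?p ^ Suc (i - l))"
    have b0: "b 0 = \<beta> ^ ?p * a 0" by (simp add: b_def)
    have bS: "b (Suc i) = b i ^ ?p + \<beta> ^ ?p * a (Suc i)" for i
    proof -
      have "b i ^ ?p = (\<Sum>l\<le>i. (a l ^ ?p ^ (i - l) * \<beta> ^ ?p ^ Suc (i - l)) ^ ?p)"
        unfolding b_def by (rule freshmans_dream_sum[OF prime_CHAR refl])
      also have "\<dots> = (\<Sum>l\<le>i. a l ^ ?p ^ (Suc i - l) * \<beta> ^ ?p ^ Suc (Suc i - l))"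
        by (intro sum.cong refl) (simp add: power_mult_distrib power_mult[symmetric] Suc_diff_le mult_ac)
      finally show ?thesis by (simp add: b_def mult.commute)
    qed
    have bm: "b m' = \<beta>"
    proof -
      have "b m' = (\<Sum>i<m. \<beta> * (a i ^ ?p ^ (m' - i) * \<beta> ^ (?p ^ (m - i) - 1)))"
        unfolding b_def m' lessThan_Suc_atMost
      proof (rule sum.cong[OF refl])
        fix l assume "l \<in> {..m'}"
        then have "\<beta> ^ ?p ^ Suc (m' - l) = \<beta> * \<beta> ^ (?p ^ (Suc m' - l) - 1)"
          using pos[of l] m' power_minus_mult[of "?p ^ Suc (m' - l)" \<beta>]
          by (simp add: Suc_diff_le mult.commute CHAR_positive)
        then show "a l ^ ?p ^ (m' - l) * \<beta> ^ ?p ^ Suc (m' - l) =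
            \<beta> * (a l ^ ?p ^ (m' - l) * \<beta> ^ (?p ^ (Suc m' - l) - 1))" by simp
      qed
      then show ?thesis using sum1 by (simp add: sum_distrib_left[symmetric])
    qed
    define z where "z = (\<Sum>i<m. b i *s w i)"
    have zS: "z \<in> S" unfolding z_def using wS S(1) by (intro subspace_sum subspace_scale) auto
    have pz: "pmap z = z + \<beta> ^ ?p *s u"
    proof -
      have "pmap z = (\<Sum>i<m. b i ^ ?p *s w (Suc i))"
        unfolding z_def using wS S(2) by (subst pmap_sum_commuting) (auto simp: w_def)
      also have "\<dots> = (\<Sum>i<m'. b i ^ ?p *s w (Suc i)) + \<beta> ^ ?p *s (u + y)"
        using uy(3) by (simp add: m' bm)
      also have "y = a 0 *s w 0 + (\<Sum>i<m'. a (Suc i) *s w (Suc i))"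
        unfolding a m' by (rule sum.lessThan_Suc_shift)
      also have "(\<Sum>i<m'. b i ^ ?p *s w (Suc i)) + \<beta> ^ ?p *s (u + (a 0 *s w 0 + (\<Sum>i<m'. a (Suc i) *s w (Suc i)))) =
          b 0 *s w 0 + (\<Sum>i<m'. b (Suc i) *s w (Suc i)) + \<beta> ^ ?p *s u"
      proof -
        have "(\<Sum>i<m'. b (Suc i) *s w (Suc i)) =
            (\<Sum>i<m'. b i ^ ?p *s w (Suc i)) + \<beta> ^ ?p *s (\<Sum>i<m'. a (Suc i) *s w (Suc i))"
          by (simp add: bS scale_left_distrib scale_sum_right sum.distrib)
        then show ?thesis by (simp add: b0 scale_right_distrib add_ac)
      qed
      also have "b 0 *s w 0 + (\<Sum>i<m'. b (Suc i) *s w (Suc i)) = z"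
        unfolding z_def m' by (rule sum.lessThan_Suc_shift[symmetric])
      finally show ?thesis .
    qed
    have \<beta>u: "\<beta> ^ ?p *s u \<in> U" using uy(1) unfolding U_def by (rule span_scale)
    obtain t c where t: "finite t" "t \<subseteq> ?F" "\<beta> ^ ?p *s u = (\<Sum>h\<in>t. c h *s h)" using U_expl[OF \<beta>u] by blast
    \<comment> \<open>\<open>z\<close> is fixed only modulo \<open>U\<close>. Artin-Schreier
      equations for the coefficients of \<open>\<beta> ^ ?p *s u\<close> correct it by an element of
      \<open>U\<close> to a fixed vector.\<close>
    have "\<exists>d. c h + d ^ ?p = d" for h
    proof -
      have "coeff (monom 1 ?p - [:- c h, 1:]) ?p \<noteq> 0"
        using p2 by (simp add: coeff_pCons split: nat.split)
      then have "degree (monom 1 ?p - [:- c h, 1:]) > 0"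
        using le_degree[of "monom 1 ?p - [:- c h, 1:]" ?p] p2 by linarith
      then obtain d where "poly (monom 1 ?p - [:- c h, 1:]) d = 0" using alg_closed_imp_poly_has_root by blast
      then show ?thesis by (intro exI[of _ d]) (simp add: poly_monom algebra_simps)
    qed
    then obtain d where d: "\<And>h. c h + d h ^ ?p = d h" by metis
    define z' where "z' = z + (\<Sum>h\<in>t. d h *s h)"
    have dS: "(\<Sum>h\<in>t. d h *s h) \<in> S" using in_U[OF t(2)] US by blast
    have "pmap z' = z + \<beta> ^ ?p *s u + (\<Sum>h\<in>t. d h ^ ?p *s h)"
      unfolding z'_def using zS dS S(2) by (simp add: pmap_add_commuting pz pm[OF t(2)])
    also have "\<dots> = z + (\<Sum>h\<in>t. (c h + d h ^ ?p) *s h)"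
      by (simp add: t(3) scale_left_distrib sum.distrib add.assoc)
    also have "\<dots> = z'" by (simp only: d z'_def)
    finally have "z' \<in> U"
      unfolding U_def using zS dS S(1) by (intro span_base) (auto simp: z'_def intro: subspace_add)
    then have "z' - (\<Sum>h\<in>t. d h *s h) \<in> U" using in_U[OF t(2)] unfolding U_def by (rule span_diff)
    then have zU: "z \<in> U" by (simp add: z'_def)
    \<comment> \<open>The last coefficient of \<open>z\<close> is the nonzero
      \<open>\<beta>\<close>, so \<open>z\<close> in \<open>U\<close> makes \<open>w m'\<close>
      dependent on its predecessors, against the minimality of \<open>m\<close>.\<close>
    have "z = (\<Sum>i<m'. b i *s w i) + \<beta> *s w m'" by (simp add: z_def m' bm)
    then have "w m' = inverse \<beta> *s (z - (\<Sum>i<m'. b i *s w i))" using \<beta>0 by simp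
    moreover have "inverse \<beta> *s (z - (\<Sum>i<m'. b i *s w i)) \<in> span (?F \<union> w ` {..<m'})"
    proof (intro span_scale span_diff span_sum)
      show "z \<in> span (?F \<union> w ` {..<m'})" using zU UF by blast
      show "w i \<in> span (?F \<union> w ` {..<m'})" if "i \<in> {..<m'}" for i
        using that by (intro span_base) blast
    qed
    ultimately show False using least[of m'] m' by simp
  qed
qed

text \<open>The iterates of one element commute, so Lang's theorem applies to \<open>S\<close>
  before \<open>T\<close> is known to be abelian. The last conclusion is semisimplicity of
  \<open>x\<close>: fixed vectors of \<open>S\<close> are images under \<open>pmap\<close>, hence
  combinations of positive iterates.\<close>

lemma toral_subset_span_pmap_orbit:
  assumes T: "toral T" and x: "x \<in> T"
  defines "S \<equiv> span (range (\<lambda>i. (pmap ^^ i) x))"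
  shows "S \<subseteq> T" "S \<subseteq> span {h \<in> S. pmap h = h}" "x \<in> span (range (\<lambda>i. (pmap ^^ Suc i) x))"
proof -
  let ?w = "\<lambda>i. (pmap ^^ i) x"
  have sub: "subspace T" "\<And>x. x \<in> T \<Longrightarrow> pmap x \<in> T" and inj: "inj_on pmap T"
    using T by (auto simp: toral_def restricted_subalgebra_def)
  have wT: "?w i \<in> T" for i by (induction i) (auto simp: x sub(2))
  show ST: "S \<subseteq> T" unfolding S_def by (rule span_minimal) (use wT sub in auto)
  have S_expl: "\<exists>t c. finite t \<and> y = (\<Sum>i\<in>t. c i *s ?w i)" if "y \<in> S" for y
    using that unfolding S_def
  proof (induction rule: span_induct_alt)
    case base
    show ?case by (intro exI[of _ "{}"]) simp
  next
    case (step k h y)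
    then obtain i where i: "h = ?w i" by auto
    obtain t c where t: "finite t" "y = (\<Sum>i\<in>t. c i *s ?w i)" using step by blast
    have "k *s h + y = (\<Sum>j\<in>insert i t. ((if j = i then k else 0) + (if j \<in> t then c j else 0)) *s ?w j)"
    proof -
      have "(\<Sum>j\<in>insert i t. (if j = i then k else 0) *s ?w j) = k *s h"
        using t(1) i by (simp add: if_distrib[of "\<lambda>a. a *s _"] cong: if_cong)
      moreover have "(\<Sum>j\<in>insert i t. (if j \<in> t then c j else 0) *s ?w j) = y"
        unfolding t(2) using t(1) by (intro sum.mono_neutral_cong_right) auto
      ultimately show ?thesis by (simp add: scale_left_distrib sum.distrib)
    qed
    then show ?case using t(1) by (intro exI[of _ "insert i t"] exI conjI) auto
  qed
  have comm: "lie y y' = 0" if y: "y \<in> S" and y': "y' \<in> S" for y y'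
  proof -
    obtain t c where "y = (\<Sum>i\<in>t. c i *s ?w i)" using S_expl[OF y] by blast
    moreover obtain t' c' where "y' = (\<Sum>i\<in>t'. c' i *s ?w i)" using S_expl[OF y'] by blast
    ultimately show ?thesis
      by (simp add: lie_sum_left lie_sum_right lie_scale_left lie_scale_right lie_pmap_funpows)
  qed
  have pm: "pmap y \<in> span (range (\<lambda>i. (pmap ^^ Suc i) x))" if y: "y \<in> S" for y
  proof -
    obtain t c where "y = (\<Sum>i\<in>t. c i *s ?w i)" using S_expl[OF y] by blast
    then have "pmap y = (\<Sum>i\<in>t. c i ^ CHAR('a) *s (pmap ^^ Suc i) x)"
      using pmap_sum_commuting[of t ?w c] by (simp add: lie_pmap_funpows)
    then show ?thesis by (simp only:) (intro span_sum span_scale span_base rangeI)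
  qed
  have "span (range (\<lambda>i. (pmap ^^ Suc i) x)) \<subseteq> S"
    unfolding S_def
  proof (rule span_mono, rule image_subsetI)
    show "(pmap ^^ Suc i) x \<in> range (\<lambda>i. (pmap ^^ i) x)" for i
      by (rule range_eqI[where x = "Suc i"]) (rule refl)
  qed
  then have pS: "pmap y \<in> S" if "y \<in> S" for y using pm[OF that] by (rule subsetD)
  show fixed: "S \<subseteq> span {h \<in> S. pmap h = h}"
    using comm pS inj ST by (intro span_fixed_vectors) (auto simp: S_def intro: inj_on_subset)
  have "{h \<in> S. pmap h = h} \<subseteq> span (range (\<lambda>i. (pmap ^^ Suc i) x))" using pm by force
  then have "span {h \<in> S. pmap h = h} \<subseteq> span (range (\<lambda>i. (pmap ^^ Suc i) x))"
    by (rule span_minimal) simp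
  moreover have "x \<in> S" unfolding S_def by (rule span_base, rule range_eqI[where x = 0]) simp
  ultimately show "x \<in> span (range (\<lambda>i. (pmap ^^ Suc i) x))" using fixed by blast
qed

text \<open>From \<open>pmap h = h\<close> the operator \<open>lie h\<close> equals its
  \<open>p\<close>-th power, so its eigenvalues lie in the prime field. If it were nonzero on
  \<open>T\<close>, there would be an eigenvector \<open>y'\<close> with nonzero eigenvalue. Then
  \<open>pmap y'\<close> and all later iterates commute with \<open>h\<close>, and so does
  \<open>y'\<close>, which is in their span.\<close>

lemma toral_fixed_central:
  assumes T: "toral T" and h: "h \<in> T" "pmap h = h" and y: "y \<in> T"
  shows "lie h y = 0"
proof (rule ccontr)
  assume nz: "lie h y \<noteq> 0"
  let ?p = "CHAR('a)"
  have p2: "?p \<ge> 2" using prime_CHAR by (rule prime_ge_2_nat)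
  have sub: "subspace T" "\<And>x y. x \<in> T \<Longrightarrow> y \<in> T \<Longrightarrow> lie x y \<in> T"
    using T by (auto simp: toral_def restricted_subalgebra_def)
  define f where "f = lie h"
  define z where "z = f y"
  have zT: "(f ^^ i) z \<in> T" for i by (induction i) (auto simp: z_def f_def h y sub(2))
  have fz: "(f ^^ (?p - 1)) z = z"
  proof -
    have "(f ^^ Suc (?p - 1)) y = f y" using lie_pmap[of h y] h(2) p2 by (simp add: f_def)
    then show ?thesis by (simp add: z_def funpow_swap1)
  qed
  \<comment> \<open>A multiple of the projection of \<open>z\<close> to the eigenspace of
    \<open>f\<close> for the eigenvalue \<open>1 / t\<close>, when
    \<open>t ^ (?p - 1) = 1\<close>.\<close>
  define v where "v = (\<lambda>t. \<Sum>i<?p - 1. t ^ i *s (f ^^ i) z)"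
  have "\<exists>t. t ^ (?p - 1) = 1 \<and> v t \<noteq> 0"
  proof (rule ccontr)
    assume "\<not> ?thesis"
    then have v0: "v t = 0" if "t ^ (?p - 1) = 1" for t using that by blast
    have "\<exists>b. representation Basis z b \<noteq> 0"
    proof (rule ccontr)
      assume "\<not> ?thesis"
      then have "z = 0"
        using sum_nonzero_representation_eq[OF independent_Basis, of z] span_Basis by simp
      then show False using nz by (simp add: z_def f_def)
    qed
    then obtain b where b: "representation Basis z b \<noteq> 0" by blast
    define \<phi> where "\<phi> = (\<lambda>x. representation Basis x b)"
    have \<phi>: "\<phi> (x + x') = \<phi> x + \<phi> x'" "\<phi> (c *s x) = c * \<phi> x" "\<phi> 0 = 0" for x x' c
      using independent_Basis span_Basis
      by (simp_all add: \<phi>_def representation_add representation_scale representation_zero)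
    have \<phi>_sum: "\<phi> (sum g A) = (\<Sum>i\<in>A. \<phi> (g i))" for g and A :: "nat set"
      by (induction A rule: infinite_finite_induct) (simp_all add: \<phi>)
    \<comment> \<open>If all projections vanished, \<open>q\<close> would have the
      \<open>?p - 1\<close> nonzero elements of the prime field as roots. Its degree is at most
      \<open>?p - 2\<close>, and its constant coefficient is nonzero by the choice of
      \<open>b\<close>.\<close>
    define q where "q = (\<Sum>i<?p - 1. monom (\<phi> ((f ^^ i) z)) i)"
    have pq: "poly q t = \<phi> (v t)" for t
      by (simp add: q_def v_def poly_sum poly_monom \<phi> \<phi>_sum mult.commute)
    have "coeff q 0 = \<phi> z" using p2 by (simp add: q_def coeff_sum)
    then have "q \<noteq> 0" using b by (auto simp: \<phi>_def)
    let ?R = "of_nat ` {1..<?p} :: 'a set"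
    have roots: "poly q t = 0" if t: "t \<in> ?R" for t
    proof -
      obtain k where k: "t = of_nat k" "0 < k" "k < ?p" using t by auto
      have "(of_nat k :: 'a) \<noteq> 0" using k of_nat_inj_char[of k 0, where 'k = 'a] by auto
      moreover have "t * t ^ (?p - 1) = t"
        using of_nat_power_char[OF prime_CHAR, of k 1] p2 by (simp add: k(1) power_Suc[symmetric] del: power_Suc)
      ultimately have "t ^ (?p - 1) = 1" using k(1) by simp
      then show ?thesis using v0 \<phi>(3) by (simp add: pq)
    qed
    have "inj_on (of_nat :: nat \<Rightarrow> 'a) {1..<?p}"
      by (rule inj_onI) (auto intro: of_nat_inj_char)
    then have "card ?R = ?p - 1" using card_image[of of_nat "{1..<?p}"] by simp
    then have "?p - 1 \<le> card {t. poly q t = 0}"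
      using card_mono[OF poly_roots_finite[OF \<open>q \<noteq> 0\<close>], of ?R] roots by auto
    also have "\<dots> \<le> degree q" using \<open>q \<noteq> 0\<close> by (rule card_poly_roots_bound)
    also have "degree q \<le> ?p - 2"
      by (rule degree_le) (auto simp: q_def coeff_sum intro!: sum.neutral)
    finally show False using p2 by simp
  qed
  then obtain t where t: "t ^ (?p - 1) = 1" "v t \<noteq> 0" by blast
  define y' where "y' = v t"
  have y'T: "y' \<in> T" unfolding y'_def v_def using sub(1) zT by (intro subspace_sum subspace_scale) auto
  have t0: "t \<noteq> 0" using t(1) p2 by (auto simp: power_0_left)
  have "t *s lie h y' = y'"
  proof -
    have "t *s lie h y' = (\<Sum>i<?p - 1. t ^ Suc i *s (f ^^ Suc i) z)"
      by (simp add: y'_def v_def f_def lie_sum_right lie_scale_right scale_sum_right)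
    also have "\<dots> = (\<Sum>i<Suc (?p - 1). t ^ i *s (f ^^ i) z) - z"
      by (subst sum.lessThan_Suc_shift) simp
    also have "\<dots> = y'" using t(1) fz by (simp add: y'_def v_def)
    finally show ?thesis .
  qed
  then have "lie y' (lie y' h) = 0"
  proof -
    have "t *s lie y' h = (- 1) *s y'"
      using \<open>t *s lie h y' = y'\<close> by (simp add: lie_antisym[of y' h])
    then have "t *s lie y' (lie y' h) = lie y' ((- 1) *s y')" by (simp only: lie_scale_right[symmetric])
    then have "t *s lie y' (lie y' h) = 0" by (simp only: lie_scale_right lie_self scale_zero_right)
    then show ?thesis using t0 by simp
  qed
  then have one: "lie (pmap y') h = 0"
  proof -
    have "(lie y' ^^ ?p) h = (lie y' ^^ (?p - 2)) (lie y' (lie y' h))"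
    proof -
      obtain k where "?p = Suc (Suc k)" using p2 by (metis add_2_eq_Suc le_Suc_ex)
      then show ?thesis by (simp add: funpow_swap1)
    qed
    then show ?thesis using \<open>lie y' (lie y' h) = 0\<close> by (simp add: lie_pmap)
  qed
  have "lie ((pmap ^^ Suc i) y') h = 0" for i
    using lie_pmap_funpow_zero[OF one, of i] by (simp add: funpow_swap1)
  then have "range (\<lambda>i. (pmap ^^ Suc i) y') \<subseteq> {x. lie x h = 0}" by auto
  moreover have "subspace {x. lie x h = 0}"
    by (rule subspaceI) (auto simp: lie_add_left lie_scale_left)
  ultimately have "lie y' h = 0"
    using toral_subset_span_pmap_orbit(3)[OF T y'T] span_minimal by blast
  then have "lie h y' = 0" by (rule lie_commute_zero)
  then show False using \<open>t *s lie h y' = y'\<close> t(2) by (simp add: y'_def)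
qed

lemma toral_fixed_basis:
  assumes T: "toral T"
  obtains B where "independent B" "card B = dim T" "span B = T"
    "\<And>h. h \<in> B \<Longrightarrow> pmap h = h" "\<And>h h'. h \<in> B \<Longrightarrow> h' \<in> B \<Longrightarrow> lie h h' = 0"
proof -
  let ?F = "{h \<in> T. pmap h = h}"
  obtain B where B: "B \<subseteq> ?F" "independent B" "?F \<subseteq> span B" "card B = dim ?F" by (rule basis_exists)
  have sub: "subspace T" using T by (auto simp: toral_def restricted_subalgebra_def)
  have "T \<subseteq> span ?F"
  proof
    fix x assume x: "x \<in> T"
    let ?S = "span (range (\<lambda>i. (pmap ^^ i) x))"
    have "x \<in> ?S" by (rule span_base, rule range_eqI[where x = 0]) simp
    moreover have "{h \<in> ?S. pmap h = h} \<subseteq> ?F" using toral_subset_span_pmap_orbit(1)[OF T x] by auto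
    ultimately show "x \<in> span ?F"
      using toral_subset_span_pmap_orbit(2)[OF T x] span_mono by blast
  qed
  also have "\<dots> \<subseteq> span B" using B(3) by (rule span_minimal) simp
  finally have "T \<subseteq> span B" .
  moreover have "span B \<subseteq> T" using B(1) sub by (intro span_minimal) auto
  ultimately have "span B = T" by simp
  moreover from this have "card B = dim T" using dim_span_eq_card_independent[OF B(2)] by simp
  ultimately show ?thesis using B toral_fixed_central[OF T] that[of B] by blast
qed

text \<open>The maximum is taken over a finite nonempty set: dimensions are bounded, and the zero
  subspace is toral.\<close>

lemma max_toral_dim_attained: "\<exists>T. toral T \<and> dim T = max_toral_dim"
proof -
  have "dim ` {T. toral T} \<subseteq> {..dimension}" using dim_subset_UNIV by auto
  then have "finite (dim ` {T. toral T})" by (rule finite_subset) simp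
  moreover have "toral {0}"
    by (auto simp: toral_def restricted_subalgebra_def subspace_single_0)
  ultimately have "max_toral_dim \<in> dim ` {T. toral T}"
    unfolding max_toral_dim_def by (intro Max_in) auto
  then show ?thesis by auto
qed

end

section \<open>Coordinates adapted to a maximal torus\<close>

context closed_restricted_lie_algebra
begin

lemma coordinates_exist:
  assumes B: "independent B"
  obtains bs X where "closed_coordinates scale (dim UNIV) bs X" "bs ` {..<card B} = B" "card B \<le> dim UNIV"
proof -
  define C where "C = extend_basis B"
  have C: "B \<subseteq> C" "independent C" "span C = UNIV"
    unfolding C_def by (simp_all add: extend_basis_superset[OF B] independent_extend_basis[OF B] span_extend_basis[OF B])
  have fin: "finite C" "finite B" using C(2) B by (simp_all add: finiteI_independent)
  have cardC: "card C = dim UNIV" using dim_span_eq_card_independent[OF C(2)] C(3) by simp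
  have le: "card B \<le> dim UNIV" using card_mono[OF fin(1) C(1)] cardC by simp
  let ?s = "card B" and ?n = "dim UNIV"
  obtain f where f: "bij_betw f {..<?s} B" using finite_same_card_bij[of "{..<?s}" B] fin by auto
  have "card (C - B) = card {?s..<?n}" using C(1) fin cardC by (simp add: card_Diff_subset)
  then obtain g where g: "bij_betw g {?s..<?n} (C - B)" using finite_same_card_bij[of "{?s..<?n}" "C - B"] fin by auto
  define bs where "bs = (\<lambda>i. if i < ?s then f i else g i)"
  have bs1: "bij_betw bs {..<?s} B" using f by (subst bij_betw_cong[of _ _ f]) (auto simp: bs_def)
  have bs2: "bij_betw bs {?s..<?n} (C - B)" using g by (subst bij_betw_cong[of _ _ g]) (auto simp: bs_def)
  have "bij_betw bs ({..<?s} \<union> {?s..<?n}) (B \<union> (C - B))"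
    using bs1 bs2 by (rule bij_betw_combine) auto
  moreover have "{..<?s} \<union> {?s..<?n} = {..<?n}" "B \<union> (C - B) = C" using le C(1) by auto
  ultimately have bs: "bij_betw bs {..<?n} C" by simp
  define X where "X = (\<lambda>i x. representation C x (bs i))"
  have "closed_coordinates scale ?n bs X"
  proof (rule closed_coordinates.intro, rule coordinates.intro, rule zariski_vector_space_axioms,
      rule coordinates_axioms.intro)
    show "infinite (UNIV :: 'a set)" by (rule infinite_alg_closed_field)
    show "Vector_Spaces.linear scale (*) (X i)" for i
      unfolding X_def using C(2,3) by (rule linear_representation)
    show "X i (bs j) = (if i = j then 1 else 0)" if "i < ?n" "j < ?n" for i j
      using bs that representation_basis[OF C(2), of "bs j"]
      by (auto simp: X_def bij_betw_def inj_on_def)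
    show "(\<Sum>i<?n. X i x *s bs i) = x" for x
      unfolding X_def sum.reindex_bij_betw[OF bs, of "\<lambda>b. representation C x b *s b"]
      using C fin by (intro sum_representation_eq) auto
  qed
  then show ?thesis using that bs1 le by (auto simp: bij_betw_def)
qed

end

locale restricted_lie_coordinates = closed_restricted_lie_algebra scale lie pmap Basis +
  closed_coordinates scale n bs X
  for scale :: "'a::alg_closed_field \<Rightarrow> 'b::ab_group_add \<Rightarrow> 'b" (infixr \<open>*s\<close> 75)
    and lie pmap Basis n bs X
begin

section \<open>The power map is polynomial\<close>

definition polynomial_map :: "('b \<Rightarrow> 'b) \<Rightarrow> bool" where
  "polynomial_map F \<longleftrightarrow> (\<forall>\<phi>. Vector_Spaces.linear scale (*) \<phi> \<longrightarrow> (\<lambda>x. \<phi> (F x)) \<in> polynomial_functions)"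

lemma polynomial_mapD:
  "polynomial_map F \<Longrightarrow> Vector_Spaces.linear scale (*) \<phi> \<Longrightarrow> (\<lambda>x. \<phi> (F x)) \<in> polynomial_functions"
  by (simp add: polynomial_map_def)

lemma polynomial_map_add:
  "polynomial_map F \<Longrightarrow> polynomial_map G \<Longrightarrow> polynomial_map (\<lambda>x. F x + G x)"
  by (auto simp: polynomial_map_def linear_functionalD intro: polynomial_functions.add)

lemma polynomial_map_scale:
  "f \<in> polynomial_functions \<Longrightarrow> polynomial_map F \<Longrightarrow> polynomial_map (\<lambda>x. f x *s F x)"
  by (auto simp: polynomial_map_def linear_functionalD intro: polynomial_functions.mult)

lemma polynomial_map_const: "polynomial_map (\<lambda>_. c)"
  by (auto simp: polynomial_map_def intro: polynomial_functions.const)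

lemma polynomial_map_sum:
  assumes "\<And>i. i \<in> A \<Longrightarrow> polynomial_map (F i)"
  shows "polynomial_map (\<lambda>x. \<Sum>i\<in>A. F i x)"
  using assms
proof (induction A rule: infinite_finite_induct)
  case (insert i A)
  then show ?case using polynomial_map_add[of "F i" "\<lambda>x. \<Sum>i\<in>A. F i x"] by simp
qed (simp_all add: polynomial_map_const)

lemma polynomial_map_lie:
  assumes F: "polynomial_map F" and G: "polynomial_map G"
  shows "polynomial_map (\<lambda>x. lie (F x) (G x))"
proof -
  have "lie (F x) (G x) = (\<Sum>i<n. \<Sum>j<n. (X i (F x) * X j (G x)) *s lie (bs i) (bs j))" for x
  proof -
    have "lie (F x) (G x) = lie (\<Sum>i<n. X i (F x) *s bs i) (\<Sum>j<n. X j (G x) *s bs j)"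
      by (simp only: X_expansion)
    also have "\<dots> = (\<Sum>i<n. lie (X i (F x) *s bs i) (\<Sum>j<n. X j (G x) *s bs j))" by (rule lie_sum_left)
    finally show ?thesis
      by (simp add: lie_sum_right lie_scale_left lie_scale_right scale_sum_right mult.commute)
  qed
  moreover have "polynomial_map (\<lambda>x. \<Sum>i<n. \<Sum>j<n. (X i (F x) * X j (G x)) *s lie (bs i) (bs j))"
    by (intro polynomial_map_sum polynomial_map_scale polynomial_map_const polynomial_functions.mult
        polynomial_mapD[OF F] polynomial_mapD[OF G] linear_X) auto
  ultimately show ?thesis by simp
qed

lemma polynomial_map_ad_coeff:
  assumes F: "polynomial_map F" and G: "polynomial_map G"
  shows "polynomial_map (\<lambda>x. ad_coeff (F x) (G x) (F x) m j)"
proof (induction m arbitrary: j)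
  case 0
  then show ?case using F by (cases "j = 0") (auto intro: polynomial_map_const)
next
  case (Suc m)
  show ?case
  proof (cases j)
    case 0
    then show ?thesis using polynomial_map_lie[OF G Suc.IH[of 0]] by simp
  next
    case (Suc j')
    then show ?thesis
      using polynomial_map_add[OF polynomial_map_lie[OF F Suc.IH[of j']] polynomial_map_lie[OF G Suc.IH[of j]]]
      by simp
  qed
qed

text \<open>Coordinates are added one at a time with Jacobson's formula, whose terms are iterated
  brackets and hence polynomial.\<close>

lemma polynomial_map_pmap: "polynomial_map pmap"
proof -
  have coord: "polynomial_map (\<lambda>x. X i x *s bs i)" if "i < n" for i
    using that by (intro polynomial_map_scale polynomial_map_const X_poly)
  have "polynomial_map (\<lambda>x. pmap (\<Sum>i<m. X i x *s bs i))" if "m \<le> n" for m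
    using that
  proof (induction m)
    case 0
    then show ?case by (simp add: polynomial_map_const)
  next
    case (Suc m)
    let ?F = "\<lambda>x. \<Sum>i<m. X i x *s bs i" and ?G = "\<lambda>x. X m x *s bs m"
    have F: "polynomial_map ?F" and G: "polynomial_map ?G"
      using Suc.prems coord by (auto intro!: polynomial_map_sum)
    have "polynomial_map (\<lambda>x. pmap (?F x) + X m x ^ CHAR('a) *s pmap (bs m) +
        (\<Sum>i = 1..<CHAR('a). inverse (of_nat i) *s ad_coeff (?F x) (?G x) (?F x) (CHAR('a) - 1) (i - 1)))"
      using Suc F G
      by (intro polynomial_map_add polynomial_map_sum polynomial_map_scale polynomial_map_const
          polynomial_map_ad_coeff polynomial_functions.const polynomial_functions_power X_poly) auto
    then show ?case by (simp add: pmap_add pmap_scale jacobson_term_def)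
  qed
  then have "polynomial_map (\<lambda>x. pmap (\<Sum>i<n. X i x *s bs i))" by blast
  then show ?thesis by (simp add: X_expansion)
qed

lemma polynomial_functions_pmap:
  "f \<in> polynomial_functions \<Longrightarrow> (\<lambda>x. f (pmap x)) \<in> polynomial_functions"
  by (erule polynomial_functions_compose_polynomial_map) (rule polynomial_mapD[OF polynomial_map_pmap])

lemma polynomial_functions_pmap_funpow:
  "f \<in> polynomial_functions \<Longrightarrow> (\<lambda>x. f ((pmap ^^ m) x)) \<in> polynomial_functions"
proof (induction m)
  case (Suc m)
  then show ?case using polynomial_functions_pmap[OF Suc.IH] by (simp add: funpow_swap1)
qed simp

section \<open>Generic independence of the iterates\<close>

context
  fixes s :: nat
  assumes s_le: "s \<le> n"
    and fixed: "i < s \<Longrightarrow> pmap (bs i) = bs i"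
    and commuting: "i < s \<Longrightarrow> j < s \<Longrightarrow> lie (bs i) (bs j) = 0"
begin

lemma X_pmap_funpow_torus:
  assumes x: "\<And>l. l \<in> {s..<n} \<Longrightarrow> X l x = 0" and j: "j < s"
  shows "X j ((pmap ^^ m) x) = X j x ^ (CHAR('a) ^ m)"
proof -
  have "x = (\<Sum>i<n. X i x *s bs i)" by (simp only: X_expansion)
  also have "\<dots> = (\<Sum>i<s. X i x *s bs i)"
    using x s_le by (intro sum.mono_neutral_right) auto
  finally have "(pmap ^^ m) x = (pmap ^^ m) (\<Sum>i<s. X i x *s bs i)" by (rule arg_cong)
  also have "\<dots> = (\<Sum>i<s. X i x ^ (CHAR('a) ^ m) *s bs i)"
    by (rule pmap_fixed_sum) (auto simp: fixed commuting)
  finally show ?thesis using X_comb[of j "{..<s}" "\<lambda>i. X i x ^ (CHAR('a) ^ m)"] j s_le by simp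
qed

text \<open>The argument behind the Moore determinant. Take a point of the torus whose coordinates
  are linearly independent over the prime field. A relation among its iterates yields an additive
  polynomial of degree below \<open>p ^ s\<close> that vanishes at the \<open>p ^ s\<close>
  combinations of the coordinates.\<close>

lemma independent_iterates_exist:
  "\<exists>x0. \<forall>\<alpha>. (\<Sum>i<s. \<alpha> i *s (pmap ^^ (i + r)) x0) = 0 \<longrightarrow> (\<forall>i<s. \<alpha> i = 0)"
proof -
  let ?p = "CHAR('a)"
  have p1: "?p > 1" using prime_CHAR by (rule prime_gt_1_nat)
  define V where "V = {..<s} \<rightarrow>\<^sub>E {..<?p}"
  have V: "finite V" "card V = ?p ^ s" by (simp_all add: V_def finite_PiE card_PiE)
  define L where "L = (\<lambda>c x. \<Sum>i<s. of_nat (c i) * X i x)"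
  define PP where "PP = {(c, c'). c \<in> V \<and> c' \<in> V \<and> c \<noteq> c'}"
  have "PP \<subseteq> V \<times> V" by (auto simp: PP_def)
  then have fin: "finite PP" using V by (auto intro: finite_subset)
  have L_pf: "L c \<in> polynomial_functions" for c
    unfolding L_def using s_le by (intro polynomial_functions_intros X_poly) auto
  have L_bs: "L c (bs i) = of_nat (c i)" if "i < s" for c i
    using that s_le by (auto simp: L_def X_bs if_distrib[of "\<lambda>t. _ * t"] cong: if_cong)
  have "\<exists>x\<in>UNIV. (\<Prod>cc\<in>PP. L (fst cc) x - L (snd cc) x) \<noteq> 0"
  proof (rule prime_set_prod[OF prime_set_UNIV fin])
    fix cc assume "cc \<in> PP"
    then obtain c c' where cc: "cc = (c, c')" "c \<in> V" "c' \<in> V" "c \<noteq> c'" by (auto simp: PP_def)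
    then obtain i where i: "i < s" "c i \<noteq> c' i" unfolding V_def by (metis PiE_ext lessThan_iff)
    then show "\<exists>x\<in>UNIV. L (fst cc) x - L (snd cc) x \<noteq> 0"
      using cc of_nat_inj_char[of "c i" "c' i", where 'k = 'a]
      by (intro bexI[of _ "bs i"]) (auto simp: L_bs V_def)
  qed (intro polynomial_functions_intros L_pf)
  then obtain x where x: "(\<Prod>cc\<in>PP. L (fst cc) x - L (snd cc) x) \<noteq> 0" by blast
  have inj: "inj_on (\<lambda>c. L c x) V"
  proof (rule inj_onI, rule ccontr)
    fix c c' assume "c \<in> V" "c' \<in> V" "L c x = L c' x" "c \<noteq> c'"
    then show False using x fin by (auto simp: PP_def prod_zero_iff)
  qed
  define x0 where "x0 = (\<Sum>i<s. X i x *s bs i)"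
  have X0: "X l x0 = (if l < s then X l x else 0)" if "l < n" for l
    using X_comb[OF that, of "{..<s}" "\<lambda>i. X i x"] s_le by (simp add: x0_def)
  show ?thesis
  proof (intro exI[of _ x0] allI impI)
    fix \<alpha> i assume \<alpha>: "(\<Sum>i<s. \<alpha> i *s (pmap ^^ (i + r)) x0) = 0" and i: "i < s"
    have rel: "(\<Sum>i<s. \<alpha> i * X j x ^ (?p ^ (i + r))) = 0" if j: "j < s" for j
    proof -
      have "0 = X j (\<Sum>i<s. \<alpha> i *s (pmap ^^ (i + r)) x0)"
        using j s_le linear_functionalD(3)[OF linear_X] by (simp add: \<alpha>)
      also have "\<dots> = (\<Sum>i<s. \<alpha> i * X j ((pmap ^^ (i + r)) x0))"
        using j s_le by (simp add: linear_functionalD[OF linear_X])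
      also have "\<dots> = (\<Sum>i<s. \<alpha> i * X j x ^ (?p ^ (i + r)))"
        using j s_le X_pmap_funpow_torus[of x0 j] X0 by simp
      finally show ?thesis by simp
    qed
    \<comment> \<open>Roots of the coefficients remove the shift by \<open>r\<close>, which would
      otherwise raise the degree beyond the number of known roots.\<close>
    have "\<forall>i. \<exists>\<beta>. \<beta> ^ (?p ^ r) = \<alpha> i" using nth_root_exists[of "?p ^ r"] p1 by fastforce
    then obtain \<beta> where \<beta>: "\<forall>i. \<beta> i ^ (?p ^ r) = \<alpha> i" by (rule choice[THEN exE])
    have rel': "(\<Sum>i<s. \<beta> i * X j x ^ (?p ^ i)) = 0" if j: "j < s" for j
    proof -
      have "(\<Sum>i<s. \<beta> i * X j x ^ (?p ^ i)) ^ (?p ^ r) = (\<Sum>i<s. (\<beta> i * X j x ^ (?p ^ i)) ^ (?p ^ r))"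
        by (rule freshmans_dream_sum'[OF prime_CHAR refl])
      also have "\<dots> = (\<Sum>i<s. \<alpha> i * X j x ^ (?p ^ (i + r)))"
        using \<beta> by (simp add: power_mult_distrib power_mult[symmetric] power_add)
      finally show ?thesis using rel[OF j] by simp
    qed
    define Q where "Q = (\<Sum>i<s. monom (\<beta> i) (?p ^ i))"
    have "poly Q (L c x) = 0" for c
    proof -
      have "poly Q (L c x) = (\<Sum>i<s. \<beta> i * (\<Sum>j<s. of_nat (c j) * X j x ^ (?p ^ i)))"
        by (simp add: Q_def poly_sum poly_monom L_def freshmans_dream_sum'[OF prime_CHAR refl]
            power_mult_distrib of_nat_power_char[OF prime_CHAR])
      also have "\<dots> = (\<Sum>j<s. of_nat (c j) * (\<Sum>i<s. \<beta> i * X j x ^ (?p ^ i)))"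
        unfolding sum_distrib_left by (subst sum.swap) (simp add: mult_ac)
      also have "\<dots> = 0" by (simp add: rel')
      finally show ?thesis .
    qed
    then have roots: "(\<lambda>c. L c x) ` V \<subseteq> {t. poly Q t = 0}" by blast
    have "Q = 0"
    proof (rule ccontr)
      assume nz: "Q \<noteq> 0"
      have "?p ^ s \<le> card {t. poly Q t = 0}"
        using card_mono[OF poly_roots_finite[OF nz] roots] card_image[OF inj] V by simp
      also have "\<dots> \<le> degree Q" using nz by (rule card_poly_roots_bound)
      also have "degree Q \<le> ?p ^ s - 1"
      proof (rule degree_le, intro allI impI)
        fix k assume k: "?p ^ s - 1 < k"
        have "?p ^ i \<noteq> k" if "i < s" for i
          using power_strict_increasing[OF that p1] k by linarith
        then show "coeff Q k = 0" by (auto simp: Q_def coeff_sum intro!: sum.neutral)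
      qed
      also have "\<dots> < ?p ^ s" using p1 by simp
      finally show False by simp
    qed
    moreover have "coeff Q (?p ^ i) = \<beta> i"
      using i p1 by (simp add: Q_def coeff_sum power_inject_exp)
    ultimately have "\<beta> i = 0" by simp
    then show "\<alpha> i = 0" using \<beta>[THEN spec, of i] p1 by (simp add: power_0_left)
  qed
qed

lemma dual_functionals_exist:
  assumes "\<And>\<alpha>. (\<Sum>i<s. \<alpha> i *s v i) = 0 \<Longrightarrow> \<forall>i<s. \<alpha> i = 0"
  shows "\<exists>\<phi>. \<forall>l<s. Vector_Spaces.linear scale (*) (\<phi> l) \<and> (\<forall>i<s. \<phi> l (v i) = (if i = l then 1 else 0))"
proof -
  interpret pair: vector_space_pair scale "(*) :: 'a \<Rightarrow> 'a \<Rightarrow> 'a"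
    by unfold_locales (simp_all add: algebra_simps)
  have inj: "inj_on v {..<s}"
  proof (rule inj_onI, rule ccontr)
    fix i j assume ij: "i \<in> {..<s}" "j \<in> {..<s}" "v i = v j" "i \<noteq> j"
    let ?\<alpha> = "\<lambda>l. (if l = i then 1 else 0) - (if l = j then 1 else 0 :: 'a)"
    have "(\<Sum>l<s. ?\<alpha> l *s v l) = 0"
      using ij by (simp add: scale_left_diff_distrib sum_subtractf if_distrib[of "\<lambda>a. a *s _"] cong: if_cong)
    from assms[OF this] show False using ij by auto
  qed
  have indep: "independent (v ` {..<s})"
  proof
    assume "dependent (v ` {..<s})"
    then obtain u where u: "\<exists>y\<in>v ` {..<s}. u y \<noteq> 0" "(\<Sum>y\<in>v ` {..<s}. u y *s y) = 0"
      by (auto simp: dependent_finite)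
    from u(2) have "(\<Sum>i<s. u (v i) *s v i) = 0" by (simp add: sum.reindex[OF inj])
    from assms[OF this] show False using u(1) by auto
  qed
  have "\<exists>g. Vector_Spaces.linear scale (*) g \<and> (\<forall>i<s. g (v i) = (if i = l then 1 else 0))" for l
  proof -
    obtain g where g: "Vector_Spaces.linear scale (*) g"
      "\<forall>y\<in>v ` {..<s}. g y = (if the_inv_into {..<s} v y = l then 1 else 0)"
      using pair.linear_independent_extend[OF indep, of "\<lambda>y. if the_inv_into {..<s} v y = l then 1 else 0"] by blast
    then show ?thesis using inj by (intro exI[of _ g]) (auto simp: the_inv_into_f_f)
  qed
  then show ?thesis by metis
qed

section \<open>The functions \<open>\<psi> i\<close> under the power map\<close>

context
  fixes \<psi> :: "nat \<Rightarrow> 'b \<Rightarrow> 'a" and e :: nat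
  assumes \<psi>_poly: "i < s \<Longrightarrow> \<psi> i \<in> polynomial_functions"
    and relation: "(pmap ^^ (s + e)) x = (\<Sum>i<s. \<psi> i x *s (pmap ^^ (i + e)) x)"
begin

text \<open>The differences \<open>\<delta> i\<close> are the coefficients of a relation among
  iterates that holds at every point. Near a point with independent iterates they vanish, and
  irreducibility of the whole space carries this to all points.\<close>

lemma \<psi>_pmap:
  assumes "i < s"
  shows "\<psi> i (pmap x) = \<psi> i x ^ CHAR('a)"
proof -
  let ?p = "CHAR('a)"
  define \<delta> where "\<delta> = (\<lambda>i x. \<psi> i (pmap x) - \<psi> i x ^ ?p)"
  have \<delta>_pf: "\<delta> i \<in> polynomial_functions" if "i < s" for i
    unfolding \<delta>_def using \<psi>_poly[OF that]
    by (intro polynomial_functions_intros polynomial_functions_pmap)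
  have sum0: "(\<Sum>i<s. \<delta> i x *s (pmap ^^ (i + Suc e)) x) = 0" for x
  proof -
    have "(\<Sum>i<s. \<psi> i (pmap x) *s (pmap ^^ (i + Suc e)) x) = (pmap ^^ (s + e)) (pmap x)"
      unfolding relation[of "pmap x"] by (simp add: funpow_swap1)
    also have "\<dots> = pmap ((pmap ^^ (s + e)) x)" by (simp add: funpow_swap1)
    also have "\<dots> = (\<Sum>i<s. \<psi> i x ^ ?p *s (pmap ^^ (i + Suc e)) x)"
      unfolding relation[of x]
      using pmap_sum_commuting[of "{..<s}" "\<lambda>i. (pmap ^^ (i + e)) x" "\<lambda>i. \<psi> i x"] by (simp add: lie_pmap_funpows)
    finally show ?thesis by (simp add: \<delta>_def scale_left_diff_distrib sum_subtractf)
  qed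
  obtain x0 where x0: "\<And>\<alpha>. (\<Sum>i<s. \<alpha> i *s (pmap ^^ (i + Suc e)) x0) = 0 \<Longrightarrow> \<forall>i<s. \<alpha> i = 0"
    using independent_iterates_exist[of "Suc e"] by blast
  obtain \<phi> where \<phi>: "\<And>l. l < s \<Longrightarrow> Vector_Spaces.linear scale (*) (\<phi> l)"
    "\<And>l i. l < s \<Longrightarrow> i < s \<Longrightarrow> \<phi> l ((pmap ^^ (i + Suc e)) x0) = (if i = l then 1 else 0)"
    using dual_functionals_exist[of "\<lambda>i. (pmap ^^ (i + Suc e)) x0", OF x0] by metis
  \<comment> \<open>The identity matrix minus the matrix of the functionals on the iterates. It
    vanishes at \<open>x0\<close> by duality, as the elimination lemma requires.\<close>
  define m where "m = (\<lambda>l i x. (if i = l then 1 else 0) - \<phi> l ((pmap ^^ (i + Suc e)) x))"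
  have "\<exists>w\<in>polynomial_functions. w x0 = 1 \<and> (\<forall>i<s. \<forall>z\<in>UNIV. w z * \<delta> i z = 0)"
  proof (rule elimination[OF function_ring_polynomial_functions, where m = m and u = "\<lambda>_. 1"])
    show "m l i \<in> polynomial_functions \<and> m l i x0 = 0" if "l < s" "i < s" for l i
    proof
      show "m l i \<in> polynomial_functions"
        unfolding m_def
        by (intro polynomial_functions_diff polynomial_functions.const polynomial_functions_pmap_funpow
            polynomial_functions.functional \<phi>(1) that(1))
      show "m l i x0 = 0" unfolding m_def \<phi>(2)[OF that] by simp
    qed
    fix l x assume l: "l < s"
    have "(\<Sum>i<s. \<phi> l ((pmap ^^ (i + Suc e)) x) * \<delta> i x) = 0"
      using arg_cong[OF sum0[of x], of "\<phi> l"] by (simp add: linear_functionalD[OF \<phi>(1)[OF l]] mult.commute)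
    then show "1 * \<delta> l x = (\<Sum>i<s. m l i x * \<delta> i x)"
      using l by (simp add: m_def left_diff_distrib sum_subtractf if_distrib[of "\<lambda>a. a * _"] cong: if_cong)
  qed (auto intro: polynomial_functions.const)
  then obtain w where w: "w \<in> polynomial_functions" "w x0 = 1" "\<And>i z. i < s \<Longrightarrow> w z * \<delta> i z = 0" by blast
  have "\<delta> i x = 0"
  proof (rule prime_setD[OF prime_set_UNIV w(1) \<delta>_pf])
    show "\<exists>x\<in>UNIV. w x \<noteq> 0" using w(2) by (intro bexI[of _ x0]) simp_all
  qed (use w(3) assms in auto)
  then show ?thesis by (simp add: \<delta>_def)
qed

lemma nilpotent_variety_eq:
  assumes \<psi>0: "\<And>i. i < s \<Longrightarrow> \<psi> i 0 = 0"
  shows "nilpotent_variety = {x. \<forall>i<s. \<psi> i x = 0}"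
proof (intro equalityI subsetI)
  fix x assume "x \<in> nilpotent_variety"
  then obtain N where N: "(pmap ^^ N) x = 0" by (auto simp: nilpotent_variety_def)
  have "\<psi> i ((pmap ^^ m) x) = \<psi> i x ^ (CHAR('a) ^ m)" if "i < s" for i m
    by (induction m) (simp_all add: \<psi>_pmap[OF that] power_mult[symmetric] mult.commute)
  then have "\<psi> i x ^ (CHAR('a) ^ N) = 0" if "i < s" for i
    using that N \<psi>0 by metis
  then show "x \<in> {x. \<forall>i<s. \<psi> i x = 0}" by simp
next
  fix x assume "x \<in> {x. \<forall>i<s. \<psi> i x = 0}"
  then have zero: "(pmap ^^ (s + e)) x = 0" by (simp add: relation)
  have "(pmap ^^ N) x = 0" if "N \<ge> s + e" for N
  proof -
    have "(pmap ^^ N) x = (pmap ^^ (N - (s + e))) ((pmap ^^ (s + e)) x)"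
      using that by (simp add: funpow_add[symmetric, THEN fun_cong, unfolded comp_def])
    then show ?thesis by (simp add: zero)
  qed
  then show "x \<in> nilpotent_variety" by (auto simp: nilpotent_variety_def)
qed

text \<open>On the torus the power map raises each coordinate to the power \<open>p\<close>, so the
  coordinates of the given identity are the equations of the additive polynomial.\<close>

lemma parameter_system_\<psi>:
  assumes \<psi>: "\<And>i. i < s \<Longrightarrow> \<psi> i \<in> homogeneous_polynomial_functions (CHAR('a) ^ (s + e) - CHAR('a) ^ (i + e))"
  shows "parameter_system scale n bs X s (\<lambda>j. CHAR('a) ^ (s + e) - CHAR('a) ^ (j + e)) \<psi>"
proof (rule parameter_system_if_torus_relation[OF refl prime_CHAR s_le homogeneous_polys[OF \<psi>]])
  fix x i assume x: "\<And>l. l \<in> {s..<n} \<Longrightarrow> X l x = 0" and i: "i < s"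
  have "X i x ^ CHAR('a) ^ (s + e) = X i ((pmap ^^ (s + e)) x)"
    using X_pmap_funpow_torus[OF x i] by simp
  also have "\<dots> = (\<Sum>l<s. \<psi> l x * X i ((pmap ^^ (l + e)) x))"
    using i s_le by (simp add: relation linear_functionalD[OF linear_X])
  also have "\<dots> = (\<Sum>l<s. \<psi> l x * X i x ^ CHAR('a) ^ (l + e))"
    using X_pmap_funpow_torus[OF x i] by simp
  finally show "X i x ^ CHAR('a) ^ (s + e) = (\<Sum>l<s. \<psi> l x * X i x ^ CHAR('a) ^ (l + e))" .
qed

end

end

end

theorem theorem4p2:
  fixes scale :: "'k::alg_closed_field \<Rightarrow> 'l::ab_group_add \<Rightarrow> 'l"
    and lie :: "'l \<Rightarrow> 'l \<Rightarrow> 'l"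
    and pmap :: "'l \<Rightarrow> 'l"
    and Basis :: "'l set"
    and p n e s :: nat
    and \<psi> :: "nat \<Rightarrow> 'l \<Rightarrow> 'k"
  assumes "CHAR('k) = p" and "p > 0"
    and "restricted_lie_algebra scale lie pmap"
    and "finite_dimensional_vector_space scale Basis"
    and "n = vector_space.dim scale (UNIV :: 'l set)"
    and "e = restricted_lie_algebra.e_invariant scale lie pmap"
    and "s = restricted_lie_algebra.max_toral_dim scale lie pmap"
    and "\<And>i. i < s \<Longrightarrow>
      \<psi> i \<in> zariski_vector_space.homogeneous_polynomial_functions scale (p ^ (s + e) - p ^ (i + e))"
    and "\<And>x. (pmap ^^ (s + e)) x = (\<Sum>i<s. scale (\<psi> i x) ((pmap ^^ (i + e)) x))"
  shows "(\<forall>x. \<forall>i<s. \<psi> i (pmap x) = \<psi> i x ^ p)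
    \<and> restricted_lie_algebra.nilpotent_variety pmap = {x. \<forall>i<s. \<psi> i x = 0}
    \<and> (\<forall>Z \<in> irreducible_components
            (subtopology (zariski_vector_space.zariski scale) (restricted_lie_algebra.nilpotent_variety pmap)).
          krull_dimension (subtopology (zariski_vector_space.zariski scale) Z) = enat (n - s))"
proof -
  interpret L: closed_restricted_lie_algebra scale lie pmap Basis
    using assms(3,4) by (rule closed_restricted_lie_algebra.intro)
  obtain T where T: "L.toral T" "L.dim T = s" using L.max_toral_dim_attained assms(7) by blast
  obtain B where B: "L.independent B" "card B = s" "\<And>h. h \<in> B \<Longrightarrow> pmap h = h"
    "\<And>h h'. h \<in> B \<Longrightarrow> h' \<in> B \<Longrightarrow> lie h h' = 0"
    using L.toral_fixed_basis[OF T(1)] T(2) by metis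
  obtain bs X where C: "closed_coordinates scale n bs X" "bs ` {..<s} = B" "s \<le> n"
    using L.coordinates_exist[OF B(1)] B(2) assms(5) by metis
  interpret C: restricted_lie_coordinates scale lie pmap Basis n bs X
    using L.closed_restricted_lie_algebra_axioms C(1) by (rule restricted_lie_coordinates.intro)
  have fixed: "pmap (bs i) = bs i" if "i < s" for i using B(3) C(2) that by blast
  have comm: "lie (bs i) (bs j) = 0" if "i < s" "j < s" for i j using B(4) C(2) that by blast
  note \<psi>_pf = L.homogeneous_polynomial_function[OF assms(8)]
  have pos: "p ^ (s + e) - p ^ (i + e) > 0" if "i < s" for i
    using that prime_gt_1_nat[OF L.prime_CHAR] assms(1) by simp
  have \<psi>0: "\<psi> i 0 = 0" if "i < s" for i using L.homogeneous_at_0[OF assms(8)[OF that] pos[OF that]] .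
  have part1: "\<psi> i (pmap x) = \<psi> i x ^ p" if "i < s" for i x
    using C.\<psi>_pmap[OF C(3) fixed comm \<psi>_pf assms(9) that] assms(1) by simp
  have part2: "L.nilpotent_variety = {x. \<forall>i<s. \<psi> i x = 0}"
    by (rule C.nilpotent_variety_eq[OF C(3) fixed comm \<psi>_pf assms(9) \<psi>0])
  interpret P: parameter_system scale n bs X s "\<lambda>j. p ^ (s + e) - p ^ (j + e)" \<psi>
    using C.parameter_system_\<psi>[OF C(3) fixed comm \<psi>_pf assms(9)] assms(1,8) by simp
  have "P.N = L.nilpotent_variety" by (simp add: part2 P.N_def)
  then show ?thesis using part1 part2 P.krull_dimension_component by simp
qed

end
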